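(* Let $a\ge 2$ be an integer and let $\mu$ be a Borel probability measure on $[0,1]$ which is $T_a$-ergodic and of intermediate dimension. Then there exists $n\in\mathbb{N}$ such that the following hold. (i) If $f\in\mathrm{diff}(\mathbb{R})$ and $E\subseteq\mathbb{R}$ is a Borel set with $(f\mu)|_E\sim\mu|_E$, then $$f'(x)\in\{\pm a^{k/n}: k\in\mathbb{Z}\}\quad\text{for } \mu\text{-a.e. } x\in f^{-1}E.$$ (ii) More generally, if $\nu$ is another $T_a$-ergodic probability measure, $f\in\mathrm{diff}(\mathbb{R})$, and $E\subseteq\mathbb{R}$ is a Borel set with $(f\mu)|_E\sim\nu|_E$, then there exists $t\in\mathbb{R}$ such that $$f'(x)\in\{\pm t\cdot a^{k/n}: k\in\mathbb{Z}\}\quad\text{for } \mu\text{-a.e. } x\in f^{-1}E.$$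
   Context: $T_a:[0,1]\to[0,1]$ is $T_a(x)=ax\bmod 1$. A measure is $T_a$-ergodic if it is $T_a$-invariant and ergodic. Measures on $[0,1]$ are regarded as measures on $\mathbb{R}$. $f\mu$ is the push-forward, $f\mu(A)=\mu(f^{-1}A)$; $\mu|_E(A)=\mu(A\cap E)$; $\sim$ denotes equivalence of measures (mutual absolute continuity). $\mathrm{diff}(\mathbb{R})$ is the set of ($C^1$) diffeomorphisms of $\mathbb{R}$. The local dimension of $\mu$ at $x$ is $D(\mu,x)=\lim_{r\to0}\log\mu(B_r(x))/\log r$, where $B_r(x)$ is the ball of radius $r$ about $x$; $\mu$ has intermediate dimension if $D(\mu,x)$ exists and $0<D(\mu,x)<1$ for $\mu$-a.e. $x$. $\mathbb{N}=\{1,2,3,\dots\}$. *)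

theory Defs
  imports "HOL-Probability.Probability"
begin

definition T :: "int \<Rightarrow> real \<Rightarrow> real" where
  "T a x = frac (of_int a * x)"

text \<open>A Borel probability measure on \<open>[0,1]\<close>, regarded as a measure on the real line, is a Borel
  probability measure on the real line concentrated on \<open>[0,1]\<close>.\<close>

definition prob_on_unit :: "real measure \<Rightarrow> bool" where
  "prob_on_unit \<mu> \<longleftrightarrow> prob_space \<mu> \<and> sets \<mu> = sets borel \<and> measure \<mu> {0..1} = 1"

text \<open>The dynamical system lives on \<open>[0,1]\<close>, so invariant sets are subsets of \<open>[0,1]\<close> and preimages
  are taken there. Invariance of \<open>\<mu>\<close> may use \<open>T a\<close> on the whole line, since \<open>\<mu>\<close> gives no mass to
  the complement of \<open>[0,1]\<close>.\<close>

definition T_ergodic :: "int \<Rightarrow> real measure \<Rightarrow> bool" where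
  "T_ergodic a \<mu> \<longleftrightarrow>
     prob_on_unit \<mu> \<and> distr \<mu> borel (T a) = \<mu> \<and>
     (\<forall>A \<in> sets borel. A \<subseteq> {0..1} \<longrightarrow> {x \<in> {0..1}. T a x \<in> A} = A \<longrightarrow>
        measure \<mu> A = 0 \<or> measure \<mu> A = 1)"

text \<open>\<open>has_local_dim \<mu> x d\<close>: the limit \<open>D(\<mu>,x)\<close> exists and equals \<open>d\<close>. Outside the support of \<open>\<mu>\<close>,
  where the conventional value is \<open>\<infinity>\<close>, the library convention \<open>ln 0 = 0\<close> makes the limit \<open>0\<close>; neither
  value lies strictly between \<open>0\<close> and \<open>1\<close>.\<close>

definition has_local_dim :: "real measure \<Rightarrow> real \<Rightarrow> real \<Rightarrow> bool" where
  "has_local_dim \<mu> x d \<longleftrightarrow> ((\<lambda>r. ln (measure \<mu> (ball x r)) / ln r) \<longlongrightarrow> d) (at_right 0)"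

definition intermediate_dimension :: "real measure \<Rightarrow> bool" where
  "intermediate_dimension \<mu> \<longleftrightarrow> (AE x in \<mu>. \<exists>d. has_local_dim \<mu> x d \<and> 0 < d \<and> d < 1)"

definition diffeos :: "(real \<Rightarrow> real) set" where
  "diffeos = {f. bij f \<and> f C1_differentiable_on UNIV \<and> inv f C1_differentiable_on UNIV}"

text \<open>The measure \<open>A \<mapsto> \<mu>(A \<inter> E)\<close>, still a measure on the whole space; see
  \<open>emeasure_restricted\<close>.\<close>

definition restr :: "'a measure \<Rightarrow> 'a set \<Rightarrow> 'a measure" where
  "restr \<mu> E = density \<mu> (indicator E)"

definition equiv_measures :: "'a measure \<Rightarrow> 'a measure \<Rightarrow> bool" where
  "equiv_measures \<mu> \<nu> \<longleftrightarrow>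
     sets \<mu> = sets \<nu> \<and> absolutely_continuous \<mu> \<nu> \<and> absolutely_continuous \<nu> \<mu>"

end

theory Submission
  imports Defs
begin

text \<open>Let \<open>\<eta>(x, n)\<close> be the conditional measure of \<open>\<mu>\<close> on the cell of order \<open>n\<close> of \<open>x\<close> in base \<open>a\<close>,
  rescaled by \<open>T\<^sup>n\<close>. If \<open>f\<close> carries a part of \<open>\<mu>\<close> of positive mass into \<open>\<mu>\<close>, then at a typical \<open>x\<close>
  in this part the orbit of \<open>f x\<close> equidistributes for \<open>\<mu>\<close>, and \<open>e (k a\<^sup>n f y)\<close> may be replaced by its
  conditional mean on the cell of \<open>x\<close>, on which \<open>a\<^sup>n f\<close> is nearly affine with slope \<open>f' x\<close>. Hence the
  \<open>k\<close>-th Fourier coefficient of \<open>\<mu>\<close> is bounded by the average over \<open>n\<close> of the modulus of the Fourier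
  transform of \<open>\<eta>(x, n)\<close> at the frequency \<open>k f' x\<close>, and this average does not depend on \<open>x\<close>.

  The logarithms of slopes of such maps, up to multiples of \<open>ln a\<close>, form a closed semigroup, hence
  either \<open>(ln a / n) \<int>\<close> or the whole line. In the latter case the bound holds at all frequencies. Positive
  dimension means that the measures \<open>\<eta>(x, n)\<close> have no atoms in the limit, so by Wiener's lemma the bound
  averages to zero over the frequencies; then \<open>\<mu>\<close> has no nonzero Fourier coefficients besides the
  trivial one, which is impossible in dimension less than \<open>1\<close>.\<close>

section \<open>Birkhoff averages\<close>

text \<open>The phase of \<open>X n\<close> at the base point is out of control, so only moduli of
  conditional means can be compared. This suffices, as Wiener's lemma concerns moduli too, and it
  removes the sign of the slope, since conjugation preserves moduli. That the averages do not depend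
  on \<open>x\<close> is, in substance, martingale convergence in the natural extension. It is
  obtained from a monotone quantity instead: \<open>cond \<phi> m\<close> after \<open>k\<close>
  steps and \<open>cond \<phi> (m + k)\<close> are projections of one function onto nested finite
  partitions, so their squared distance is a difference of energies, which increase and are bounded.
  Elementary conditional means over finite partitions thus take the place of disintegrations, and a
  bound on the inverse conditional masses that of entropy. Slopes come from maps that are absolutely
  continuous in one direction, which compose well; a shift by \<open>ln a\<close> is free and makes
  up for the inverses. Part (ii) goes into \<open>\<nu>\<close> along \<open>f\<close> and back
  along \<open>inv f\<close>, so that quotients of slopes belong to \<open>\<mu>\<close> alone and
  one \<open>n\<close> serves all \<open>\<nu>\<close>.\<close>

locale times_ergodic =
  fixes a :: int and \<mu> :: "real measure"
  assumes a_ge_2: "a \<ge> 2" and ergodic: "T_ergodic a \<mu>"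
begin

sublocale prob_space \<mu>
  using ergodic unfolding T_ergodic_def prob_on_unit_def by simp

lemma sets_eq [measurable_cong, simp]: "sets \<mu> = sets borel"
  using ergodic unfolding T_ergodic_def prob_on_unit_def by simp

lemma space_eq [simp]: "space \<mu> = UNIV"
  using sets_eq_imp_space_eq[OF sets_eq] by simp

lemma prob_UNIV [simp]: "measure \<mu> UNIV = 1"
  using prob_space by simp

lemma measurable_mu [simp]: "measurable \<mu> N = measurable borel N"
  by (rule measurable_cong_sets) auto

lemma T_measurable [measurable]: "T a \<in> borel_measurable borel"
  unfolding T_def frac_def by measurable

text \<open>\<open>Tn 0\<close> is \<open>frac\<close>, not the identity; in exchange
  \<open>a ^ n * x\<close> splits exactly into \<open>Tn n x\<close> and an integer, at every real
  \<open>x\<close>.\<close>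

definition Tn :: "nat \<Rightarrow> real \<Rightarrow> real"
  where "Tn n x = frac (of_int a ^ n * x)"

lemma Tn_measurable [measurable]: "Tn n \<in> borel_measurable borel"
  unfolding Tn_def frac_def by measurable

lemma Tn_range: "0 \<le> Tn n x" "Tn n x < 1"
  unfolding Tn_def by (auto simp: frac_lt_1)

lemma frac_mult_frac: "frac (of_int k * frac y) = frac (of_int k * (y :: real))"
proof -
  have "of_int k * frac y = of_int k * y - of_int (k * \<lfloor>y\<rfloor>)"
    by (simp add: frac_def algebra_simps)
  then show ?thesis
    unfolding frac_def by (simp only: floor_diff_of_int)
qed

lemma Tn_add: "Tn m (Tn n x) = Tn (m + n) x"
  using frac_mult_frac[of "a ^ m" "of_int a ^ n * x"]
  unfolding Tn_def by (simp add: power_add mult.assoc)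

lemma Tn_T: "Tn n (T a x) = Tn (Suc n) x"
  using Tn_add[of n 1 x] by (simp add: T_def Tn_def)

lemma distr_T: "distr \<mu> borel (T a) = \<mu>"
  using ergodic unfolding T_ergodic_def by simp

text \<open>The point 1 carries no mass, since \<open>T a\<close> takes values below 1 and preserves
  \<open>\<mu>\<close>. So half-open cells cover almost everything.\<close>

lemma AE_unit: "AE x in \<mu>. x \<in> {0..<1}"
proof -
  have "AE x in distr \<mu> borel (T a). x < 1"
    by (subst AE_distr_iff) (auto simp: T_def frac_lt_1)
  moreover have "AE x in \<mu>. x \<in> {0..1}"
    using ergodic unfolding T_ergodic_def prob_on_unit_def by (intro AE_prob_1) simp
  ultimately show ?thesis
    unfolding distr_T by (auto elim: AE_mp)
qed

lemma AE_Tn_0: "AE x in \<mu>. Tn 0 x = x"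
  using AE_unit by eventually_elim (simp add: Tn_def frac_eq)

lemma distr_Tn: "distr \<mu> borel (Tn n) = \<mu>"
proof (induction n)
  case 0
  have "distr \<mu> borel (Tn 0) = distr \<mu> borel (\<lambda>x. x)"
    using AE_Tn_0 by (intro distr_cong_AE) auto
  also have "\<dots> = distr \<mu> \<mu> (\<lambda>x. x)"
    by (rule distr_cong) auto
  finally show ?case by simp
next
  case (Suc n)
  have "distr \<mu> borel (Tn (Suc n)) = distr \<mu> borel (Tn n \<circ> T a)"
    by (simp add: Tn_T o_def)
  also have "\<dots> = distr (distr \<mu> borel (T a)) borel (Tn n)"
    by (subst distr_distr) auto
  finally show ?case using Suc by (simp add: distr_T)
qed

lemma integral_Tn:
  fixes f :: "real \<Rightarrow> 'b::{banach, second_countable_topology}"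
  assumes [measurable]: "f \<in> borel_measurable borel"
  shows "(\<integral>x. f (Tn n x) \<partial>\<mu>) = (\<integral>x. f x \<partial>\<mu>)"
  using integral_distr[of "Tn n" \<mu> borel f] by (simp add: distr_Tn)

lemma integral_T:
  fixes f :: "real \<Rightarrow> 'b::{banach, second_countable_topology}"
  assumes [measurable]: "f \<in> borel_measurable borel"
  shows "(\<integral>x. f (T a x) \<partial>\<mu>) = (\<integral>x. f x \<partial>\<mu>)"
  using integral_distr[of "T a" \<mu> borel f] by (simp add: distr_T)

lemma integrable_bounded:
  fixes f :: "real \<Rightarrow> 'b::{banach, second_countable_topology}"
  assumes "f \<in> borel_measurable borel" "\<And>x. norm (f x) \<le> B"
  shows "integrable \<mu> f"
  by (rule integrable_const_bound[of _ B]) (use assms in auto)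

text \<open>Garsia's argument: on the invariant set where the Birkhoff sums are unbounded, the running
  maxima \<open>M n\<close> satisfy \<open>M (n + 1) - M n \<circ> T = \<phi>\<close> for large \<open>n\<close>, so the
  mean of \<open>\<phi>\<close> cannot be negative if this set is conull.\<close>

lemma birkhoff_sums_bdd_above:
  fixes \<phi> :: "real \<Rightarrow> real"
  assumes [measurable]: "\<phi> \<in> borel_measurable borel" and bound: "\<And>x. \<bar>\<phi> x\<bar> \<le> B"
    and neg: "(\<integral>x. \<phi> x \<partial>\<mu>) < 0"
  shows "AE x in \<mu>. bdd_above (range (\<lambda>n. \<Sum>i<n. \<phi> (Tn i x)))"
proof -
  define S where "S n x = (\<Sum>i<n. \<phi> (Tn i x))" for n x
  have S_meas [measurable]: "S n \<in> borel_measurable borel" for n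
    unfolding S_def by measurable
  have S_Suc: "S (Suc n) x = \<phi> (Tn 0 x) + S n (T a x)" for n x
    unfolding S_def Tn_T by (rule sum.lessThan_Suc_shift)
  have S_unb_iff: "bdd_above (range (\<lambda>n. S n (T a x))) = bdd_above (range (\<lambda>n. S n x))" for x
  proof
    assume "bdd_above (range (\<lambda>n. S n (T a x)))"
    then obtain K where K: "S n (T a x) \<le> K" for n
      by (auto simp: bdd_above_def)
    have "S n x \<le> max 0 (\<phi> (Tn 0 x) + K)" for n
    proof (cases n)
      case (Suc m)
      then show ?thesis unfolding Suc S_Suc using K[of m] by (intro max.coboundedI2 add_left_mono)
    qed (simp add: S_def)
    then show "bdd_above (range (\<lambda>n. S n x))" by (auto simp: bdd_above_def)
  next
    assume "bdd_above (range (\<lambda>n. S n x))"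
    then obtain K where K: "S n x \<le> K" for n
      by (auto simp: bdd_above_def)
    have "S n (T a x) \<le> K - \<phi> (Tn 0 x)" for n
      using K[of "Suc n"] by (auto simp: S_Suc)
    then show "bdd_above (range (\<lambda>n. S n (T a x)))" by (auto simp: bdd_above_def)
  qed
  \<comment> \<open>Restricted to the unit interval, because ergodicity speaks of strictly invariant
    subsets of it.\<close>
  define E where "E = {x \<in> {0..1}. \<not> bdd_above (range (\<lambda>n. S n x))}"
  \<comment> \<open>A countable description, for measurability.\<close>
  have unb: "\<not> bdd_above (range (\<lambda>n. S n x)) \<longleftrightarrow> (\<forall>k::nat. \<exists>n. S n x > real k)" for x
  proof
    assume "\<not> bdd_above (range (\<lambda>n. S n x))"
    then show "\<forall>k::nat. \<exists>n. S n x > real k"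
      unfolding bdd_above_def by (auto simp: not_le)
  next
    assume *: "\<forall>k::nat. \<exists>n. S n x > real k"
    show "\<not> bdd_above (range (\<lambda>n. S n x))"
    proof
      assume "bdd_above (range (\<lambda>n. S n x))"
      then obtain K where K: "S n x \<le> K" for n
        by (auto simp: bdd_above_def)
      obtain k :: nat where "K \<le> real k" using real_arch_simple by blast
      then show False using * K by (meson leD order_trans)
    qed
  qed
  have E_meas [measurable]: "E \<in> sets borel"
    unfolding E_def unb by measurable
  have "{x \<in> {0..1}. T a x \<in> E} = E"
    unfolding E_def using S_unb_iff by (auto simp: T_def frac_lt_1 less_imp_le)
  then have "measure \<mu> E = 0 \<or> measure \<mu> E = 1"
    using ergodic E_meas unfolding T_ergodic_def by (metis (no_types, lifting) E_def mem_Collect_eq subsetI)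
  moreover have "measure \<mu> E \<noteq> 1"
  proof
    assume "measure \<mu> E = 1"
    then have AE_E: "AE x in \<mu>. x \<in> E" by (rule AE_prob_1)
    \<comment> \<open>\<open>M n\<close> is the maximum of \<open>S 0\<close>, ...,
      \<open>S n\<close>, written as a recursion over functions.\<close>
    define M where "M = rec_nat (\<lambda>x. 0 :: real) (\<lambda>n m x. max 0 (\<phi> (Tn 0 x) + m (T a x)))"
    have M_0: "M 0 x = 0" and M_Suc: "M (Suc n) x = max 0 (\<phi> (Tn 0 x) + M n (T a x))" for n x
      by (auto simp: M_def)
    have M_fun: "M 0 = (\<lambda>x. 0)" "M (Suc n) = (\<lambda>x. max 0 (\<phi> (Tn 0 x) + M n (T a x)))" for n
      by (auto simp: M_def)
    have M_meas [measurable]: "M n \<in> borel_measurable borel" for n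
      by (induction n) (auto simp: M_fun)
    have M_nonneg: "0 \<le> M n x" for n x
      by (cases n) (auto simp: M_0 M_Suc)
    have B0: "0 \<le> B" using bound[of 0] by linarith
    have M_le: "\<bar>M n x\<bar> \<le> real n * B" for n x
    proof (induction n arbitrary: x)
      case (Suc n)
      then show ?case using bound[of "Tn 0 x"] B0 Suc[of "T a x"] M_nonneg[of n "T a x"]
        by (auto simp: M_Suc algebra_simps)
    qed (simp add: M_0)
    have M_mono: "M n x \<le> M (Suc n) x" for n x
    proof (induction n arbitrary: x)
      case (Suc n)
      have "\<phi> (Tn 0 x) + M n (T a x) \<le> \<phi> (Tn 0 x) + M (Suc n) (T a x)"
        using Suc by simp
      then show ?case
        unfolding M_Suc[of n x] M_Suc[of "Suc n" x] by (intro max.mono) auto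
    qed (auto simp: M_0 M_Suc)
    have M_incseq: "incseq (\<lambda>n. M n x)" for x
      using M_mono by (auto simp: incseq_Suc_iff)
    have M_ge_S: "S n x \<le> M n x" for n x
    proof (induction n arbitrary: x)
      case (Suc n)
      show ?case
        unfolding M_Suc S_Suc using Suc by (intro max.coboundedI2 add_left_mono)
    qed (simp add: M_0 S_def)
    have [simp]: "integrable \<mu> (M n)" for n
      using M_le by (intro integrable_bounded[of _ "real n * B"]) auto
    have [simp]: "integrable \<mu> (\<lambda>x. M n (T a x))" for n
      using M_le by (intro integrable_bounded[of _ "real n * B"]) auto
    define d where "d n x = M (Suc n) x - M n (T a x)" for n x
    have d_eq: "d n x = max (- M n (T a x)) (\<phi> (Tn 0 x))" for n x
      unfolding d_def M_Suc by (auto simp: max_def)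
    \<comment> \<open>Monotonicity of \<open>M\<close>; invariance turns the second integral into
      that of \<open>M n\<close> after \<open>T a\<close>, and so the difference into the integral
      of \<open>d n\<close>.\<close>
    have "0 \<le> (\<integral>x. M (Suc n) x - M n x \<partial>\<mu>)" for n
      using M_mono by (intro integral_nonneg_AE) auto
    then have d_nonneg: "0 \<le> (\<integral>x. d n x \<partial>\<mu>)" for n
      unfolding d_def by (simp add: integral_T)
    have "(\<lambda>n. \<integral>x. d n x \<partial>\<mu>) \<longlonglongrightarrow> (\<integral>x. \<phi> (Tn 0 x) \<partial>\<mu>)"
    proof (rule integral_dominated_convergence[where w = "\<lambda>_. B"])
      show "AE x in \<mu>. (\<lambda>n. d n x) \<longlonglongrightarrow> \<phi> (Tn 0 x)"
        using AE_E
      proof eventually_elim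
        case (elim x)
        then have "\<not> bdd_above (range (\<lambda>n. S n (T a x)))"
          using S_unb_iff by (auto simp: E_def)
        then obtain n where "S n (T a x) > B"
          unfolding bdd_above_def by (auto simp: not_le)
        then have n: "M n (T a x) > B" using M_ge_S less_le_trans by blast
        have "d m x = \<phi> (Tn 0 x)" if "m \<ge> n" for m
        proof -
          have "M m (T a x) > B"
            using n M_incseq[of "T a x"] that by (meson incseqD less_le_trans)
          then show ?thesis using bound[of "Tn 0 x"] unfolding d_eq by auto
        qed
        then show ?case
          by (intro tendsto_eventually) (auto simp: eventually_sequentially)
      qed
      show "AE x in \<mu>. norm (d n x) \<le> B" for n
      proof (intro AE_I2)
        fix x
        show "norm (d n x) \<le> B"
        proof -
          have 1: "\<phi> (Tn 0 x) \<le> B" "- B \<le> \<phi> (Tn 0 x)" using bound[of "Tn 0 x"] by linarith+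
          have "- M n (T a x) \<le> B" using M_nonneg[of n "T a x"] B0 by linarith
          then have "d n x \<le> B" unfolding d_eq using 1 by (intro max.boundedI)
          moreover have "- B \<le> d n x" unfolding d_eq using 1 by (intro max.coboundedI2)
          ultimately show ?thesis unfolding real_norm_def by linarith
        qed
      qed
    qed (auto simp: d_def)
    then have "0 \<le> (\<integral>x. \<phi> (Tn 0 x) \<partial>\<mu>)"
      using d_nonneg by (intro LIMSEQ_le_const) auto
    then show False using neg by (simp add: integral_Tn)
  qed
  ultimately have "measure \<mu> E = 0" by simp
  then have "AE x in \<mu>. x \<notin> E"
    using E_meas by (intro AE_not_in null_setsI) (auto simp: emeasure_eq_measure)
  then show ?thesis
    using AE_unit unfolding S_def[symmetric] by eventually_elim (auto simp: E_def)
qed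

theorem birkhoff:
  fixes \<phi> :: "real \<Rightarrow> real"
  assumes [measurable]: "\<phi> \<in> borel_measurable borel" and bound: "\<And>x. \<bar>\<phi> x\<bar> \<le> B"
  shows "AE x in \<mu>. (\<lambda>N. (\<Sum>i<N. \<phi> (Tn i x)) / N) \<longlonglongrightarrow> (\<integral>x. \<phi> x \<partial>\<mu>)"
proof -
  have upper: "AE x in \<mu>. \<forall>j::nat. \<forall>\<^sub>F N in sequentially.
      (\<Sum>i<N. \<psi> (Tn i x)) / N \<le> (\<integral>x. \<psi> x \<partial>\<mu>) + 2 / real (Suc j)"
    if [measurable]: "\<psi> \<in> borel_measurable borel" and b: "\<And>x. \<bar>\<psi> x\<bar> \<le> B" for \<psi>
  proof (subst AE_all_countable, rule allI)
    fix j :: nat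
    let ?e = "1 / real (Suc j)" let ?I = "\<integral>x. \<psi> x \<partial>\<mu>"
    have int: "integrable \<mu> \<psi>" using b by (intro integrable_bounded[of _ B]) auto
    \<comment> \<open>Subtracting slightly more than the mean makes the integral negative. Sums
      bounded by \<open>K\<close> then cost only \<open>K / N\<close> in the average, which accounts
      for the second \<open>1 / (j + 1)\<close>.\<close>
    have "AE x in \<mu>. bdd_above (range (\<lambda>n. \<Sum>i<n. \<psi> (Tn i x) - ?I - ?e))"
    proof (rule birkhoff_sums_bdd_above)
      show "\<bar>\<psi> x - ?I - ?e\<bar> \<le> B + \<bar>?I\<bar> + \<bar>?e\<bar>" for x
        using b[of x] by linarith
      show "(\<integral>x. \<psi> x - ?I - ?e \<partial>\<mu>) < 0"
        using int by (simp add: prob_space)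
    qed simp
    then show "AE x in \<mu>. \<forall>\<^sub>F N in sequentially. (\<Sum>i<N. \<psi> (Tn i x)) / N \<le> ?I + 2 / real (Suc j)"
    proof eventually_elim
      case (elim x)
      then obtain K where K: "(\<Sum>i<n. \<psi> (Tn i x) - ?I - ?e) \<le> K" for n
        by (auto simp: bdd_above_def)
      have "\<forall>\<^sub>F N in sequentially. K / real N < ?e"
        by (rule order_tendstoD(2)[OF lim_const_over_n]) simp
      then show ?case
        using eventually_gt_at_top[of 0]
      proof eventually_elim
        case (elim N)
        have "(\<Sum>i<N. \<psi> (Tn i x)) \<le> K + N * (?I + ?e)"
          using K[of N] by (simp add: sum_subtractf algebra_simps)
        then have "(\<Sum>i<N. \<psi> (Tn i x)) / N \<le> (K + N * (?I + ?e)) / N"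
          by (intro divide_right_mono) auto
        also have "\<dots> = K / N + ?I + ?e" using elim by (simp add: add_divide_distrib)
        finally have "(\<Sum>i<N. \<psi> (Tn i x)) / N \<le> K / N + ?I + ?e" .
        moreover have "2 / real (Suc j) = ?e + ?e" by simp
        ultimately show ?case using elim(1) by linarith
      qed
    qed
  qed
  have "AE x in \<mu>. \<forall>j::nat. \<forall>\<^sub>F N in sequentially.
      (\<Sum>i<N. - \<phi> (Tn i x)) / N \<le> (\<integral>x. - \<phi> x \<partial>\<mu>) + 2 / real (Suc j)"
    using bound by (intro upper) auto
  with upper[OF assms] show ?thesis
  proof (eventually_elim, goal_cases)
    case (1 x)
    show ?case
    proof (rule tendstoI)
      fix e :: real assume "e > 0"
      then obtain j where j: "2 / real (Suc j) < e"
        using reals_Archimedean[of "e / 2"] by (auto simp: field_simps)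
      show "\<forall>\<^sub>F N in sequentially. dist ((\<Sum>i<N. \<phi> (Tn i x)) / N) (\<integral>x. \<phi> x \<partial>\<mu>) < e"
        using 1(1)[rule_format, of j] 1(2)[rule_format, of j]
      proof eventually_elim
        case (elim N)
        have "(\<Sum>i<N. - \<phi> (Tn i x)) / N = - ((\<Sum>i<N. \<phi> (Tn i x)) / N)"
          by (simp add: sum_negf)
        then show ?case using elim j by (auto simp: dist_real_def)
      qed
    qed
  qed
qed

end

section \<open>Conditional expectations over finite partitions\<close>

text \<open>A null cell gets the value 0, through division by 0. The partition is given by an
  integer label because the cells of order \<open>n\<close> are labelled by
  \<open>digits n\<close>.\<close>

definition cell_mean :: "'a measure \<Rightarrow> ('a \<Rightarrow> int) \<Rightarrow> ('a \<Rightarrow> complex) \<Rightarrow> int \<Rightarrow> complex"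
  where "cell_mean M D \<phi> d =
    (\<integral>y. of_bool (D y = d) * \<phi> y \<partial>M) / of_real (measure M {y \<in> space M. D y = d})"

definition cexp :: "'a measure \<Rightarrow> ('a \<Rightarrow> int) \<Rightarrow> ('a \<Rightarrow> complex) \<Rightarrow> 'a \<Rightarrow> complex"
  where "cexp M D \<phi> x = cell_mean M D \<phi> (D x)"

lemma integral_norm_sq:
  "complex_of_real (\<integral>x. (norm (f x))\<^sup>2 \<partial>M) = (\<integral>x. cnj (f x) * f x \<partial>M)"
proof -
  have "(\<lambda>x. cnj (f x) * f x) = (\<lambda>x. complex_of_real ((norm (f x))\<^sup>2))"
    by (intro ext) (simp only: complex_norm_square mult.commute)
  then show ?thesis by (simp only: integral_complex_of_real)
qed

lemma (in finite_measure) measure_zero_mono: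
  assumes "measure M B = 0" "A \<subseteq> B" "B \<in> sets M" shows "measure M A = 0"
  using finite_measure_mono[OF assms(2,3)] assms(1) by (simp add: antisym)

context prob_space
begin

context
  fixes D :: "'a \<Rightarrow> int" and F :: "int set"
  assumes D [measurable]: "D \<in> M \<rightarrow>\<^sub>M count_space UNIV"
    and F: "finite F" and AE_F: "AE x in M. D x \<in> F"
begin

lemma measurable_partition_fun: "(\<lambda>x. g (D x)) \<in> borel_measurable M"
  using D by (rule measurable_compose) simp

lemma partition_cell_integrable:
  fixes \<phi> :: "'a \<Rightarrow> 'b::{real_normed_field, banach, second_countable_topology}"
  assumes "integrable M \<phi>"
  shows "integrable M (\<lambda>x. of_bool (D x = d) * \<phi> x)"
proof (rule Bochner_Integration.integrable_bound[OF assms])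
  have [measurable]: "\<phi> \<in> borel_measurable M" using assms by simp
  have [measurable]: "(\<lambda>x. of_bool (D x = d) :: 'b) \<in> borel_measurable M"
    by (rule measurable_partition_fun)
  show "(\<lambda>x. of_bool (D x = d) * \<phi> x) \<in> borel_measurable M" by measurable
qed (auto simp: norm_mult)

lemma partition_expand:
  fixes \<phi> :: "'a \<Rightarrow> 'b::{real_normed_field, banach, second_countable_topology}"
  shows "AE x in M. g (D x) * \<phi> x = (\<Sum>d\<in>F. g d * (of_bool (D x = d) * \<phi> x))"
  using AE_F
proof eventually_elim
  case (elim x)
  have "(\<Sum>d\<in>F. g d * (of_bool (D x = d) * \<phi> x)) = (\<Sum>d\<in>F. if d = D x then g d * \<phi> x else 0)"
    by (intro sum.cong) auto
  also have "\<dots> = g (D x) * \<phi> x"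
    using elim F by simp
  finally show ?case by simp
qed

lemma partition_integrable:
  fixes \<phi> :: "'a \<Rightarrow> 'b::{real_normed_field, banach, second_countable_topology}"
  assumes "integrable M \<phi>"
  shows "integrable M (\<lambda>x. g (D x) * \<phi> x)"
proof -
  have [measurable]: "\<phi> \<in> borel_measurable M" using assms by simp
  have [measurable]: "(\<lambda>x. g (D x)) \<in> borel_measurable M"
    by (rule measurable_partition_fun)
  have 1: "integrable M (\<lambda>x. \<Sum>d\<in>F. g d * (of_bool (D x = d) * \<phi> x))"
    using partition_cell_integrable[OF assms] by (intro Bochner_Integration.integrable_sum integrable_mult_right) auto
  show ?thesis
    by (subst integrable_cong_AE[OF _ _ partition_expand]) (use 1 in auto)
qed

lemma partition_integral:
  fixes \<phi> :: "'a \<Rightarrow> 'b::{real_normed_field, banach, second_countable_topology}"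
  assumes "integrable M \<phi>"
  shows "(\<integral>x. g (D x) * \<phi> x \<partial>M) = (\<Sum>d\<in>F. g d * (\<integral>x. of_bool (D x = d) * \<phi> x \<partial>M))"
proof -
  have [measurable]: "\<phi> \<in> borel_measurable M" using assms by simp
  have [measurable]: "(\<lambda>x. g (D x)) \<in> borel_measurable M"
    by (rule measurable_partition_fun)
  have 1: "integrable M (\<lambda>x. g d * (of_bool (D x = d) * \<phi> x))" for d
    using partition_cell_integrable[OF assms] by (intro integrable_mult_right) auto
  have "(\<integral>x. g (D x) * \<phi> x \<partial>M) = (\<integral>x. (\<Sum>d\<in>F. g d * (of_bool (D x = d) * \<phi> x)) \<partial>M)"
    using 1 by (intro integral_cong_AE partition_expand) (auto intro!: borel_measurable_sum)
  also have "\<dots> = (\<Sum>d\<in>F. \<integral>x. g d * (of_bool (D x = d) * \<phi> x) \<partial>M)"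
    using 1 by (rule Bochner_Integration.integral_sum)
  finally show ?thesis by simp
qed

lemma partition_cell_prob:
  "(\<integral>x. of_bool (D x = d) \<partial>M) = (of_real (prob {x \<in> space M. D x = d}) :: 'b::{real_normed_field, banach, second_countable_topology})"
proof -
  have "(\<integral>x. of_bool (D x = d) \<partial>M) = (\<integral>x. of_real (indicator {x \<in> space M. D x = d} x) \<partial>M :: 'b)"
    by (intro Bochner_Integration.integral_cong) (auto simp: indicator_def)
  also have "\<dots> = of_real (\<integral>x. indicator {x \<in> space M. D x = d} x \<partial>M)"
    by (rule integral_of_real) (intro integrable_const_bound[of _ 1], auto)
  also have "(\<integral>x. indicator {x \<in> space M. D x = d} x \<partial>M) = prob {x \<in> space M. D x = d}"
  proof -
    have "{x \<in> space M. D x = d} \<inter> space M = {x \<in> space M. D x = d}" by auto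
    then show ?thesis by simp
  qed
  finally show ?thesis .
qed

lemma partition_integral_fun:
  fixes g :: "int \<Rightarrow> 'b::{real_normed_field, banach, second_countable_topology}"
  shows "(\<integral>x. g (D x) \<partial>M) = (\<Sum>d\<in>F. g d * of_real (prob {x \<in> space M. D x = d}))"
  using partition_integral[of "\<lambda>_. 1 :: 'b" g] by (simp add: partition_cell_prob)

lemma partition_integrable_fun:
  fixes g :: "int \<Rightarrow> 'b::{real_normed_field, banach, second_countable_topology}"
  shows "integrable M (\<lambda>x. g (D x))"
  using partition_integrable[of "\<lambda>_. 1 :: 'b" g] by simp

lemma AE_partition_pos: "AE x in M. prob {y \<in> space M. D y = D x} > 0"
proof -
  have "AE x in M. \<forall>d\<in>F. D x = d \<longrightarrow> prob {y \<in> space M. D y = d} > 0"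
  proof (rule AE_finite_allI[OF F])
    fix d
    show "AE x in M. D x = d \<longrightarrow> prob {y \<in> space M. D y = d} > 0"
    proof (cases "prob {y \<in> space M. D y = d} = 0")
      case True
      then have "AE x in M. x \<notin> {y \<in> space M. D y = d}"
        by (intro AE_not_in) (auto simp: emeasure_eq_measure)
      then show ?thesis using AE_space by eventually_elim auto
    next
      case False
      then have "prob {y \<in> space M. D y = d} > 0" by (metis zero_less_measure_iff)
      then show ?thesis by (intro AE_I2 impI)
    qed
  qed
  with AE_F show ?thesis by eventually_elim auto
qed

lemma cexp_measurable: "cexp M D \<phi> \<in> borel_measurable M"
  using measurable_partition_fun[of "cell_mean M D \<phi>"] unfolding cexp_def .

lemma cexp_integrable: "integrable M (cexp M D \<phi>)"
  using partition_integrable_fun[of "cell_mean M D \<phi>"] unfolding cexp_def .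

lemma cell_integral_null:
  assumes "prob {y \<in> space M. D y = d} = 0"
  shows "(\<integral>y. of_bool (D y = d) * \<phi> y \<partial>M) = (0 :: complex)"
proof -
  have "AE x in M. x \<notin> {y \<in> space M. D y = d}"
    using assms by (intro AE_not_in) (auto simp: emeasure_eq_measure)
  then have "AE x in M. of_bool (D x = d) * \<phi> x = 0"
    using AE_space by eventually_elim auto
  then show ?thesis by (rule integral_eq_zero_AE)
qed

text \<open>Cell by cell, mean times weight gives back the integral; on a null cell, where the mean
  is 0 by convention, both sides vanish. This is the orthogonal projection property.\<close>

lemma cexp_projection:
  assumes "integrable M \<phi>"
  shows "(\<integral>x. g (D x) * cexp M D \<phi> x \<partial>M) = (\<integral>x. g (D x) * \<phi> x \<partial>M)"
proof -
  let ?w = "\<lambda>d. prob {y \<in> space M. D y = d}" and ?I = "\<lambda>d. \<integral>y. of_bool (D y = d) * \<phi> y \<partial>M"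
  have "(\<integral>x. g (D x) * cexp M D \<phi> x \<partial>M) = (\<Sum>d\<in>F. g d * (?I d / of_real (?w d)) * of_real (?w d))"
    unfolding cexp_def cell_mean_def by (subst partition_integral_fun[of "\<lambda>d. g d * (?I d / of_real (?w d))"]) simp
  also have "\<dots> = (\<Sum>d\<in>F. g d * ?I d)"
    using cell_integral_null[where \<phi> = \<phi>] by (intro sum.cong refl) auto
  also have "\<dots> = (\<integral>x. g (D x) * \<phi> x \<partial>M)"
    using partition_integral[OF assms, of g] by simp
  finally show ?thesis .
qed

text \<open>Valid at every \<open>x\<close>, since on a null cell both means are 0. The constant
  \<open>c\<close> may depend on the cell, which allows an uncontrolled phase to be factored out;
  \<open>\<psi> = 0\<close> and \<open>\<psi> = 1\<close> give the norm bound and the closeness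
  lemma below.\<close>

lemma cexp_affine_bound:
  assumes "integrable M \<phi>" "integrable M \<psi>" and "\<epsilon> \<ge> 0"
    and close: "AE y in M. D y = D x \<longrightarrow> norm (\<phi> y - c * \<psi> y) \<le> \<epsilon>"
  shows "norm (cexp M D \<phi> x - c * cexp M D \<psi> x) \<le> \<epsilon>"
proof (cases "prob {y \<in> space M. D y = D x} = 0")
  case True
  then show ?thesis using assms(3) by (simp add: cexp_def cell_mean_def)
next
  case False
  let ?w = "prob {y \<in> space M. D y = D x}"
  have w: "?w > 0" using False by (simp add: zero_less_measure_iff)
  note int = partition_cell_integrable[OF assms(1), of "D x"] partition_cell_integrable[OF assms(2), of "D x"]
  have "(\<integral>y. of_bool (D y = D x) * \<phi> y \<partial>M) - c * (\<integral>y. of_bool (D y = D x) * \<psi> y \<partial>M)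
      = (\<integral>y. of_bool (D y = D x) * \<phi> y - c * (of_bool (D y = D x) * \<psi> y) \<partial>M)"
    using int by simp
  also have "norm \<dots> \<le> (\<integral>y. norm (of_bool (D y = D x) * \<phi> y - c * (of_bool (D y = D x) * \<psi> y)) \<partial>M)"
    by (rule integral_norm_bound)
  also have "\<dots> \<le> (\<integral>y. of_bool (D y = D x) * \<epsilon> \<partial>M)"
  proof (rule integral_mono_AE)
    show "integrable M (\<lambda>y. of_bool (D y = D x) * \<epsilon>)"
      by (rule partition_cell_integrable) simp
    show "AE y in M. norm (of_bool (D y = D x) * \<phi> y - c * (of_bool (D y = D x) * \<psi> y))
        \<le> of_bool (D y = D x) * \<epsilon>"
      using close by eventually_elim auto
  qed (use int in auto)
  also have "\<dots> = \<epsilon> * ?w"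
    using partition_cell_prob[of "D x", where ?'b = real] by simp
  finally show ?thesis
    using w unfolding cexp_def cell_mean_def
    by (simp add: norm_divide field_simps flip: diff_divide_distrib)
qed

lemma cexp_one: "prob {y \<in> space M. D y = D x} > 0 \<Longrightarrow> cexp M D (\<lambda>_. 1) x = 1"
  unfolding cexp_def cell_mean_def by (simp add: partition_cell_prob)

lemma cexp_norm_le:
  assumes "\<phi> \<in> borel_measurable M" "\<And>x. norm (\<phi> x) \<le> B"
  shows "norm (cexp M D \<phi> x) \<le> B"
proof -
  have "B \<ge> 0" using assms(2) norm_ge_zero order_trans by blast
  moreover have "integrable M \<phi>" using assms by (intro integrable_const_bound[of _ B]) auto
  ultimately show ?thesis
    using cexp_affine_bound[of \<phi> "\<lambda>_. 0" B x 0] assms by simp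
qed

lemma cexp_close:
  assumes "integrable M \<phi>" "AE x in M. x \<in> \<Omega>" "\<epsilon> \<ge> 0"
    and osc: "\<And>x y. x \<in> \<Omega> \<Longrightarrow> y \<in> \<Omega> \<Longrightarrow> D x = D y \<Longrightarrow> norm (\<phi> x - \<phi> y) \<le> \<epsilon>"
  shows "AE x in M. norm (\<phi> x - cexp M D \<phi> x) \<le> \<epsilon>"
  using assms(2) AE_partition_pos
proof eventually_elim
  case (elim x)
  have "norm (cexp M D \<phi> x - \<phi> x * cexp M D (\<lambda>_. 1) x) \<le> \<epsilon>"
  proof (rule cexp_affine_bound)
    show "AE y in M. D y = D x \<longrightarrow> norm (\<phi> y - \<phi> x * 1) \<le> \<epsilon>"
      using assms(2) by eventually_elim (use elim(1) osc in auto)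
  qed (use assms in auto)
  then show ?case using elim(2) by (simp add: cexp_one norm_minus_commute)
qed

text \<open>Replacing one factor by \<open>\<phi>\<close> itself reduces the mean square to a single
  conditional integral.\<close>

lemma cexp_norm_sq:
  assumes "integrable M \<phi>"
  shows "of_real (\<integral>x. (norm (cexp M D \<phi> x))\<^sup>2 \<partial>M) = (\<integral>x. cnj (cexp M D \<phi> x) * \<phi> x \<partial>M)"
proof -
  let ?G = "cell_mean M D \<phi>"
  have "of_real (\<integral>x. (norm (cexp M D \<phi> x))\<^sup>2 \<partial>M) = (\<integral>x. cnj (cexp M D \<phi> x) * cexp M D \<phi> x \<partial>M)"
    by (rule integral_norm_sq)
  also have "\<dots> = (\<integral>x. cnj (?G (D x)) * cexp M D \<phi> x \<partial>M)"
    unfolding cexp_def ..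
  also have "\<dots> = (\<integral>x. cnj (?G (D x)) * \<phi> x \<partial>M)"
    by (rule cexp_projection[OF assms, of "\<lambda>d. cnj (?G d)"])
  finally show ?thesis unfolding cexp_def .
qed

end

text \<open>The partition of \<open>D'\<close> is coarser than that of \<open>D\<close>, so
  \<open>cexp M D' \<phi>\<close> is also the projection of \<open>cexp M D \<phi>\<close>, and
  their difference is orthogonal to it.\<close>

lemma cexp_pythagoras:
  assumes D [measurable]: "D \<in> M \<rightarrow>\<^sub>M count_space UNIV"
    and F: "finite F" "AE x in M. D x \<in> F"
    and \<theta>: "\<And>x. D' x = \<theta> (D x)" and int: "integrable M \<phi>"
  shows "(\<integral>x. (norm (cexp M D \<phi> x - cexp M D' \<phi> x))\<^sup>2 \<partial>M)
    = (\<integral>x. (norm (cexp M D \<phi> x))\<^sup>2 \<partial>M) - (\<integral>x. (norm (cexp M D' \<phi> x))\<^sup>2 \<partial>M)"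
proof -
  have D'_eq: "D' = (\<lambda>x. \<theta> (D x))" using \<theta> by auto
  have D' [measurable]: "D' \<in> M \<rightarrow>\<^sub>M count_space UNIV"
    unfolding D'_eq using D by (rule measurable_compose) simp
  have F': "finite (\<theta> ` F)" "AE x in M. D' x \<in> \<theta> ` F"
    using F by (auto simp: D'_eq elim: AE_mp)
  define u where "u = cexp M D \<phi>"
  define v where "v = cexp M D' \<phi>"
  let ?G = "cell_mean M D \<phi>"
  let ?H = "\<lambda>d. cell_mean M D' \<phi> (\<theta> d)"
  have u: "u x = ?G (D x)" and v: "v x = ?H (D x)" for x
    by (simp_all add: u_def v_def cexp_def \<theta>)
  have int_prod: "integrable M (\<lambda>x. cnj (u x) * u x)" "integrable M (\<lambda>x. cnj (v x) * u x)"
    "integrable M (\<lambda>x. cnj (v x) * v x)" "integrable M (\<lambda>x. cnj (u x) * v x)"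
    unfolding u v
    using partition_integrable_fun[OF D F, of "\<lambda>d. cnj (?G d) * ?G d"]
      partition_integrable_fun[OF D F, of "\<lambda>d. cnj (?H d) * ?G d"]
      partition_integrable_fun[OF D F, of "\<lambda>d. cnj (?H d) * ?H d"]
      partition_integrable_fun[OF D F, of "\<lambda>d. cnj (?G d) * ?H d"] by auto
  have "(\<integral>x. cnj (v x) * u x \<partial>M) = (\<integral>x. cnj (v x) * \<phi> x \<partial>M)"
    using cexp_projection[OF D F int, of "\<lambda>d. cnj (?H d)"] unfolding v u_def .
  also have "\<dots> = of_real (\<integral>x. (norm (v x))\<^sup>2 \<partial>M)"
    unfolding v_def by (rule cexp_norm_sq[OF D' F' int, symmetric])
  finally have vu: "(\<integral>x. cnj (v x) * u x \<partial>M) = of_real (\<integral>x. (norm (v x))\<^sup>2 \<partial>M)" .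
  have "(\<integral>x. cnj (u x) * v x \<partial>M) = cnj (\<integral>x. cnj (v x) * u x \<partial>M)"
    using Bochner_Integration.integral_cnj[of M "\<lambda>x. cnj (v x) * u x"] by (simp add: mult.commute)
  then have uv: "(\<integral>x. cnj (u x) * v x \<partial>M) = of_real (\<integral>x. (norm (v x))\<^sup>2 \<partial>M)"
    by (simp add: vu)
  have "complex_of_real (\<integral>x. (norm (u x - v x))\<^sup>2 \<partial>M)
      = (\<integral>x. cnj (u x) * u x - cnj (v x) * u x - (cnj (u x) * v x - cnj (v x) * v x) \<partial>M)"
    unfolding integral_norm_sq by (intro Bochner_Integration.integral_cong) (auto simp: algebra_simps)
  also have "\<dots> = of_real ((\<integral>x. (norm (u x))\<^sup>2 \<partial>M) - (\<integral>x. (norm (v x))\<^sup>2 \<partial>M))"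
    using int_prod by (simp add: uv vu flip: integral_norm_sq)
  finally show ?thesis
    unfolding of_real_eq_iff u_def v_def .
qed

end

section \<open>Conditional expectations given the first digits\<close>

context prob_space
begin

lemma expectation_norm_le_sqrt:
  fixes f :: "'a \<Rightarrow> 'b::{banach, second_countable_topology}"
  assumes "f \<in> borel_measurable M" "\<And>x. norm (f x) \<le> B"
  shows "(\<integral>x. norm (f x) \<partial>M) \<le> sqrt (\<integral>x. (norm (f x))\<^sup>2 \<partial>M)"
proof (rule real_le_rsqrt)
  have [measurable]: "f \<in> borel_measurable M" by fact
  have 1: "integrable M (\<lambda>x. norm (f x))"
    using assms by (intro integrable_const_bound[of _ B]) auto
  have 2: "integrable M (\<lambda>x. (norm (f x))\<^sup>2)"
    using assms by (intro integrable_const_bound[of _ "B\<^sup>2"]) (auto intro!: power_mono)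
  show "(\<integral>x. norm (f x) \<partial>M)\<^sup>2 \<le> (\<integral>x. (norm (f x))\<^sup>2 \<partial>M)"
    using variance_positive[of "\<lambda>x. norm (f x)"] variance_eq[OF 1 2] by simp
qed

end

context times_ergodic
begin

section \<open>Mean ergodic theorems along almost stationary sequences\<close>

lemma birkhoff_L1:
  fixes \<phi> :: "real \<Rightarrow> real"
  assumes [measurable]: "\<phi> \<in> borel_measurable borel" and bound: "\<And>x. \<bar>\<phi> x\<bar> \<le> B"
  shows "(\<lambda>N. \<integral>x. \<bar>(\<Sum>i<N. \<phi> (Tn i x)) / N - (\<integral>y. \<phi> y \<partial>\<mu>)\<bar> \<partial>\<mu>) \<longlonglongrightarrow> 0"
proof -
  let ?I = "\<integral>y. \<phi> y \<partial>\<mu>"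
  have B0: "0 \<le> B" using bound[of 0] by linarith
  have "(\<lambda>N. \<integral>x. \<bar>(\<Sum>i<N. \<phi> (Tn i x)) / N - ?I\<bar> \<partial>\<mu>) \<longlonglongrightarrow> (\<integral>x. 0 \<partial>\<mu>)"
  proof (rule integral_dominated_convergence[where w = "\<lambda>_. B + \<bar>?I\<bar>"])
    show "AE x in \<mu>. (\<lambda>N. \<bar>(\<Sum>i<N. \<phi> (Tn i x)) / N - ?I\<bar>) \<longlonglongrightarrow> 0"
      using birkhoff[OF assms] by eventually_elim (rule tendsto_rabs_zero, simp add: LIM_zero)
    show "AE x in \<mu>. norm \<bar>(\<Sum>i<N. \<phi> (Tn i x)) / N - ?I\<bar> \<le> B + \<bar>?I\<bar>" for N
    proof (intro AE_I2)
      fix x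
      have "\<bar>\<Sum>i<N. \<phi> (Tn i x)\<bar> \<le> (\<Sum>i<N. B)"
        using bound by (intro order_trans[OF sum_abs] sum_mono)
      then have "\<bar>(\<Sum>i<N. \<phi> (Tn i x)) / N\<bar> \<le> B"
        using B0 by (cases "N = 0") (auto simp: abs_divide divide_le_eq mult.commute)
      then show "norm \<bar>(\<Sum>i<N. \<phi> (Tn i x)) / N - ?I\<bar> \<le> B + \<bar>?I\<bar>"
        unfolding real_norm_def by linarith
    qed
  qed simp_all
  then show ?thesis by simp
qed

text \<open>The block may start anywhere beyond \<open>m0\<close>: later, either its length or its
  starting point goes to infinity while the other one is fixed.\<close>

definition averages_to :: "(nat \<Rightarrow> real \<Rightarrow> real) \<Rightarrow> real \<Rightarrow> bool"
  where "averages_to u U \<longleftrightarrow>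
    (\<forall>\<epsilon>>0. \<exists>q0 m0. \<forall>q\<ge>q0. \<forall>M\<ge>m0. (\<integral>x. \<bar>(\<Sum>i<q. u (M + i) x) / q - U\<bar> \<partial>\<mu>) \<le> \<epsilon>)"

text \<open>An ergodic theorem in the manner of Maker: \<open>u\<close> is not one function along
  the orbit, but nearly so beyond a fixed index \<open>m\<close>. Birkhoff's theorem for the single
  function \<open>u m\<close> then suffices, with one error \<open>\<delta> m\<close> from the terms
  and another from the limit.\<close>

lemma ergodic_average_approx:
  fixes u :: "nat \<Rightarrow> real \<Rightarrow> real"
  assumes [measurable]: "\<And>n. u n \<in> borel_measurable borel" and bound: "\<And>n x. \<bar>u n x\<bar> \<le> 1"
    and \<delta>: "\<delta> \<longlonglongrightarrow> 0" and close: "\<And>m k. (\<integral>x. \<bar>u (m + k) x - u m (Tn k x)\<bar> \<partial>\<mu>) \<le> \<delta> m"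
  obtains U where "(\<lambda>m. \<integral>x. u m x \<partial>\<mu>) \<longlonglongrightarrow> U"
    and "averages_to u U"
proof -
  define I where "I m = (\<integral>x. u m x \<partial>\<mu>)" for m
  have int [simp]: "integrable \<mu> (u n)" for n
    using bound by (intro integrable_bounded[of _ 1]) auto
  have int' [simp]: "integrable \<mu> (\<lambda>x. u n (Tn k x))" for n k
    using bound by (intro integrable_bounded[of _ 1]) auto
  have I_close: "\<bar>I (m + k) - I m\<bar> \<le> \<delta> m" for m k
  proof -
    have "I (m + k) - I m = (\<integral>x. u (m + k) x - u m (Tn k x) \<partial>\<mu>)"
      unfolding I_def by (simp add: integral_Tn)
    also have "\<bar>\<dots>\<bar> \<le> (\<integral>x. \<bar>u (m + k) x - u m (Tn k x)\<bar> \<partial>\<mu>)"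
      using integral_norm_bound[of \<mu> "\<lambda>x. u (m + k) x - u m (Tn k x)"] by simp
    finally show ?thesis using close[of m k] by linarith
  qed
  have "Cauchy I"
  proof (rule metric_CauchyI)
    fix e :: real assume "e > 0"
    then have "\<forall>\<^sub>F m in sequentially. \<delta> m < e / 2"
      using \<delta> by (intro order_tendstoD) auto
    then obtain m where m: "\<delta> m < e / 2" by (auto simp: eventually_sequentially)
    have "dist (I i) (I j) < e" if "i \<ge> m" "j \<ge> m" for i j
      using I_close[of m "i - m"] I_close[of m "j - m"] that m by (simp add: dist_real_def)
    then show "\<exists>M. \<forall>m\<ge>M. \<forall>n\<ge>M. dist (I m) (I n) < e" by blast
  qed
  then obtain U where U: "I \<longlonglongrightarrow> U"
    by (auto simp: Cauchy_convergent_iff convergent_def)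
  have U_close: "\<bar>U - I m\<bar> \<le> \<delta> m" for m
  proof (rule LIMSEQ_le_const2)
    show "(\<lambda>k. \<bar>I (m + k) - I m\<bar>) \<longlonglongrightarrow> \<bar>U - I m\<bar>"
      using LIMSEQ_ignore_initial_segment[OF U, of m]
      by (intro tendsto_intros) (simp add: add.commute)
  qed (use I_close in auto)
  have "\<exists>q0 m0. \<forall>q\<ge>q0. \<forall>M\<ge>m0. (\<integral>x. \<bar>(\<Sum>i<q. u (M + i) x) / q - U\<bar> \<partial>\<mu>) \<le> \<epsilon>"
    if "\<epsilon> > 0" for \<epsilon>
  proof -
    have "\<forall>\<^sub>F m in sequentially. \<delta> m < \<epsilon> / 3"
      using \<delta> that by (intro order_tendstoD) auto
    then obtain m where m: "\<delta> m < \<epsilon> / 3" by (auto simp: eventually_sequentially)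
    have "\<forall>\<^sub>F q in sequentially. (\<integral>x. \<bar>(\<Sum>i<q. u m (Tn i x)) / q - I m\<bar> \<partial>\<mu>) < \<epsilon> / 3"
      unfolding I_def using birkhoff_L1[of "u m" 1] bound that by (intro order_tendstoD) auto
    then obtain q1 where q1: "\<And>q. q \<ge> q1 \<Longrightarrow> (\<integral>x. \<bar>(\<Sum>i<q. u m (Tn i x)) / q - I m\<bar> \<partial>\<mu>) < \<epsilon> / 3"
      by (auto simp: eventually_sequentially)
    have "(\<integral>x. \<bar>(\<Sum>i<q. u (M + i) x) / q - U\<bar> \<partial>\<mu>) \<le> \<epsilon>" if q: "q \<ge> max 1 q1" and M: "M \<ge> m" for q M
    proof -
      \<comment> \<open>The term of index \<open>M + i\<close> is compared with \<open>u m\<close>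
        at time \<open>j + i\<close>; the shift by \<open>j\<close> disappears on
        integrating.\<close>
      define j where "j = M - m"
      have M_eq: "M = m + j" using M by (simp add: j_def)
      let ?A = "\<lambda>x. (\<Sum>i<q. \<bar>u (m + (j + i)) x - u m (Tn (j + i) x)\<bar>) / q"
      let ?B = "\<lambda>x. \<bar>(\<Sum>i<q. u m (Tn i x)) / q - I m\<bar>"
      have pt: "\<bar>(\<Sum>i<q. u (M + i) x) / q - U\<bar> \<le> ?A x + ?B (Tn j x) + \<bar>U - I m\<bar>" for x
      proof -
        have "(\<Sum>i<q. u (M + i) x) / q - (\<Sum>i<q. u m (Tn i (Tn j x))) / q
            = (\<Sum>i<q. u (m + (j + i)) x - u m (Tn (j + i) x)) / q"
        proof -
          have "u (M + i) x = u (m + (j + i)) x" "u m (Tn i (Tn j x)) = u m (Tn (j + i) x)" for i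
            by (simp_all add: M_eq Tn_add add.assoc add.commute[of i j])
          then show ?thesis by (simp only: sum_subtractf diff_divide_distrib)
        qed
        moreover have "\<bar>(\<Sum>i<q. u (m + (j + i)) x - u m (Tn (j + i) x)) / q\<bar> \<le> ?A x"
          by (simp add: abs_divide divide_right_mono sum_abs)
        ultimately show ?thesis by linarith
      qed
      have intA: "integrable \<mu> (\<lambda>x. \<bar>u (m + k) x - u m (Tn k x)\<bar>)" for k
        by simp
      have intB: "integrable \<mu> ?B" "integrable \<mu> (\<lambda>x. ?B (Tn j x))"
        by (simp_all add: Tn_add)
      have "(\<integral>x. \<bar>(\<Sum>i<q. u (M + i) x) / q - U\<bar> \<partial>\<mu>)
          \<le> (\<integral>x. ?A x + ?B (Tn j x) + \<bar>U - I m\<bar> \<partial>\<mu>)"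
        using intA intB by (intro integral_mono pt) (auto intro!: integrable_abs)
      also have "\<dots> = (\<integral>x. ?A x \<partial>\<mu>) + (\<integral>x. ?B (Tn j x) \<partial>\<mu>) + \<bar>U - I m\<bar>"
        using intA intB by (simp add: integral_add)
      also have "(\<integral>x. ?B (Tn j x) \<partial>\<mu>) = (\<integral>x. ?B x \<partial>\<mu>)"
        by (rule integral_Tn) measurable
      also have "(\<integral>x. ?A x \<partial>\<mu>) = (\<Sum>i<q. \<integral>x. \<bar>u (m + (j + i)) x - u m (Tn (j + i) x)\<bar> \<partial>\<mu>) / q"
        using intA by simp
      also have "\<dots> \<le> (\<Sum>i<q. \<delta> m) / q"
        by (intro divide_right_mono sum_mono close) auto
      also have "\<dots> = \<delta> m" using q by simp
      finally show ?thesis using m q1[of q] q U_close[of m] by simp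
    qed
    then show ?thesis by blast
  qed
  then show ?thesis using that U unfolding I_def averages_to_def by blast
qed

section \<open>Digits in base \<open>a\<close> and conditional means over cells\<close>

definition digits :: "nat \<Rightarrow> real \<Rightarrow> int"
  where "digits n x = \<lfloor>of_int a ^ n * x\<rfloor>"

lemma digits_measurable [measurable]: "digits n \<in> borel \<rightarrow>\<^sub>M count_space UNIV"
  unfolding digits_def by measurable

lemma a_pow_pos [simp]: "0 < (of_int a :: real) ^ n" "0 \<le> (of_int a :: real) ^ n" "0 < a ^ n" "a \<noteq> 0"
  using a_ge_2 by auto

lemma AE_digits: "AE x in \<mu>. digits n x \<in> {0..<a ^ n}"
  using AE_unit
proof eventually_elim
  case (elim x)
  then have "of_int a ^ n * x < of_int (a ^ n)" by simp
  then have "digits n x < a ^ n" unfolding digits_def by (simp only: floor_less_iff)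
  then show ?case using elim by (simp add: digits_def)
qed

lemma Tn_eq: "Tn n x = of_int a ^ n * x - of_int (digits n x)"
  by (simp add: Tn_def digits_def frac_def)

lemma digits_Tn: "digits m (Tn n x) = digits (m + n) x - a ^ m * digits n x"
proof -
  have "of_int a ^ m * Tn n x = of_int a ^ (m + n) * x - of_int (a ^ m * digits n x)"
    by (simp add: Tn_eq power_add algebra_simps)
  then show ?thesis unfolding digits_def by (simp only: floor_diff_of_int)
qed

lemma digits_div: "digits n x = digits (m + n) x div a ^ m"
proof -
  have "0 \<le> digits m (Tn n x)" "digits m (Tn n x) < a ^ m"
  proof -
    have "of_int a ^ m * Tn n x < of_int (a ^ m)" using Tn_range(2)[of n x] by simp
    then show "digits m (Tn n x) < a ^ m" unfolding digits_def by (simp only: floor_less_iff)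
    show "0 \<le> digits m (Tn n x)" unfolding digits_def using Tn_range(1)[of n x] by simp
  qed
  then show ?thesis
    unfolding digits_Tn by (intro int_div_pos_eq[symmetric, of _ _ _ "digits m (Tn n x)"]) (auto simp: digits_Tn)
qed

text \<open>The last \<open>m\<close> of the first \<open>m + n\<close> digits are thus a function
  of all of them, as the Pythagorean identity demands.\<close>

lemma digits_mod: "digits m (Tn n x) = digits (m + n) x mod a ^ m"
  by (simp add: digits_Tn digits_div[of n x m] minus_mult_div_eq_mod)

text \<open>The integral of \<open>\<phi>\<close> against the measure \<eta>(x, n) of the overview,
  which itself is never constructed.\<close>

definition cond :: "(real \<Rightarrow> complex) \<Rightarrow> nat \<Rightarrow> real \<Rightarrow> complex"
  where "cond \<phi> n = cexp \<mu> (digits n) (\<lambda>x. \<phi> (Tn n x))"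

definition energy :: "(real \<Rightarrow> complex) \<Rightarrow> nat \<Rightarrow> real"
  where "energy \<phi> n = (\<integral>x. (norm (cond \<phi> n x))\<^sup>2 \<partial>\<mu>)"

lemma measure_Tn: "A \<in> sets borel \<Longrightarrow> measure \<mu> {x. Tn k x \<in> A} = measure \<mu> A"
  using measure_distr[of "Tn k" \<mu> borel A] by (simp add: distr_Tn vimage_def)

lemma digits_fin:
  "digits n \<in> \<mu> \<rightarrow>\<^sub>M count_space UNIV" "finite {0..<a ^ n}" "AE x in \<mu>. digits n x \<in> {0..<a ^ n}"
  using AE_digits by auto

lemma cond_measurable [measurable]: "cond \<phi> n \<in> borel_measurable borel"
  unfolding cond_def using cexp_measurable[OF digits_fin] by simp

text \<open>By invariance, conditioning after \<open>k\<close> steps means conditioning the function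
  \<open>\<phi> (Tn (m + k) x)\<close> on the last \<open>m\<close> of its \<open>m + k\<close>
  digits only. It is therefore a coarser projection than \<open>cond \<phi> (m + k)\<close>, of the
  same function.\<close>

lemma cond_Tn:
  assumes [measurable]: "\<phi> \<in> borel_measurable borel"
  shows "cond \<phi> m (Tn k x) = cexp \<mu> (\<lambda>x. digits m (Tn k x)) (\<lambda>x. \<phi> (Tn (m + k) x)) x"
proof -
  let ?d = "digits m (Tn k x)"
  have "(\<integral>y. of_bool (digits m (Tn k y) = ?d) * \<phi> (Tn m (Tn k y)) \<partial>\<mu>)
      = (\<integral>y. of_bool (digits m y = ?d) * \<phi> (Tn m y) \<partial>\<mu>)"
  proof (rule integral_Tn)
    have [measurable]: "(\<lambda>y. of_bool (digits m y = ?d) :: complex) \<in> borel_measurable borel"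
      by (rule measurable_compose[OF digits_measurable, of "\<lambda>d. of_bool (d = ?d)"]) simp
    show "(\<lambda>y. of_bool (digits m y = ?d) * \<phi> (Tn m y)) \<in> borel_measurable borel"
      by measurable
  qed
  moreover have "measure \<mu> {y. digits m (Tn k y) = ?d} = measure \<mu> {y. digits m y = ?d}"
    using measure_Tn[of "{y. digits m y = ?d}" k] by simp
  ultimately show ?thesis
    by (simp add: cond_def cexp_def cell_mean_def Tn_add)
qed

context
  fixes \<phi> :: "real \<Rightarrow> complex"
  assumes \<phi> [measurable]: "\<phi> \<in> borel_measurable borel" and \<phi>_bound: "\<And>x. norm (\<phi> x) \<le> 1"
begin

lemma cond_norm_le: "norm (cond \<phi> n x) \<le> 1"
  unfolding cond_def using \<phi>_bound by (intro cexp_norm_le[OF digits_fin]) auto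

lemma integrable_Tn: "integrable \<mu> (\<lambda>x. \<phi> (Tn n x))"
  using \<phi>_bound by (intro integrable_bounded[of _ 1]) auto

text \<open>This identity does the work of martingale convergence: as energies increase to a finite
  limit, the right side is small for large \<open>m\<close>, uniformly in \<open>k\<close>.\<close>

lemma energy_diff:
  "(\<integral>x. (norm (cond \<phi> (m + k) x - cond \<phi> m (Tn k x)))\<^sup>2 \<partial>\<mu>) = energy \<phi> (m + k) - energy \<phi> m"
proof -
  have "energy \<phi> m = (\<integral>x. (norm (cond \<phi> m (Tn k x)))\<^sup>2 \<partial>\<mu>)"
    unfolding energy_def by (rule integral_Tn[symmetric]) measurable
  then show ?thesis
    unfolding energy_def[of _ "m + k"] cond_Tn[OF \<phi>] unfolding cond_def
    using cexp_pythagoras[OF digits_fin[of "m + k"] _ integrable_Tn[of "m + k"],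
        of "\<lambda>x. digits m (Tn k x)" "\<lambda>d. d mod a ^ m"]
    by (simp add: digits_mod)
qed

lemma energy_incseq: "incseq (energy \<phi>)"
proof (rule incseq_SucI)
  fix n
  have "0 \<le> (\<integral>x. (norm (cond \<phi> (n + 1) x - cond \<phi> n (Tn 1 x)))\<^sup>2 \<partial>\<mu>)" by simp
  then show "energy \<phi> n \<le> energy \<phi> (Suc n)" unfolding energy_diff by simp
qed

lemma cond_sq_integrable: "integrable \<mu> (\<lambda>x. (norm (cond \<phi> n x))\<^sup>2)"
  using cond_norm_le by (intro integrable_bounded[of _ 1]) (auto simp: power_le_one)

lemma energy_le_1: "energy \<phi> n \<le> 1"
  unfolding energy_def using cond_norm_le cond_sq_integrable
  by (intro integral_le_const) (auto simp: power_le_one)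

lemma energy_nonneg: "0 \<le> energy \<phi> n"
  unfolding energy_def by simp

lemma energy_bdd: "bdd_above (range (energy \<phi>))"
  using energy_le_1 by (auto simp: bdd_above_def)

lemma energy_tendsto: "energy \<phi> \<longlonglongrightarrow> (SUP n. energy \<phi> n)"
  using energy_bdd energy_incseq by (rule LIMSEQ_incseq_SUP)

lemma cond_diff_L1:
  "(\<integral>x. norm (cond \<phi> (m + k) x - cond \<phi> m (Tn k x)) \<partial>\<mu>) \<le> sqrt ((SUP n. energy \<phi> n) - energy \<phi> m)"
proof -
  have "(\<integral>x. norm (cond \<phi> (m + k) x - cond \<phi> m (Tn k x)) \<partial>\<mu>)
    \<le> sqrt (\<integral>x. (norm (cond \<phi> (m + k) x - cond \<phi> m (Tn k x)))\<^sup>2 \<partial>\<mu>)"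
  proof (rule expectation_norm_le_sqrt)
    show "norm (cond \<phi> (m + k) x - cond \<phi> m (Tn k x)) \<le> 2" for x
      using norm_triangle_ineq4[of "cond \<phi> (m + k) x" "cond \<phi> m (Tn k x)"]
        cond_norm_le[of "m + k" x] cond_norm_le[of m "Tn k x"] by linarith
  qed simp
  also have "\<dots> \<le> sqrt ((SUP n. energy \<phi> n) - energy \<phi> m)"
    unfolding energy_diff using energy_bdd by (intro real_sqrt_le_mono) (auto intro: cSUP_upper)
  finally show ?thesis .
qed

lemma cond_diff_tendsto: "(\<lambda>m. sqrt ((SUP n. energy \<phi> n) - energy \<phi> m)) \<longlonglongrightarrow> 0"
proof -
  have "(\<lambda>m. sqrt ((SUP n. energy \<phi> n) - energy \<phi> m)) \<longlonglongrightarrow> sqrt ((SUP n. energy \<phi> n) - (SUP n. energy \<phi> n))"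
    by (intro tendsto_intros energy_tendsto)
  then show ?thesis by simp
qed

text \<open>The averages converge to the limit of the first moments, which the Cauchy-Schwarz
  inequality bounds by the root of the limit energy. The error is kept as a function
  \<open>g\<close> of small integral, so that it can be integrated together with other errors
  later.\<close>

lemma cond_average_upper:
  assumes "\<epsilon> > 0"
  shows "\<exists>q0 m0. \<forall>q\<ge>q0. \<forall>M\<ge>m0. \<exists>g. integrable \<mu> g \<and> (\<integral>x. g x \<partial>\<mu>) \<le> \<epsilon> \<and>
    (\<forall>x. 0 \<le> g x \<and> (\<Sum>i<q. norm (cond \<phi> (M + i) x)) / q \<le> sqrt (SUP n. energy \<phi> n) + g x)"
proof -
  have "(\<integral>x. \<bar>norm (cond \<phi> (m + k) x) - norm (cond \<phi> m (Tn k x))\<bar> \<partial>\<mu>)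
      \<le> sqrt ((SUP n. energy \<phi> n) - energy \<phi> m)" for m k
  proof -
    have "integrable \<mu> (\<lambda>x. cond \<phi> (m + k) x - cond \<phi> m (Tn k x))"
      using cond_norm_le by (intro Bochner_Integration.integrable_diff integrable_bounded[of _ 1]) auto
    moreover have "integrable \<mu> (\<lambda>x. \<bar>norm (cond \<phi> (m + k) x) - norm (cond \<phi> m (Tn k x))\<bar>)"
      using cond_norm_le
      by (intro integrable_abs Bochner_Integration.integrable_diff integrable_bounded[of _ 1]) auto
    ultimately show ?thesis
      by (intro order_trans[OF integral_mono cond_diff_L1]) (auto simp: norm_triangle_ineq3)
  qed
  note close = this
  obtain U where U: "(\<lambda>m. \<integral>x. norm (cond \<phi> m x) \<partial>\<mu>) \<longlonglongrightarrow> U"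
    and av: "averages_to (\<lambda>m x. norm (cond \<phi> m x)) U"
  proof (rule ergodic_average_approx[of "\<lambda>m x. norm (cond \<phi> m x)", OF _ _ cond_diff_tendsto close])
    show "\<bar>norm (cond \<phi> n x)\<bar> \<le> 1" for n x
      using cond_norm_le by simp
  qed simp_all
  have "(\<integral>x. norm (cond \<phi> m x) \<partial>\<mu>) \<le> sqrt (SUP n. energy \<phi> n)" for m
  proof -
    have "(\<integral>x. norm (cond \<phi> m x) \<partial>\<mu>) \<le> sqrt (energy \<phi> m)"
      unfolding energy_def using cond_norm_le by (intro expectation_norm_le_sqrt) auto
    also have "\<dots> \<le> sqrt (SUP n. energy \<phi> n)"
      using energy_bdd by (intro real_sqrt_le_mono cSUP_upper) auto
    finally show ?thesis .
  qed
  then have U_le: "U \<le> sqrt (SUP n. energy \<phi> n)"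
    using U by (intro LIMSEQ_le_const2) auto
  obtain q0 m0 where *: "\<And>q M. q \<ge> q0 \<Longrightarrow> M \<ge> m0 \<Longrightarrow>
      (\<integral>x. \<bar>(\<Sum>i<q. norm (cond \<phi> (M + i) x)) / q - U\<bar> \<partial>\<mu>) \<le> \<epsilon>"
    using av assms unfolding averages_to_def by blast
  show ?thesis
  proof (rule exI[of _ q0], rule exI[of _ m0], intro allI impI)
    fix q M assume qM: "q0 \<le> q" "m0 \<le> M"
    let ?g = "\<lambda>x. \<bar>(\<Sum>i<q. norm (cond \<phi> (M + i) x)) / q - U\<bar>"
    have "integrable \<mu> (\<lambda>x. norm (cond \<phi> n x))" for n
      using cond_norm_le by (intro integrable_bounded[of _ 1]) auto
    then have "integrable \<mu> ?g" by simp
    moreover have "(\<Sum>i<q. norm (cond \<phi> (M + i) x)) / q \<le> sqrt (SUP n. energy \<phi> n) + ?g x" for x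
      using U_le by linarith
    ultimately show "\<exists>g. integrable \<mu> g \<and> (\<integral>x. g x \<partial>\<mu>) \<le> \<epsilon> \<and>
        (\<forall>x. 0 \<le> g x \<and> (\<Sum>i<q. norm (cond \<phi> (M + i) x)) / q \<le> sqrt (SUP n. energy \<phi> n) + g x)"
      using *[OF qM] by (intro exI[of _ ?g] conjI allI abs_ge_zero)
  qed
qed

end

end

section \<open>Zooming in along a smooth map\<close>

lemma norm_cis_diff_le: "norm (cis s - cis t) \<le> \<bar>s - t\<bar>"
proof -
  have "norm (cis s - cis t) = norm (cis t * (cis (s - t) - 1))"
    by (simp add: algebra_simps cis_mult)
  also have "\<dots> = norm (exp (\<i> * of_real (s - t)) - 1)"
    by (simp add: norm_mult cis_conv_exp)
  also have "\<dots> = 2 * \<bar>sin ((s - t) / 2)\<bar>" by (rule dist_exp_i_1)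
  also have "\<dots> \<le> \<bar>s - t\<bar>" using abs_sin_x_le_abs_x[of "(s - t) / 2"] by simp
  finally show ?thesis .
qed

lemma borel_measurable_cnj [measurable (raw)]:
  "f \<in> borel_measurable M \<Longrightarrow> (\<lambda>x. cnj (f x)) \<in> borel_measurable M"
  by (rule measurable_compose[where g = cnj]) (auto intro!: borel_measurable_continuous_onI continuous_intros)

lemma borel_measurable_cis [measurable]: "cis \<in> borel_measurable borel"
  by (intro borel_measurable_continuous_onI continuous_on_cis continuous_on_id)

lemma cexp_cnj: "cexp M D (\<lambda>x. cnj (\<phi> x)) x = cnj (cexp M D \<phi> x)"
proof -
  have "(\<integral>y. of_bool (D y = D x) * cnj (\<phi> y) \<partial>M) = (\<integral>y. cnj (of_bool (D y = D x) * \<phi> y) \<partial>M)"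
    by (intro Bochner_Integration.integral_cong) auto
  then show ?thesis
    unfolding cexp_def cell_mean_def
    by (simp only: Bochner_Integration.integral_cnj complex_cnj_divide complex_cnj_complex_of_real)
qed

lemma card_close_le: "card {j \<in> {..<N}. i < j + p \<and> j < i + p} \<le> 2 * p" for i :: nat
proof -
  have "{j \<in> {..<N}. i < j + p \<and> j < i + p} \<subseteq> {i - p..<i + p}" by auto
  then have "card {j \<in> {..<N}. i < j + p \<and> j < i + p} \<le> card {i - p..<i + p}"
    by (intro card_mono) auto
  then show ?thesis by simp
qed

definition smooth :: "(real \<Rightarrow> real) \<Rightarrow> (real \<Rightarrow> real) \<Rightarrow> bool"
  where "smooth f f' \<longleftrightarrow> (\<forall>x. (f has_real_derivative f' x) (at x)) \<and> continuous_on UNIV f'"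

lemma smoothD:
  assumes "smooth f f'" shows "(f has_real_derivative f' x) (at x)" "continuous_on UNIV f'"
  using assms by (simp_all add: smooth_def)

lemma smooth_measurable:
  assumes "smooth f f'" shows "f \<in> borel_measurable borel" "f' \<in> borel_measurable borel"
proof -
  have "continuous_on UNIV f"
    using assms unfolding smooth_def by (meson DERIV_isCont continuous_at_imp_continuous_on)
  then show "f \<in> borel_measurable borel" by (rule borel_measurable_continuous_onI)
  show "f' \<in> borel_measurable borel"
    using assms unfolding smooth_def by (intro borel_measurable_continuous_onI) auto
qed

context times_ergodic
begin

lemma digits_refine:
  assumes "digits (n + p) x = digits (n + p) y" shows "digits n x = digits n y"
  using assms digits_div[of n _ p] by (metis add.commute)

lemma digits_eq_close:
  assumes "digits n x = digits n y" shows "\<bar>x - y\<bar> * of_int a ^ n \<le> 1"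
proof -
  have "\<bar>Tn n x - Tn n y\<bar> \<le> 1"
    using Tn_range[of n x] Tn_range[of n y] by linarith
  moreover have "Tn n x - Tn n y = (x - y) * of_int a ^ n"
    using assms by (simp add: Tn_eq algebra_simps)
  ultimately show ?thesis by (simp add: abs_mult)
qed

text \<open>Uniform in \<open>n\<close>: up to \<open>\<epsilon>\<close>, each \<open>X n\<close> is
  a function of the first \<open>n + p\<close> digits.\<close>

definition oscillates :: "(nat \<Rightarrow> real \<Rightarrow> complex) \<Rightarrow> nat \<Rightarrow> real \<Rightarrow> bool"
  where "oscillates X p \<epsilon> \<longleftrightarrow> (\<forall>n. \<forall>x\<in>{0..<1}. \<forall>y\<in>{0..<1}.
    digits (n + p) x = digits (n + p) y \<longrightarrow> norm (X n x - X n y) \<le> \<epsilon>)"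

text \<open>Martingale differences are only approximately orthogonal here, since \<open>X n\<close> is merely
  close to a function of the first \<open>n + p\<close> digits.\<close>

lemma conditional_decorrelation:
  assumes X_meas [measurable]: "\<And>n. X n \<in> borel_measurable borel" and X_bound: "\<And>n x. norm (X n x) \<le> 1"
    and osc: "\<And>\<epsilon>. \<epsilon> > 0 \<Longrightarrow> \<exists>p. oscillates X p \<epsilon>"
  shows "(\<lambda>N. \<integral>x. norm ((\<Sum>i<N. X (M + i) x - cexp \<mu> (digits (M + i)) (X (M + i)) x) / N) \<partial>\<mu>) \<longlonglongrightarrow> 0"
proof -
  define Z where "Z n x = X n x - cexp \<mu> (digits n) (X n) x" for n x
  have [measurable]: "cexp \<mu> (digits n) (X n) \<in> borel_measurable borel" for n
    using cexp_measurable[OF digits_fin] by simp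
  have Z_meas [measurable]: "Z n \<in> borel_measurable borel" for n
    unfolding Z_def by measurable
  have c_bound: "norm (cexp \<mu> (digits n) (X n) x) \<le> 1" for n x
    using X_bound by (intro cexp_norm_le[OF digits_fin]) auto
  have Z_bound: "norm (Z n x) \<le> 2" for n x
    unfolding Z_def using norm_triangle_ineq4[of "X n x" "cexp \<mu> (digits n) (X n) x"]
      X_bound[of n x] c_bound[of n x] by linarith
  have int_X: "integrable \<mu> (X n)" for n
    using X_bound by (intro integrable_bounded[of _ 1]) auto
  have int_Z: "integrable \<mu> (Z n)" for n
    using Z_bound by (intro integrable_bounded[of _ 2]) auto
  have int_ZZ: "integrable \<mu> (\<lambda>x. cnj (Z n x) * Z m x)" for n m
  proof (rule integrable_bounded[of _ 4])
    show "norm (cnj (Z n x) * Z m x) \<le> 4" for x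
      using mult_mono[OF Z_bound[of n x] Z_bound[of m x]] by (simp add: norm_mult)
  qed simp
  have corr_le: "norm (\<integral>x. cnj (Z n x) * Z m x \<partial>\<mu>) \<le> 4" for n m
  proof -
    have "norm (\<integral>x. cnj (Z n x) * Z m x \<partial>\<mu>) \<le> (\<integral>x. norm (cnj (Z n x) * Z m x) \<partial>\<mu>)"
      by (rule integral_norm_bound)
    also have "\<dots> \<le> (\<integral>x. 4 \<partial>\<mu>)"
    proof (rule integral_mono)
      show "norm (cnj (Z n x) * Z m x) \<le> 4" for x
        using mult_mono[OF Z_bound[of n x] Z_bound[of m x]] by (simp add: norm_mult)
    qed (rule integrable_norm[OF int_ZZ], simp)
    finally show ?thesis by simp
  qed
  \<comment> \<open>\<open>Z n\<close> is nearly a function \<open>W\<close> of the first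
    \<open>m\<close> digits, and \<open>Z m\<close> is orthogonal to all such functions.\<close>
  have corr_far: "norm (\<integral>x. cnj (Z n x) * Z m x \<partial>\<mu>) \<le> 2 * \<epsilon>"
    if p: "oscillates X p \<epsilon>"
      and \<epsilon>: "\<epsilon> > 0" and m: "m \<ge> n + p" for n m p \<epsilon>
  proof -
    define W where "W = cexp \<mu> (digits m) (Z n)"
    let ?G = "cell_mean \<mu> (digits m) (Z n)"
    have W: "W x = ?G (digits m x)" for x by (simp add: W_def cexp_def)
    have W_meas [measurable]: "W \<in> borel_measurable borel"
      unfolding W_def using cexp_measurable[OF digits_fin] by simp
    have W_bound: "norm (W x) \<le> 2" for x
      unfolding W_def using Z_bound by (intro cexp_norm_le[OF digits_fin]) auto
    have close: "AE x in \<mu>. norm (Z n x - W x) \<le> \<epsilon>"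
      unfolding W_def
    proof (rule cexp_close[OF digits_fin int_Z AE_unit])
      fix x y :: real assume xy: "x \<in> {0..<1}" "y \<in> {0..<1}" and eq: "digits m x = digits m y"
      have np: "digits (n + p) x = digits (n + p) y"
        using digits_refine[of "n + p" "m - (n + p)" x y] eq m by simp
      then have "digits n x = digits n y" by (rule digits_refine)
      then have "cexp \<mu> (digits n) (X n) x = cexp \<mu> (digits n) (X n) y"
        by (simp add: cexp_def)
      then have "Z n x - Z n y = X n x - X n y" by (simp add: Z_def)
      then show "norm (Z n x - Z n y) \<le> \<epsilon>" using p xy np by (simp add: oscillates_def)
    qed (use \<epsilon> in auto)
    have int_WX: "integrable \<mu> (\<lambda>x. cnj (W x) * X m x)"
      "integrable \<mu> (\<lambda>x. cnj (W x) * cexp \<mu> (digits m) (X m) x)"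
      unfolding W
      by (rule partition_integrable[OF digits_fin, where g = "\<lambda>d. cnj (?G d)"],
          rule int_X cexp_integrable[OF digits_fin])+
    have "(\<integral>x. cnj (W x) * Z m x \<partial>\<mu>)
        = (\<integral>x. cnj (W x) * X m x \<partial>\<mu>) - (\<integral>x. cnj (W x) * cexp \<mu> (digits m) (X m) x \<partial>\<mu>)"
      unfolding Z_def right_diff_distrib using int_WX by (rule Bochner_Integration.integral_diff)
    also have "\<dots> = 0"
      unfolding W cexp_projection[OF digits_fin int_X, where g = "\<lambda>d. cnj (?G d)"] by simp
    finally have 0: "(\<integral>x. cnj (W x) * Z m x \<partial>\<mu>) = 0" .
    have int_WZ: "integrable \<mu> (\<lambda>x. cnj (W x) * Z m x)"
      unfolding Z_def right_diff_distrib using int_WX by (rule Bochner_Integration.integrable_diff)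
    have "(\<integral>x. cnj (Z n x) * Z m x \<partial>\<mu>) = (\<integral>x. cnj (Z n x) * Z m x - cnj (W x) * Z m x \<partial>\<mu>)"
      using int_ZZ int_WZ 0 by simp
    also have "norm \<dots> \<le> (\<integral>x. norm (cnj (Z n x) * Z m x - cnj (W x) * Z m x) \<partial>\<mu>)"
      by (rule integral_norm_bound)
    also have "\<dots> \<le> (\<integral>x. \<epsilon> * 2 \<partial>\<mu>)"
    proof (rule integral_mono_AE)
      show "AE x in \<mu>. norm (cnj (Z n x) * Z m x - cnj (W x) * Z m x) \<le> \<epsilon> * 2"
        using close
      proof eventually_elim
        case (elim x)
        have "norm (cnj (Z n x) * Z m x - cnj (W x) * Z m x) = norm (cnj (Z n x - W x) * Z m x)"
          by (simp add: algebra_simps)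
        also have "\<dots> = norm (Z n x - W x) * norm (Z m x)"
          by (simp only: norm_mult complex_mod_cnj)
        also have "\<dots> \<le> \<epsilon> * 2" using elim \<epsilon> Z_bound by (intro mult_mono) auto
        finally show ?case .
      qed
    qed (use int_ZZ int_WZ in auto)
    finally show ?thesis by simp
  qed
  \<comment> \<open>Each \<open>i\<close> has at most \<open>2 * p\<close> partners at distance
    below \<open>p\<close>, with correlation at most 4; every pair contributes at most
    \<open>2 * \<epsilon>\<close> besides.\<close>
  have sum_sq: "(\<integral>x. (norm (\<Sum>i<N. Z (M + i) x))\<^sup>2 \<partial>\<mu>) \<le> 8 * real p * real N + 2 * \<epsilon> * (real N)\<^sup>2"
    if p: "oscillates X p \<epsilon>"
      and \<epsilon>: "\<epsilon> > 0" for N p \<epsilon>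
  proof -
    let ?c = "\<lambda>i j. \<integral>x. cnj (Z (M + i) x) * Z (M + j) x \<partial>\<mu>"
    have c_sym: "?c i j = cnj (?c j i)" for i j
      using Bochner_Integration.integral_cnj[of \<mu> "\<lambda>x. cnj (Z (M + j) x) * Z (M + i) x"] by (simp add: mult.commute)
    have c_le: "norm (?c i j) \<le> (if i < j + p \<and> j < i + p then 4 else 0) + 2 * \<epsilon>" for i j
    proof -
      consider "i < j + p \<and> j < i + p" | "j \<ge> i + p" | "i \<ge> j + p" by linarith
      then show ?thesis
      proof cases
        case 1 then show ?thesis using corr_le[of "M + i" "M + j"] \<epsilon> by simp
      next
        case 2 then show ?thesis using corr_far[OF p \<epsilon>, of "M + i" "M + j"] by simp
      next
        case 3
        have "norm (?c i j) = norm (?c j i)" by (subst c_sym) simp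
        then show ?thesis using 3 corr_far[OF p \<epsilon>, of "M + j" "M + i"] by simp
      qed
    qed
    have "complex_of_real (\<integral>x. (norm (\<Sum>i<N. Z (M + i) x))\<^sup>2 \<partial>\<mu>)
        = (\<integral>x. (\<Sum>i<N. \<Sum>j<N. cnj (Z (M + i) x) * Z (M + j) x) \<partial>\<mu>)"
      unfolding integral_norm_sq by (simp only: cnj_sum sum_product)
    also have "\<dots> = (\<Sum>i<N. \<Sum>j<N. ?c i j)"
      using int_ZZ by (simp add: Bochner_Integration.integral_sum)
    finally have "norm (complex_of_real (\<integral>x. (norm (\<Sum>i<N. Z (M + i) x))\<^sup>2 \<partial>\<mu>)) = norm (\<Sum>i<N. \<Sum>j<N. ?c i j)"
      by simp
    also have "\<dots> \<le> (\<Sum>i<N. \<Sum>j<N. (if i < j + p \<and> j < i + p then 4 else 0) + 2 * \<epsilon>)"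
      by (intro order_trans[OF norm_sum] sum_mono c_le)
    also have "\<dots> = (\<Sum>i<N. 4 * real (card {j \<in> {..<N}. i < j + p \<and> j < i + p}) + N * (2 * \<epsilon>))"
      by (simp add: sum.distrib sum.If_cases Int_def mult.commute)
    also have "\<dots> \<le> (\<Sum>i<N. 4 * real (2 * p) + N * (2 * \<epsilon>))"
      using card_close_le by (intro sum_mono add_mono mult_left_mono) (auto simp del: of_nat_mult)
    finally have "\<bar>\<integral>x. (norm (\<Sum>i<N. Z (M + i) x))\<^sup>2 \<partial>\<mu>\<bar> \<le> (\<Sum>i<N. 4 * real (2 * p) + N * (2 * \<epsilon>))"
      by (simp only: norm_of_real)
    also have "\<dots> = 8 * real p * real N + 2 * \<epsilon> * (real N)\<^sup>2"
      by (simp add: power2_eq_square algebra_simps)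
    finally show ?thesis by linarith
  qed
  have "(\<lambda>N. \<integral>x. norm ((\<Sum>i<N. Z (M + i) x) / N) \<partial>\<mu>) \<longlonglongrightarrow> 0"
  proof (rule tendstoI)
    fix e :: real assume e: "e > 0"
    \<comment> \<open>Then \<open>2 * \<epsilon>\<close> is half of the square of \<open>e\<close>,
      and the near-diagonal term takes the other half.\<close>
    define \<epsilon> where "\<epsilon> = e\<^sup>2 / 4"
    have \<epsilon>: "\<epsilon> > 0" using e by (simp add: \<epsilon>_def)
    obtain p where p: "oscillates X p \<epsilon>"
      using osc[OF \<epsilon>] by blast
    have "\<forall>\<^sub>F N in sequentially. 8 * real p / real N < e\<^sup>2 / 2"
      using e by (intro order_tendstoD(2)[OF lim_const_over_n]) auto
    then show "\<forall>\<^sub>F N in sequentially. dist (\<integral>x. norm ((\<Sum>i<N. Z (M + i) x) / N) \<partial>\<mu>) 0 < e"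
      using eventually_gt_at_top[of 0]
    proof eventually_elim
      case (elim N)
      have "(\<integral>x. norm ((\<Sum>i<N. Z (M + i) x) / N) \<partial>\<mu>) \<le> sqrt (\<integral>x. (norm ((\<Sum>i<N. Z (M + i) x) / N))\<^sup>2 \<partial>\<mu>)"
      proof (rule expectation_norm_le_sqrt)
        fix x
        have "norm (\<Sum>i<N. Z (M + i) x) \<le> (\<Sum>i<N. 2)"
          using Z_bound by (intro order_trans[OF norm_sum] sum_mono)
        then show "norm ((\<Sum>i<N. Z (M + i) x) / of_nat N) \<le> 2"
          using elim by (simp add: norm_divide divide_le_eq mult.commute)
      qed simp
      also have "(\<integral>x. (norm ((\<Sum>i<N. Z (M + i) x) / N))\<^sup>2 \<partial>\<mu>)
          = (\<integral>x. (norm (\<Sum>i<N. Z (M + i) x))\<^sup>2 \<partial>\<mu>) / (real N)\<^sup>2"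
        by (simp add: norm_divide power_divide)
      also have "sqrt \<dots> \<le> sqrt ((8 * real p * real N + 2 * \<epsilon> * (real N)\<^sup>2) / (real N)\<^sup>2)"
        by (intro real_sqrt_le_mono divide_right_mono sum_sq[OF p \<epsilon>]) auto
      also have "(8 * real p * real N + 2 * \<epsilon> * (real N)\<^sup>2) / (real N)\<^sup>2 = 8 * real p / real N + e\<^sup>2 / 2"
        using elim by (simp add: \<epsilon>_def field_simps power2_eq_square)
      also have "sqrt \<dots> < sqrt (e\<^sup>2)"
        using elim by (intro real_sqrt_less_mono) auto
      finally show ?case using e by (simp add: integral_nonneg_AE)
    qed
  qed
  then show ?thesis unfolding Z_def .
qed

section \<open>Weyl averages along orbits\<close>

definition fourier_coeff :: "nat \<Rightarrow> complex"
  where "fourier_coeff k = (\<integral>x. cis (2 * pi * real k * x) \<partial>\<mu>)"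

text \<open>Without reduction modulo 1, so that it applies to every real \<open>y\<close>, in
  particular to values of \<open>f\<close> outside the unit interval and to multiples by negative
  powers of \<open>a\<close>.\<close>

definition normal :: "nat \<Rightarrow> real \<Rightarrow> bool"
  where "normal k y \<longleftrightarrow>
    (\<lambda>N. (\<Sum>i<N. cis (2 * pi * real k * (of_int a ^ i * y))) / N) \<longlonglongrightarrow> fourier_coeff k"

lemma cis_Tn: "cis (2 * pi * real k * Tn i x) = cis (2 * pi * real k * (of_int a ^ i * x))"
proof -
  have "2 * pi * real k * (of_int a ^ i * x) = 2 * pi * real k * Tn i x + 2 * pi * of_int (int k * digits i x)"
    by (simp add: Tn_eq algebra_simps)
  also have "cis \<dots> = cis (2 * pi * real k * Tn i x)"
    by (simp add: cis_multiple_2pi flip: cis_mult)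
  finally show ?thesis ..
qed

lemma AE_normal: "AE x in \<mu>. normal k x"
proof -
  let ?c = "\<lambda>y. cis (2 * pi * real k * y)"
  have [measurable]: "?c \<in> borel_measurable borel" by measurable
  have int: "integrable \<mu> ?c" by (intro integrable_bounded[of _ 1]) auto
  have 1: "AE x in \<mu>. (\<lambda>N. (\<Sum>i<N. Re (?c (Tn i x))) / N) \<longlonglongrightarrow> (\<integral>x. Re (?c x) \<partial>\<mu>)"
    by (rule birkhoff[of _ 1]) (auto simp del: cis.sel intro: order_trans[OF abs_Re_le_cmod])
  have 2: "AE x in \<mu>. (\<lambda>N. (\<Sum>i<N. Im (?c (Tn i x))) / N) \<longlonglongrightarrow> (\<integral>x. Im (?c x) \<partial>\<mu>)"
    by (rule birkhoff[of _ 1]) (auto simp del: cis.sel intro: order_trans[OF abs_Im_le_cmod])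
  from 1 2 show ?thesis
  proof eventually_elim
    case (elim x)
    show ?case
      unfolding normal_def tendsto_complex_iff fourier_coeff_def integral_Re[OF int, symmetric] integral_Im[OF int, symmetric]
      using elim by (simp add: cis_Tn Re_divide_of_nat Im_divide_of_nat del: cis.sel)
  qed
qed

lemma average_shift:
  fixes s :: "nat \<Rightarrow> complex"
  assumes bound: "\<And>i. norm (s i) \<le> 1"
  shows "(\<lambda>N. (\<Sum>i<N. s (Suc i)) / N) \<longlonglongrightarrow> l \<longleftrightarrow> (\<lambda>N. (\<Sum>i<N. s i) / N) \<longlonglongrightarrow> l"
proof -
  have "(\<lambda>N. (\<Sum>i<N. s (Suc i)) / N - (\<Sum>i<N. s i) / N) \<longlonglongrightarrow> 0"
  proof (rule Lim_null_comparison)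
    show "\<forall>\<^sub>F N in sequentially. norm ((\<Sum>i<N. s (Suc i)) / N - (\<Sum>i<N. s i) / N) \<le> 2 / real N"
    proof (intro always_eventually allI)
      fix N
      have "(\<Sum>i<N. s (Suc i)) - (\<Sum>i<N. s i) = s N - s 0"
        by (simp flip: sum_subtractf add: sum_lessThan_telescope)
      then have "(\<Sum>i<N. s (Suc i)) / N - (\<Sum>i<N. s i) / N = (s N - s 0) / N"
        by (simp flip: diff_divide_distrib)
      moreover have "norm (s N - s 0) \<le> 2"
        using norm_triangle_ineq4[of "s N" "s 0"] bound[of N] bound[of 0] by linarith
      ultimately show "norm ((\<Sum>i<N. s (Suc i)) / N - (\<Sum>i<N. s i) / N) \<le> 2 / real N"
        by (simp add: norm_divide divide_right_mono)
    qed
    show "(\<lambda>N. 2 / real N) \<longlonglongrightarrow> 0" by (rule lim_const_over_n)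
  qed
  then show ?thesis by (rule Lim_transform_eq)
qed

lemma normal_mult: "normal k (of_int a * y) \<longleftrightarrow> normal k y"
  unfolding normal_def
  using average_shift[of "\<lambda>i. cis (2 * pi * real k * (of_int a ^ i * y))" "fourier_coeff k"]
  by (simp add: mult.assoc mult.left_commute)

lemma normal_mult_power: "normal k (of_int a ^ j * y) \<longleftrightarrow> normal k y"
  by (induction j) (simp_all add: mult.assoc normal_mult)

text \<open>Powers of either sign only shift the averages. So a slope may be changed by any power of
  \<open>a\<close> without leaving the normal points.\<close>

lemma normal_mult_powi: "normal k (of_int a powi j * y) \<longleftrightarrow> normal k y"
proof (cases "j \<ge> 0")
  case True
  then show ?thesis by (simp add: power_int_def normal_mult_power)
next
  case False
  then have "of_int a ^ nat (- j) * (of_int a powi j * y) = y"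
    using a_ge_2 by (simp add: power_int_def field_simps)
  then show ?thesis by (metis normal_mult_power)
qed

text \<open>Zooming into the cell of \<open>x\<close> of order \<open>n\<close> turns \<open>a ^ n * f\<close> into an affine map with
  slope \<open>f' x\<close>.\<close>

lemma linearisation:
  assumes f: "smooth f f'" and \<delta>: "\<delta> > 0"
  shows "\<exists>n0. \<forall>n\<ge>n0. \<forall>x\<in>{0..<1}. \<forall>y\<in>{0..<1}. digits n x = digits n y \<longrightarrow>
    \<bar>of_int a ^ n * (f y - f x) - f' x * (Tn n y - Tn n x)\<bar> \<le> \<delta>"
proof -
  note der = smoothD(1)[OF f] and cont = smoothD(2)[OF f]
  have "uniformly_continuous_on {0..1} f'"
    using cont by (intro compact_uniformly_continuous) (auto intro: continuous_on_subset)
  then obtain d where d: "d > 0" "\<And>x y. x \<in> {0..1} \<Longrightarrow> y \<in> {0..1} \<Longrightarrow> \<bar>y - x\<bar> < d \<Longrightarrow> \<bar>f' y - f' x\<bar> < \<delta>"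
    using \<delta> unfolding uniformly_continuous_on_def dist_real_def by meson
  obtain n0 where n0: "1 / d < of_int a ^ n0"
    using real_arch_pow[of "of_int a" "1 / d"] a_ge_2 by auto
  have "\<bar>of_int a ^ n * (f y - f x) - f' x * (Tn n y - Tn n x)\<bar> \<le> \<delta>"
    if n: "n \<ge> n0" and xy: "x \<in> {0..<1}" "y \<in> {0..<1}" and eq: "digits n x = digits n y" for n x y
  proof -
    have "(of_int a :: real) ^ n0 \<le> of_int a ^ n"
      using n a_ge_2 by (intro power_increasing) auto
    then have "1 / d < of_int a ^ n" using n0 by linarith
    then have "1 < of_int a ^ n * d" using d(1) by (simp add: field_simps)
    have close: "\<bar>x - y\<bar> * of_int a ^ n \<le> 1" by (rule digits_eq_close[OF eq])
    then have "\<bar>x - y\<bar> * of_int a ^ n < d * of_int a ^ n"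
      using \<open>1 < of_int a ^ n * d\<close> unfolding mult.commute[of d] by linarith
    then have xyd: "\<bar>x - y\<bar> < d" by (rule mult_right_less_imp_less) simp
    obtain z where z: "f y - f x = f' z * (y - x)" "min x y \<le> z" "z \<le> max x y"
    proof (cases x y rule: linorder_cases)
      case less
      from MVT2[OF less, of f f'] der obtain z where "x < z" "z < y" "f y - f x = (y - x) * f' z" by blast
      then show ?thesis using less by (intro that[of z]) (auto simp: mult.commute)
    next
      case equal
      then show ?thesis by (intro that[of x]) auto
    next
      case greater
      from MVT2[OF greater, of f f'] der obtain z where "y < z" "z < x" "f x - f y = (x - y) * f' z" by blast
      then show ?thesis using greater by (intro that[of z]) (auto simp: algebra_simps)
    qed
    have "z \<in> {0..1}" "x \<in> {0..1}" "\<bar>z - x\<bar> < d" using z xy xyd by (auto simp: min_def max_def split: if_splits)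
    then have f'z: "\<bar>f' z - f' x\<bar> < \<delta>" using d(2)[of x z] by simp
    have t: "Tn n y - Tn n x = of_int a ^ n * (y - x)"
      using eq by (simp add: Tn_eq algebra_simps)
    have "of_int a ^ n * (f y - f x) - f' x * (Tn n y - Tn n x) = (f' z - f' x) * (of_int a ^ n * (y - x))"
      unfolding t z(1) by (simp add: algebra_simps)
    also have "\<bar>\<dots>\<bar> = \<bar>f' z - f' x\<bar> * (\<bar>x - y\<bar> * of_int a ^ n)"
      by (simp add: abs_mult abs_minus_commute mult.commute)
    also have "\<dots> \<le> \<delta> * 1"
      using f'z close \<delta> by (intro mult_mono) auto
    finally show ?thesis by simp
  qed
  then show ?thesis by blast
qed

text \<open>On a cell of order \<open>n + p\<close>, \<open>a ^ n * f\<close> varies by at most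
  \<open>C / a ^ p\<close>, where \<open>C\<close> bounds the derivative on the unit
  interval.\<close>

lemma lipschitz_oscillation:
  assumes f: "smooth f f'" and \<epsilon>: "\<epsilon> > 0"
    and K: "K \<ge> (0 :: real)"
  shows "\<exists>p. oscillates (\<lambda>n x. cis (K * (of_int a ^ n * f x))) p \<epsilon>"
proof -
  note der = smoothD(1)[OF f] and cont = smoothD(2)[OF f]
  have "bounded (f' ` {0..1})"
    using cont by (intro compact_imp_bounded compact_continuous_image) (auto intro: continuous_on_subset)
  then obtain C where C: "C > 0" "\<And>x. x \<in> {0..1} \<Longrightarrow> \<bar>f' x\<bar> \<le> C"
    by (auto simp: bounded_pos)
  have lip: "\<bar>f x - f y\<bar> \<le> C * \<bar>x - y\<bar>" if "x \<in> {0..<1}" "y \<in> {0..<1}" for x y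
    using field_differentiable_bound[of "{0..1}" f f' C x y] that C DERIV_subset[OF der] by auto
  obtain p where p: "K * C / \<epsilon> < of_int a ^ p"
    using real_arch_pow[of "of_int a" "K * C / \<epsilon>"] a_ge_2 by auto
  then have p': "K * C \<le> \<epsilon> * of_int a ^ p" using \<epsilon> by (simp add: field_simps)
  have "norm (cis (K * (of_int a ^ n * f x)) - cis (K * (of_int a ^ n * f y))) \<le> \<epsilon>"
    if xy: "x \<in> {0..<1}" "y \<in> {0..<1}" and eq: "digits (n + p) x = digits (n + p) y" for n x y
  proof -
    have "norm (cis (K * (of_int a ^ n * f x)) - cis (K * (of_int a ^ n * f y)))
        \<le> \<bar>K * (of_int a ^ n * f x) - K * (of_int a ^ n * f y)\<bar>"
      by (rule norm_cis_diff_le)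
    also have "\<dots> = K * of_int a ^ n * \<bar>f x - f y\<bar>"
      using K by (simp add: abs_mult mult.assoc flip: right_diff_distrib)
    also have "\<dots> \<le> K * of_int a ^ n * (C * \<bar>x - y\<bar>)"
      using lip[OF xy] K by (intro mult_left_mono) auto
    also have "\<dots> = (K * C) * (\<bar>x - y\<bar> * of_int a ^ n)" by simp
    also have "\<dots> \<le> (\<epsilon> * of_int a ^ p) * (\<bar>x - y\<bar> * of_int a ^ n)"
      using p' by (intro mult_right_mono) auto
    also have "\<dots> = \<epsilon> * (\<bar>x - y\<bar> * of_int a ^ (n + p))" by (simp add: power_add)
    also have "\<dots> \<le> \<epsilon>" using digits_eq_close[OF eq] \<epsilon> by (simp add: mult_le_cancel_left1)
    finally show ?thesis .
  qed
  then show ?thesis unfolding oscillates_def by blast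
qed

abbreviation freq_energy :: "real \<Rightarrow> real"
  where "freq_energy \<xi> \<equiv> (SUP n. energy (\<lambda>y. cis (\<xi> * y)) n)"

text \<open>Everything is integrated over \<open>A\<close>: there the averages of \<open>X\<close>
  tend to the coefficient, by dominated convergence, while two of the errors are small only in the
  mean. The mass of \<open>A\<close> cancels in the end, which is why these errors are chosen
  proportional to it.\<close>

theorem fourier_coeff_le_freq_energy:
  assumes f: "smooth f f'"
    and A: "A \<in> sets borel" "measure \<mu> A > 0"
    and normal: "AE x in \<mu>. x \<in> A \<longrightarrow> normal k (f x)"
    and slope: "\<And>x. x \<in> A \<Longrightarrow> \<bar>\<bar>f' x\<bar> - \<theta>\<bar> \<le> \<epsilon>" and \<epsilon>: "\<epsilon> \<ge> 0"
  shows "norm (fourier_coeff k) \<le> sqrt (freq_energy (2 * pi * k * \<theta>)) + 2 * pi * k * \<epsilon>"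
proof (rule field_le_epsilon)
  fix \<eta> :: real assume \<eta>: "\<eta> > 0"
  define K where "K = 2 * pi * real k"
  have K: "K \<ge> 0" by (simp add: K_def)
  define \<psi> where "\<psi> y = cis (K * \<theta> * y)" for y
  \<comment> \<open>\<open>K + 1\<close> and not \<open>K\<close>, which is 0 for
    \<open>k = 0\<close>. The slack \<open>\<eta>\<close> is shared by \<open>K * \<delta>\<close>,
    the averages of \<open>cond\<close> and the decorrelation error.\<close>
  define \<delta> where "\<delta> = \<eta> / (3 * (K + 1))"
  have \<delta>: "\<delta> > 0" "K * \<delta> \<le> \<eta> / 3" using \<eta> K by (auto simp: \<delta>_def field_simps)
  note [measurable] = smooth_measurable[OF f] A(1)
  have \<psi>_meas [measurable]: "\<psi> \<in> borel_measurable borel" unfolding \<psi>_def by measurable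
  have \<psi>_norm: "norm (\<psi> x) \<le> 1" for x by (simp add: \<psi>_def)
  define X where "X n x = cis (K * (of_int a ^ n * f x))" for n x
  have X_meas [measurable]: "X n \<in> borel_measurable borel" for n unfolding X_def by measurable
  have X_norm: "norm (X n x) \<le> 1" for n x by (simp add: X_def)
  obtain n0 where n0: "\<And>n x y. n \<ge> n0 \<Longrightarrow> x \<in> {0..<1} \<Longrightarrow> y \<in> {0..<1} \<Longrightarrow> digits n x = digits n y \<Longrightarrow>
      \<bar>of_int a ^ n * (f y - f x) - f' x * (Tn n y - Tn n x)\<bar> \<le> \<delta>"
    using linearisation[OF f \<delta>(1)] by blast
  have cexp_X: "norm (cexp \<mu> (digits n) (X n) x) \<le> norm (cond \<psi> n x) + K * (\<delta> + \<epsilon>)"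
    if n: "n \<ge> n0" and x: "x \<in> {0..<1}" "x \<in> A" for n x
  proof -
    \<comment> \<open>A negative slope conjugates \<open>\<psi>\<close>, which leaves the modulus of
      the conditional mean unchanged.\<close>
    define \<sigma> where "\<sigma> = (if f' x \<ge> 0 then 1 else - 1 :: real)"
    have slope': "\<bar>f' x - \<sigma> * \<theta>\<bar> \<le> \<epsilon>" using slope[OF x(2)] by (auto simp: \<sigma>_def split: if_splits)
    define \<psi>' where "\<psi>' y = cis (K * (\<sigma> * \<theta>) * y)" for y
    \<comment> \<open>The phase at \<open>x\<close>: constant on the cell and of modulus 1.\<close>
    define c where "c = cis (K * (of_int a ^ n * f x - \<sigma> * \<theta> * Tn n x))"
    have [measurable]: "\<psi>' \<in> borel_measurable borel" unfolding \<psi>'_def by measurable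
    have "norm (cexp \<mu> (digits n) (X n) x - c * cexp \<mu> (digits n) (\<lambda>y. \<psi>' (Tn n y)) x) \<le> K * (\<delta> + \<epsilon>)"
    proof (rule cexp_affine_bound[OF digits_fin])
      show "integrable \<mu> (X n)" using X_norm by (intro integrable_bounded[of _ 1]) auto
      show "integrable \<mu> (\<lambda>y. \<psi>' (Tn n y))" by (intro integrable_bounded[of _ 1]) (auto simp: \<psi>'_def)
      have "norm (X n y - c * \<psi>' (Tn n y)) \<le> K * (\<delta> + \<epsilon>)"
        if y: "y \<in> {0..<1}" and eq: "digits n y = digits n x" for y
      proof -
        let ?r = "of_int a ^ n * (f y - f x) - f' x * (Tn n y - Tn n x)"
        let ?t = "Tn n y - Tn n x"
        have "norm (X n y - c * \<psi>' (Tn n y)) \<le>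
          \<bar>K * (of_int a ^ n * f y) - (K * (of_int a ^ n * f x - \<sigma> * \<theta> * Tn n x) + K * (\<sigma> * \<theta>) * Tn n y)\<bar>"
          unfolding X_def c_def \<psi>'_def cis_mult by (rule norm_cis_diff_le)
        also have "\<dots> = \<bar>K * (?r + (f' x - \<sigma> * \<theta>) * ?t)\<bar>"
          by (rule arg_cong[where f = abs]) (simp add: algebra_simps)
        also have "\<dots> = K * \<bar>?r + (f' x - \<sigma> * \<theta>) * ?t\<bar>" using K by (simp add: abs_mult)
        also have "\<dots> \<le> K * (\<delta> + \<epsilon>)"
        proof (intro mult_left_mono K)
          have "\<bar>?r\<bar> \<le> \<delta>" using n0[OF n x(1) y] eq by simp
          moreover have "\<bar>(f' x - \<sigma> * \<theta>) * ?t\<bar> \<le> \<epsilon> * 1"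
            unfolding abs_mult using slope' Tn_range[of n x] Tn_range[of n y] \<epsilon> by (intro mult_mono) auto
          ultimately show "\<bar>?r + (f' x - \<sigma> * \<theta>) * ?t\<bar> \<le> \<delta> + \<epsilon>" by linarith
        qed
        finally show ?thesis .
      qed
      with AE_unit show "AE y in \<mu>. digits n y = digits n x \<longrightarrow> norm (X n y - c * \<psi>' (Tn n y)) \<le> K * (\<delta> + \<epsilon>)"
        by (auto elim: AE_mp)
    qed (use K \<delta> \<epsilon> in auto)
    then have "norm (cexp \<mu> (digits n) (X n) x)
        \<le> norm (c * cexp \<mu> (digits n) (\<lambda>y. \<psi>' (Tn n y)) x) + K * (\<delta> + \<epsilon>)"
      using norm_triangle_sub[of "cexp \<mu> (digits n) (X n) x" "c * cexp \<mu> (digits n) (\<lambda>y. \<psi>' (Tn n y)) x"]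
      by linarith
    also have "norm (c * cexp \<mu> (digits n) (\<lambda>y. \<psi>' (Tn n y)) x) = norm (cexp \<mu> (digits n) (\<lambda>y. \<psi>' (Tn n y)) x)"
      by (simp add: norm_mult c_def)
    also have "\<dots> = norm (cond \<psi> n x)"
    proof (cases "f' x \<ge> 0")
      case True
      then show ?thesis by (simp add: cond_def \<psi>'_def \<psi>_def \<sigma>_def)
    next
      case False
      then have "\<psi>' = (\<lambda>y. cnj (\<psi> y))" by (auto simp: \<psi>'_def \<psi>_def \<sigma>_def cis_cnj)
      then show ?thesis by (simp add: cond_def cexp_cnj)
    qed
    finally show ?thesis .
  qed
  let ?w = "measure \<mu> A"
  let ?C = "sqrt (SUP n. energy \<psi> n)"
  obtain q0 m0 where q0: "\<And>q M. q \<ge> q0 \<Longrightarrow> M \<ge> m0 \<Longrightarrow> \<exists>g. integrable \<mu> g \<and> (\<integral>x. g x \<partial>\<mu>) \<le> ?w * (\<eta> / 3) \<and>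
    (\<forall>x. 0 \<le> g x \<and> (\<Sum>i<q. norm (cond \<psi> (M + i) x)) / q \<le> ?C + g x)"
  proof -
    have "0 < ?w * (\<eta> / 3)" using A \<eta> by simp
    from cond_average_upper[OF \<psi>_meas \<psi>_norm this] show ?thesis using that by blast
  qed
  \<comment> \<open>Beyond \<open>m0\<close> the averages are under control, beyond
    \<open>n0\<close> the linearisation. Starting at \<open>M\<close> replaces \<open>f x\<close> by
    \<open>a ^ M * f x\<close>, which is normal as well.\<close>
  define M where "M = max m0 n0"
  define S where "S N x = (\<Sum>i<N. X (M + i) x) / of_nat N" for N x
  define Y where "Y N x = (\<Sum>i<N. X (M + i) x - cexp \<mu> (digits (M + i)) (X (M + i)) x) / of_nat N" for N x
  have [measurable]: "cexp \<mu> (digits n) (X n) \<in> borel_measurable borel" for n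
    using cexp_measurable[OF digits_fin] by simp
  have S_meas [measurable]: "S N \<in> borel_measurable borel" for N unfolding S_def by measurable
  have S_norm: "norm (S N x) \<le> 1" for N x
  proof -
    have "norm (\<Sum>i<N. X (M + i) x) \<le> (\<Sum>i<N. 1)"
      using X_norm by (intro order_trans[OF norm_sum] sum_mono)
    then show ?thesis by (cases "N = 0") (simp_all add: S_def norm_divide)
  qed
  have int_Y: "integrable \<mu> (Y N)" for N
  proof -
    have "integrable \<mu> (X n)" for n using X_norm by (intro integrable_bounded[of _ 1]) auto
    then show ?thesis
      unfolding Y_def using cexp_integrable[OF digits_fin]
      by (intro integrable_divide Bochner_Integration.integrable_sum Bochner_Integration.integrable_diff) auto
  qed
  have "(\<lambda>N. \<integral>x. norm (Y N x) \<partial>\<mu>) \<longlonglongrightarrow> 0"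
    unfolding Y_def
    by (rule conditional_decorrelation[OF X_meas X_norm])
      (use lipschitz_oscillation[OF f _ K] in \<open>simp add: X_def[abs_def]\<close>)
  then have Y_small: "\<forall>\<^sub>F N in sequentially. (\<integral>x. norm (Y N x) \<partial>\<mu>) < ?w * (\<eta> / 3)"
    using A \<eta> by (intro order_tendstoD(2)) auto
  have lim: "(\<lambda>N. \<integral>x. indicator A x * norm (S N x) \<partial>\<mu>) \<longlonglongrightarrow> (\<integral>x. indicator A x * norm (fourier_coeff k) \<partial>\<mu>)"
  proof (rule integral_dominated_convergence[where w = "\<lambda>_. 1"])
    show "AE x in \<mu>. (\<lambda>N. indicator A x * norm (S N x)) \<longlonglongrightarrow> indicator A x * norm (fourier_coeff k)"
      using normal
    proof eventually_elim
      case (elim x)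
      show ?case
      proof (cases "x \<in> A")
        case True
        then have "normal k (of_int a ^ M * f x)" using elim normal_mult_power by simp
        then have "(\<lambda>N. S N x) \<longlonglongrightarrow> fourier_coeff k"
          unfolding normal_def S_def X_def K_def by (simp add: power_add ac_simps)
        then show ?thesis by (intro tendsto_intros)
      qed simp
    qed
    show "AE x in \<mu>. norm (indicator A x * norm (S N x)) \<le> 1" for N
      using S_norm by (intro AE_I2) (auto simp: indicator_def)
  qed simp_all
  have intA: "integrable \<mu> (\<lambda>x. indicator A x :: real)"
    by (intro integrable_bounded[of _ 1]) (auto simp: indicator_def)
  have "\<forall>\<^sub>F N in sequentially. (\<integral>x. indicator A x * norm (S N x) \<partial>\<mu>) \<le> ?w * (?C + K * \<epsilon> + \<eta>)"
    using Y_small eventually_ge_at_top[of q0] eventually_gt_at_top[of 0]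
  proof eventually_elim
    case (elim N)
    obtain g where g: "integrable \<mu> g" "(\<integral>x. g x \<partial>\<mu>) \<le> ?w * (\<eta> / 3)" "\<And>x. 0 \<le> g x"
      "\<And>x. (\<Sum>i<N. norm (cond \<psi> (M + i) x)) / N \<le> ?C + g x"
      using q0[OF elim(2), of M] by (auto simp: M_def)
    have "(\<integral>x. indicator A x * norm (S N x) \<partial>\<mu>)
        \<le> (\<integral>x. norm (Y N x) + g x + indicator A x * (?C + K * (\<delta> + \<epsilon>)) \<partial>\<mu>)"
    proof (rule integral_mono_AE)
      show "integrable \<mu> (\<lambda>x. indicator A x * norm (S N x))"
        using S_norm by (intro integrable_bounded[of _ 1]) (auto simp: indicator_def)
      show "integrable \<mu> (\<lambda>x. norm (Y N x) + g x + indicator A x * (?C + K * (\<delta> + \<epsilon>)))"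
        by (intro Bochner_Integration.integrable_add integrable_norm integrable_mult_left intA int_Y g(1))
      show "AE x in \<mu>. indicator A x * norm (S N x) \<le> norm (Y N x) + g x + indicator A x * (?C + K * (\<delta> + \<epsilon>))"
        using AE_unit
      proof eventually_elim
        case (elim x)
        show ?case
        proof (cases "x \<in> A")
          case True
          have "S N x = Y N x + (\<Sum>i<N. cexp \<mu> (digits (M + i)) (X (M + i)) x) / of_nat N"
            by (simp add: S_def Y_def sum_subtractf diff_divide_distrib)
          then have "norm (S N x) \<le> norm (Y N x) + norm ((\<Sum>i<N. cexp \<mu> (digits (M + i)) (X (M + i)) x) / of_nat N)"
            by (simp add: norm_triangle_ineq)
          moreover have "norm ((\<Sum>i<N. cexp \<mu> (digits (M + i)) (X (M + i)) x) / of_nat N)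
              \<le> (\<Sum>i<N. norm (cond \<psi> (M + i) x) + K * (\<delta> + \<epsilon>)) / N"
            unfolding norm_divide norm_of_nat using cexp_X[OF _ elim True]
            by (intro divide_right_mono order_trans[OF norm_sum] sum_mono) (auto simp: M_def)
          moreover have "(\<Sum>i<N. norm (cond \<psi> (M + i) x) + K * (\<delta> + \<epsilon>)) / N
              = (\<Sum>i<N. norm (cond \<psi> (M + i) x)) / N + K * (\<delta> + \<epsilon>)"
            using \<open>0 < N\<close> by (simp add: sum.distrib add_divide_distrib)
          ultimately have "norm (S N x) \<le> norm (Y N x) + (?C + g x + K * (\<delta> + \<epsilon>))"
            using g(4)[of x] by linarith
          then show ?thesis using True by simp
        qed (use g(3) in simp)
      qed
    qed
    also have "\<dots> = (\<integral>x. norm (Y N x) \<partial>\<mu>) + (\<integral>x. g x \<partial>\<mu>) + ?w * (?C + K * (\<delta> + \<epsilon>))"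
      using integrable_norm[OF int_Y] g(1) integrable_mult_left[OF intA]
      by (subst Bochner_Integration.integral_add, simp, simp)+ simp
    also have "\<dots> \<le> ?w * (\<eta> / 3) + ?w * (\<eta> / 3) + ?w * (?C + K * \<epsilon> + \<eta> / 3)"
    proof (intro add_mono)
      have "?C + K * (\<delta> + \<epsilon>) \<le> ?C + K * \<epsilon> + \<eta> / 3"
        using \<delta>(2) unfolding distrib_left by linarith
      then show "?w * (?C + K * (\<delta> + \<epsilon>)) \<le> ?w * (?C + K * \<epsilon> + \<eta> / 3)"
        by (intro mult_left_mono) auto
    qed (use elim(1) g(2) in auto)
    finally show ?case by (simp add: algebra_simps)
  qed
  then have "(\<integral>x. indicator A x * norm (fourier_coeff k) \<partial>\<mu>) \<le> ?w * (?C + K * \<epsilon> + \<eta>)"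
    by (intro tendsto_upperbound[OF lim]) auto
  then have "?w * norm (fourier_coeff k) \<le> ?w * (?C + K * \<epsilon> + \<eta>)" by simp
  then show "norm (fourier_coeff k) \<le> sqrt (freq_energy (2 * pi * k * \<theta>)) + 2 * pi * k * \<epsilon> + \<eta>"
    using A by (simp add: mult_le_cancel_left_pos \<psi>_def[abs_def] K_def)
qed

end

section \<open>Decay of the conditional masses of cells\<close>

text \<open>With \<open>s = sqrt u\<close>, \<open>- ln u\<close> is at most
  \<open>2 * (1 - u) / s\<close>, which the inequality of arithmetic and geometric means splits with
  weight \<open>K\<close>. For \<open>u\<close> a conditional mass, \<open>1 / u\<close> has bounded
  integral, so a large \<open>K\<close> makes the singular term cheap; the other one is small when
  the mean of \<open>u\<close> is near 1.\<close>

lemma neg_ln_le: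
  fixes u K :: real
  assumes "0 < u" "u \<le> 1" "K > 0"
  shows "- ln u \<le> K * (1 - u) + 1 / (K * u)"
proof -
  define s where "s = sqrt u"
  have s: "0 < s" "s \<le> 1" "s\<^sup>2 = u" using assms by (auto simp: s_def)
  have "ln (1 / s) \<le> 1 / s - 1" using s by (intro ln_le_minus_one) auto
  then have "- ln s \<le> (1 - s) / s" using s by (simp add: ln_div diff_divide_distrib)
  moreover have "ln u = 2 * ln s" using s by (simp add: ln_realpow flip: s(3))
  moreover have "(1 - s) / s \<le> (1 - u) * (1 / s)"
  proof -
    have "u \<le> s" using s by (metis power2_eq_square mult_left_le less_imp_le)
    then show ?thesis using s by (simp add: divide_right_mono)
  qed
  ultimately have 1: "- ln u \<le> 2 * ((1 - u) * (1 / s))" by linarith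
  have "0 \<le> (K * (1 - u) - 1 / s)\<^sup>2 / K" using assms(3) by simp
  also have "\<dots> = K * (1 - u)\<^sup>2 - 2 * ((1 - u) * (1 / s)) + 1 / (K * u)"
    using assms(3) s(1) unfolding s(3)[symmetric] by (simp add: field_simps power2_eq_square)
  finally have "2 * ((1 - u) * (1 / s)) \<le> K * (1 - u)\<^sup>2 + 1 / (K * u)" by linarith
  moreover have "(1 - u)\<^sup>2 \<le> 1 - u" using assms by (simp add: power2_eq_square mult_left_le)
  then have "K * (1 - u)\<^sup>2 \<le> K * (1 - u)" using assms(3) by simp
  ultimately show ?thesis using 1 by linarith
qed

context times_ergodic
begin

definition mass :: "nat \<Rightarrow> real \<Rightarrow> real"
  where "mass n x = measure \<mu> {y. digits n y = digits n x}"

lemma digits_set_measurable [measurable]: "{y. digits n y = d} \<in> sets borel"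
  by measurable

lemma digits_fun_measurable: "(\<lambda>x. g (digits n x)) \<in> borel_measurable borel"
  by (rule measurable_compose[OF digits_measurable]) simp

lemma mass_measurable [measurable]: "mass n \<in> borel_measurable borel"
  unfolding mass_def by (rule digits_fun_measurable)

lemma mass_nonneg [simp]: "0 \<le> mass n x" by (simp add: mass_def)

lemma AE_mass_pos: "AE x in \<mu>. 0 < mass n x"
  unfolding mass_def using AE_partition_pos[OF digits_fin] by simp

lemma mass_antimono: "mass (n + p) x \<le> mass n x"
proof -
  have "{y. digits (n + p) y = digits (n + p) x} \<subseteq> {y. digits n y = digits n x}"
    by (blast intro: digits_refine)
  then show ?thesis unfolding mass_def by (intro finite_measure_mono) auto
qed

lemma mass_quotient_le_1: "mass (n + p) x / mass n x \<le> 1"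
proof -
  have "mass (n + p) x / mass n x \<le> mass n x / mass n x"
    using mass_antimono by (intro divide_right_mono) auto
  also have "\<dots> \<le> 1" by simp
  finally show ?thesis .
qed

text \<open>The conditional mass of the digit of \<open>x\<close> that follows the first
  \<open>n\<close>; it is 0 when the cell is null.\<close>

definition ratio :: "nat \<Rightarrow> real \<Rightarrow> real"
  where "ratio n x = mass (Suc n) x / mass n x"

lemma ratio_measurable [measurable]: "ratio n \<in> borel_measurable borel"
  unfolding ratio_def by measurable

lemma ratio_nonneg [simp]: "0 \<le> ratio n x" by (simp add: ratio_def)

lemma ratio_le_1 [simp]: "ratio n x \<le> 1"
  using mass_quotient_le_1[of n 1 x] by (simp add: ratio_def)

lemma mass_eq_prod: "mass (n + q) x = mass n x * (\<Prod>i<q. ratio (n + i) x)"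
proof (induction q)
  case (Suc q)
  have "mass (Suc (n + q)) x = mass (n + q) x * ratio (n + q) x"
    using mass_antimono[of "n + q" 1 x] mass_nonneg[of "Suc (n + q)" x]
    by (cases "mass (n + q) x = 0") (auto simp: ratio_def intro: antisym)
  then show ?case using Suc by simp
qed simp

definition digit_char :: "int \<Rightarrow> real \<Rightarrow> complex"
  where "digit_char j z = of_bool (digits 1 z = j)"

lemma digit_char_measurable [measurable]: "digit_char j \<in> borel_measurable borel"
  unfolding digit_char_def by (rule digits_fun_measurable)

lemma digit_char_norm: "norm (digit_char j z) \<le> 1" by (simp add: digit_char_def)

text \<open>Reduces \<open>ratio\<close> to conditional means of fixed functions, except that the
  function depends on the next digit of \<open>x\<close>; hence the sums over all \<open>a\<close>
  digits in the estimates that follow.\<close>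

lemma cond_digit_char: "cond (digit_char (digits 1 (Tn n x))) n x = of_real (ratio n x)"
proof -
  let ?j = "digits 1 (Tn n x)"
  have iff: "digits n y = digits n x \<and> digits 1 (Tn n y) = ?j \<longleftrightarrow> digits (Suc n) y = digits (Suc n) x" for y
    using digits_Tn[of 1 n] digits_refine[of n 1 y x] by auto
  have "(\<integral>y. of_bool (digits n y = digits n x) * digit_char ?j (Tn n y) \<partial>\<mu>)
      = (\<integral>y. of_bool (digits (Suc n) y = digits (Suc n) x) \<partial>\<mu>)"
    by (intro Bochner_Integration.integral_cong) (auto simp: digit_char_def simp flip: iff)
  also have "\<dots> = of_real (mass (Suc n) x)"
    using partition_cell_prob[OF digits_fin] by (simp add: mass_def)
  finally show ?thesis
    by (simp add: cond_def cexp_def cell_mean_def ratio_def mass_def)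
qed

lemma digits_1_Tn: "digits 1 (Tn n x) \<in> {0..<a}"
proof -
  have "of_int a * Tn n x < of_int a * 1" using Tn_range(2)[of n x] a_ge_2 by (intro mult_strict_left_mono) auto
  moreover have "0 \<le> of_int a * Tn n x" using Tn_range(1)[of n x] a_ge_2 by simp
  ultimately show ?thesis by (simp add: digits_def floor_less_iff)
qed

lemma ratio_limit:
  "\<exists>U. (\<lambda>m. expectation (ratio m)) \<longlonglongrightarrow> U \<and> averages_to ratio U"
proof -
  define \<delta> where "\<delta> m = (\<Sum>j\<in>{0..<a}. sqrt ((SUP n. energy (digit_char j) n) - energy (digit_char j) m))" for m
  have \<delta>: "\<delta> \<longlonglongrightarrow> 0"
  proof -
    have "\<delta> \<longlonglongrightarrow> (\<Sum>j\<in>{0..<a}. 0)"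
      unfolding \<delta>_def by (intro tendsto_sum cond_diff_tendsto digit_char_norm) measurable
    then show ?thesis by simp
  qed
  have close: "(\<integral>x. \<bar>ratio (m + k) x - ratio m (Tn k x)\<bar> \<partial>\<mu>) \<le> \<delta> m" for m k
  proof -
    let ?n = "\<lambda>j x. norm (cond (digit_char j) (m + k) x - cond (digit_char j) m (Tn k x))"
    have int: "integrable \<mu> (?n j)" for j
      using cond_norm_le[of "digit_char j", OF _ digit_char_norm]
      by (intro integrable_norm Bochner_Integration.integrable_diff integrable_bounded[of _ 1]) auto
    have "(\<integral>x. \<bar>ratio (m + k) x - ratio m (Tn k x)\<bar> \<partial>\<mu>) \<le> (\<integral>x. (\<Sum>j\<in>{0..<a}. ?n j x) \<partial>\<mu>)"
    proof (rule integral_mono)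
      show "integrable \<mu> (\<lambda>x. \<bar>ratio (m + k) x - ratio m (Tn k x)\<bar>)"
        by (intro integrable_abs Bochner_Integration.integrable_diff integrable_bounded[of _ 1]) auto
      show "integrable \<mu> (\<lambda>x. \<Sum>j\<in>{0..<a}. ?n j x)"
        using int by (intro Bochner_Integration.integrable_sum)
      fix x
      let ?j = "digits 1 (Tn (m + k) x)"
      have "\<bar>ratio (m + k) x - ratio m (Tn k x)\<bar> = norm (complex_of_real (ratio (m + k) x) - of_real (ratio m (Tn k x)))"
        by (simp flip: of_real_diff)
      also have "\<dots> = ?n ?j x"
        using cond_digit_char[of "m + k" x] cond_digit_char[of m "Tn k x"] by (simp add: Tn_add)
      also have "\<dots> \<le> (\<Sum>j\<in>{0..<a}. ?n j x)"
        using digits_1_Tn by (intro member_le_sum) auto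
      finally show "\<bar>ratio (m + k) x - ratio m (Tn k x)\<bar> \<le> (\<Sum>j\<in>{0..<a}. ?n j x)" .
    qed
    also have "\<dots> = (\<Sum>j\<in>{0..<a}. \<integral>x. ?n j x \<partial>\<mu>)"
      using int by (intro Bochner_Integration.integral_sum)
    also have "\<dots> \<le> \<delta> m"
      unfolding \<delta>_def by (intro sum_mono cond_diff_L1 digit_char_norm) measurable
    finally show ?thesis .
  qed
  show ?thesis
  proof (rule ergodic_average_approx[OF _ _ \<delta> close])
    show "\<bar>ratio n x\<bar> \<le> 1" for n x by simp
  qed auto
qed

text \<open>Given the cell, a digit of conditional mass \<open>w > 0\<close> occurs with probability
  \<open>w\<close> and contributes \<open>w * (1 / w) = 1\<close>; there are \<open>a\<close>
  digits.\<close>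

lemma integral_inverse_ratio: "integrable \<mu> (\<lambda>x. 1 / ratio m x)" "(\<integral>x. 1 / ratio m x \<partial>\<mu>) \<le> of_int a"
proof -
  let ?G = "\<lambda>j. cell_mean \<mu> (digits m) (\<lambda>x. digit_char j (Tn m x))"
  have G: "cond (digit_char j) m x = ?G j (digits m x)" for j x
    by (simp add: cond_def cexp_def)
  let ?h = "\<lambda>j x. (1 / ?G j (digits m x)) * digit_char j (Tn m x)"
  have int_char: "integrable \<mu> (\<lambda>x. digit_char j (Tn m x))" for j
    using digit_char_norm by (intro integrable_bounded[of _ 1]) auto
  have int_h: "integrable \<mu> (?h j)" for j
    by (rule partition_integrable[OF digits_fin int_char, where g = "\<lambda>d. 1 / ?G j d"])
  have eq: "complex_of_real (1 / ratio m x) = (\<Sum>j\<in>{0..<a}. ?h j x)" for x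
  proof -
    let ?j = "digits 1 (Tn m x)"
    have "(\<Sum>j\<in>{0..<a}. ?h j x) = (\<Sum>j\<in>{0..<a}. if j = ?j then 1 / cond (digit_char ?j) m x else 0)"
      by (intro sum.cong) (auto simp: G digit_char_def)
    also have "\<dots> = 1 / of_real (ratio m x)"
      using digits_1_Tn[of m x] cond_digit_char[of m x] by simp
    finally show ?thesis by simp
  qed
  have "integrable \<mu> (\<lambda>x. complex_of_real (1 / ratio m x))"
    unfolding eq using int_h by (intro Bochner_Integration.integrable_sum)
  then show "integrable \<mu> (\<lambda>x. 1 / ratio m x)"
    by (simp only: complex_of_real_integrable_eq)
  have "complex_of_real (\<integral>x. 1 / ratio m x \<partial>\<mu>) = (\<integral>x. complex_of_real (1 / ratio m x) \<partial>\<mu>)"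
    by (rule integral_complex_of_real[symmetric])
  also have "\<dots> = (\<Sum>j\<in>{0..<a}. \<integral>x. ?h j x \<partial>\<mu>)"
    unfolding eq using int_h by (intro Bochner_Integration.integral_sum)
  also have "norm \<dots> \<le> (\<Sum>j\<in>{0..<a}. 1)"
  proof (intro order_trans[OF norm_sum] sum_mono)
    fix j
    have "(\<integral>x. ?h j x \<partial>\<mu>) = (\<integral>x. (1 / ?G j (digits m x)) * cexp \<mu> (digits m) (\<lambda>x. digit_char j (Tn m x)) x \<partial>\<mu>)"
      by (rule cexp_projection[OF digits_fin int_char, where g = "\<lambda>d. 1 / ?G j d", symmetric])
    also have "\<dots> = (\<integral>x. of_bool (cond (digit_char j) m x \<noteq> 0) \<partial>\<mu>)"
    proof (intro Bochner_Integration.integral_cong refl)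
      fix x
      show "(1 / ?G j (digits m x)) * cexp \<mu> (digits m) (\<lambda>x. digit_char j (Tn m x)) x
          = of_bool (cond (digit_char j) m x \<noteq> 0)"
        unfolding G[symmetric] cond_def[symmetric] by simp
    qed
    also have "norm \<dots> \<le> (\<integral>x. norm (of_bool (cond (digit_char j) m x \<noteq> 0) :: complex) \<partial>\<mu>)"
      by (rule integral_norm_bound)
    also have "\<dots> \<le> (\<integral>x. 1 \<partial>\<mu>)"
      by (intro integral_mono integrable_bounded[of _ 1]) auto
    finally show "norm (\<integral>x. ?h j x \<partial>\<mu>) \<le> 1" by simp
  qed
  finally show "(\<integral>x. 1 / ratio m x \<partial>\<mu>) \<le> of_int a"
    using a_ge_2 by (simp del: of_real_divide)
qed

text \<open>The cell of order \<open>N\<close> lies in a ball of radius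
  \<open>r = 2 / a ^ N\<close>, whose mass is eventually below \<open>r powr (d / 2)\<close>. As
  \<open>d\<close> and the threshold vary with \<open>x\<close>, a set of mass above 1/2 with common
  constants is extracted.\<close>

lemma mass_exponential_decay:
  assumes "intermediate_dimension \<mu>"
  shows "\<exists>c>0. \<exists>G\<in>sets borel. \<exists>N0. measure \<mu> G > 1 / 2 \<and>
    (\<forall>N\<ge>N0. \<forall>x\<in>G. mass N x \<le> exp (- c * real N))"
proof -
  \<comment> \<open>One index serves as the threshold and, inverted, as the rate.\<close>
  define G where "G j = {x. \<forall>N\<ge>j. mass N x \<le> exp (- (1 / real (Suc j)) * real N)}" for j
  have [measurable]: "G j \<in> sets borel" for j unfolding G_def by measurable
  have "incseq G"
  proof (rule incseq_SucI, rule subsetI)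
    fix j x assume x: "x \<in> G j"
    show "x \<in> G (Suc j)"
      unfolding G_def
    proof (intro CollectI allI impI)
      fix N assume N: "Suc j \<le> N"
      have "mass N x \<le> exp (- (1 / real (Suc j)) * real N)"
        using x N unfolding G_def by simp
      also have "\<dots> \<le> exp (- (1 / real (Suc (Suc j))) * real N)"
        unfolding exp_le_cancel_iff by (intro mult_right_mono) (auto intro: frac_le)
      finally show "mass N x \<le> exp (- (1 / real (Suc (Suc j))) * real N)" .
    qed
  qed
  have "AE x in \<mu>. x \<in> (\<Union>j. G j)"
  proof -
    have "AE x in \<mu>. \<forall>n. 0 < mass n x" using AE_mass_pos by (simp add: AE_all_countable)
    with assms[unfolded intermediate_dimension_def] show ?thesis
    proof eventually_elim
      case (elim x)
      then obtain d where d: "has_local_dim \<mu> x d" "0 < d" by blast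
      \<comment> \<open>The factor 2 puts the cell, of length \<open>1 / a ^ N\<close>, inside the
        open ball.\<close>
      define r where "r N = 2 / (of_int a :: real) ^ N" for N :: nat
      have "filterlim r (at_right 0) sequentially"
      proof (rule tendsto_imp_filterlim_at_right)
        have "(\<lambda>N. 2 * (1 / of_int a :: real) ^ N) \<longlonglongrightarrow> 2 * 0"
          using a_ge_2 by (intro tendsto_intros LIMSEQ_power_zero) auto
        then show "r \<longlonglongrightarrow> 0" by (simp add: r_def[abs_def] power_divide)
      qed (simp add: r_def)
      then have "(\<lambda>N. ln (measure \<mu> (ball x (r N))) / ln (r N)) \<longlonglongrightarrow> d"
        using d(1) unfolding has_local_dim_def by (rule filterlim_compose[rotated])
      then have "\<forall>\<^sub>F N in sequentially. ln (measure \<mu> (ball x (r N))) / ln (r N) > d / 2"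
        using d(2) by (intro order_tendstoD) auto
      then obtain N1 where N1: "\<And>N. N \<ge> N1 \<Longrightarrow> ln (measure \<mu> (ball x (r N))) / ln (r N) > d / 2"
        by (auto simp: eventually_sequentially)
      \<comment> \<open>One factor 1/2 comes from the limit, the other absorbs \<open>ln 2\<close>
        in \<open>ln (r N)\<close>.\<close>
      define c where "c = d / 4 * ln (of_int a)"
      have lna: "ln 2 \<le> ln (of_int a :: real)" "0 < ln (of_int a :: real)" using a_ge_2 by auto
      have c: "c > 0" using d(2) lna unfolding c_def by (intro mult_pos_pos) auto
      have bound: "mass N x \<le> exp (- c * real N)" if N: "N \<ge> N1" "N \<ge> 3" for N
      proof -
        have lnr: "ln (r N) = ln 2 - real N * ln (of_int a)"
          using a_ge_2 by (simp add: r_def ln_div ln_realpow)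
        have "real N / 2 * ln (of_int a) \<ge> 1 * ln (of_int a :: real)"
          using N lna by (intro mult_right_mono) auto
        then have lnr': "ln (r N) \<le> - (real N / 2 * ln (of_int a))"
          unfolding lnr using lna by linarith
        moreover have "0 < real N / 2 * ln (of_int a :: real)" using N lna by (intro mult_pos_pos) auto
        ultimately have neg: "ln (r N) < 0" by linarith
        have "{y. digits N y = digits N x} \<subseteq> ball x (r N)"
        proof
          fix y assume "y \<in> {y. digits N y = digits N x}"
          then have "\<bar>x - y\<bar> * of_int a ^ N \<le> 1" using digits_eq_close[of N x y] by simp
          then show "y \<in> ball x (r N)" by (simp add: r_def dist_real_def field_simps)
        qed
        then have le: "mass N x \<le> measure \<mu> (ball x (r N))"
          unfolding mass_def by (intro finite_measure_mono) auto
        then have pos: "measure \<mu> (ball x (r N)) > 0" using elim(2) less_le_trans by blast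
        have "ln (measure \<mu> (ball x (r N))) < d / 2 * ln (r N)"
          using N1[OF N(1)] neg by (simp add: neg_less_divide_eq)
        also have "\<dots> \<le> d / 2 * - (real N / 2 * ln (of_int a))"
          using lnr' d(2) by (intro mult_left_mono) auto
        also have "\<dots> = - c * real N" by (simp add: c_def)
        finally have "exp (ln (measure \<mu> (ball x (r N)))) \<le> exp (- c * real N)" by simp
        then have "measure \<mu> (ball x (r N)) \<le> exp (- c * real N)" using pos by simp
        with le show ?thesis by linarith
      qed
      obtain j1 where j1: "1 / real (Suc j1) < c" using reals_Archimedean[OF c] by (auto simp: inverse_eq_divide)
      define j where "j = max j1 (max N1 3)"
      have "1 / real (Suc j) \<le> c"
      proof -
        have "1 / real (Suc j) \<le> 1 / real (Suc j1)" by (intro frac_le) (auto simp: j_def)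
        then show ?thesis using j1 by linarith
      qed
      have "x \<in> G j"
        unfolding G_def
      proof (intro CollectI allI impI)
        fix N assume "j \<le> N"
        then have "mass N x \<le> exp (- c * real N)" by (intro bound) (auto simp: j_def)
        also have "\<dots> \<le> exp (- (1 / real (Suc j)) * real N)"
          unfolding exp_le_cancel_iff using \<open>1 / real (Suc j) \<le> c\<close> by (intro mult_right_mono) auto
        finally show "mass N x \<le> exp (- (1 / real (Suc j)) * real N)" .
      qed
      then show ?case by blast
    qed
  qed
  then have "measure \<mu> (\<Union>j. G j) = 1" by (subst prob_eq_1) auto
  moreover have "(\<lambda>j. measure \<mu> (G j)) \<longlonglongrightarrow> measure \<mu> (\<Union>j. G j)"
    using \<open>incseq G\<close> by (intro finite_Lim_measure_incseq) auto
  ultimately have "\<forall>\<^sub>F j in sequentially. measure \<mu> (G j) > 1 / 2"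
    by (intro order_tendstoD) auto
  then obtain j where "measure \<mu> (G j) > 1 / 2" by (auto simp: eventually_sequentially)
  moreover have "\<forall>N\<ge>j. \<forall>x\<in>G j. mass N x \<le> exp (- (1 / real (Suc j)) * real N)"
    unfolding G_def by blast
  ultimately show ?thesis
    by (intro exI[of _ "1 / real (Suc j)"] conjI bexI[of _ "G j"] exI[of _ j]) auto
qed

text \<open>If the mean \<open>U\<close> of the conditional mass of a digit were \<open>1\<close>, the digits would have zero
  entropy, and \<open>mass N\<close> could not decay exponentially.\<close>

lemma ratio_limit_less_1:
  assumes "intermediate_dimension \<mu>" and U: "(\<lambda>m. expectation (ratio m)) \<longlonglongrightarrow> U"
  shows "U < 1"
proof (rule ccontr)
  assume "\<not> U < 1"
  obtain c G N0 where c: "c > 0" and G [measurable]: "G \<in> sets borel" and G_half: "measure \<mu> G > 1 / 2"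
    and decay: "\<And>N x. N \<ge> N0 \<Longrightarrow> x \<in> G \<Longrightarrow> mass N x \<le> exp (- c * real N)"
    using mass_exponential_decay[OF assms(1)] by meson
  have int_r: "integrable \<mu> (ratio m)" for m by (intro integrable_bounded[of _ 1]) auto
  \<comment> \<open>Makes the contribution of \<open>1 / ratio\<close>, at most
    \<open>a / K\<close>, at most \<open>c / 16\<close>; the choice of \<open>m1\<close> does the
    same for the other term.\<close>
  define K where "K = 16 * of_int a / c"
  have K: "K > 0" using c a_ge_2 by (simp add: K_def)
  define b where "b m x = K * (1 - ratio m x) + 1 / K * (1 / ratio m x)" for m x
  have int_b: "integrable \<mu> (b m)" for m
    unfolding b_def using int_r integral_inverse_ratio(1)
    by (intro Bochner_Integration.integrable_add integrable_mult_right Bochner_Integration.integrable_diff) auto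
  have b_nonneg: "0 \<le> b m x" for m x
    unfolding b_def using K by (intro add_nonneg_nonneg mult_nonneg_nonneg) auto
  have b_int: "expectation (b m) \<le> K * (1 - expectation (ratio m)) + c / 16" for m
  proof -
    have "expectation (b m) = K * (1 - expectation (ratio m)) + 1 / K * (\<integral>x. 1 / ratio m x \<partial>\<mu>)"
    proof -
      have i: "integrable \<mu> (\<lambda>x. K * (1 - ratio m x))" "integrable \<mu> (\<lambda>x. 1 / K * (1 / ratio m x))"
        by (intro integrable_mult_right Bochner_Integration.integrable_diff int_r integral_inverse_ratio(1)
            integrable_const)+
      have "expectation (b m) = (\<integral>x. K * (1 - ratio m x) \<partial>\<mu>) + (\<integral>x. 1 / K * (1 / ratio m x) \<partial>\<mu>)"
        unfolding b_def by (rule Bochner_Integration.integral_add[OF i])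
      also have "(\<integral>x. K * (1 - ratio m x) \<partial>\<mu>) = K * (1 - expectation (ratio m))"
        using int_r by simp
      also have "(\<integral>x. 1 / K * (1 / ratio m x) \<partial>\<mu>) = 1 / K * (\<integral>x. 1 / ratio m x \<partial>\<mu>)"
        by (rule integral_mult_right_zero)
      finally show ?thesis .
    qed
    also have "1 / K * (\<integral>x. 1 / ratio m x \<partial>\<mu>) \<le> 1 / K * of_int a"
      using K integral_inverse_ratio(2) by (intro mult_left_mono) auto
    also have "1 / K * of_int a = c / 16" using a_ge_2 by (simp add: K_def)
    finally show ?thesis by simp
  qed
  have "\<forall>\<^sub>F m in sequentially. expectation (ratio m) > 1 - c / (16 * K)"
  proof (rule order_tendstoD(1)[OF U])
    have "0 < c / (16 * K)" using c K by simp
    then show "1 - c / (16 * K) < U" using \<open>\<not> U < 1\<close> by linarith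
  qed
  then obtain m1 where m1: "\<And>m. m \<ge> m1 \<Longrightarrow> expectation (ratio m) > 1 - c / (16 * K)"
    by (auto simp: eventually_sequentially)
  have b_small: "expectation (b m) \<le> c / 8" if "m \<ge> m1" for m
  proof -
    have "K * (1 - expectation (ratio m)) \<le> K * (c / (16 * K))"
      using m1[OF that] K by (intro mult_left_mono) auto
    then show ?thesis using b_int[of m] K by simp
  qed
  have b_any: "expectation (b m) \<le> K + c / 16" for m
  proof -
    have "0 \<le> expectation (ratio m)" by simp
    then have "K * (1 - expectation (ratio m)) \<le> K * 1" using K by (intro mult_left_mono) auto
    then show ?thesis using b_int[of m] by simp
  qed
  define C where "C = real m1 * (K + c / 16)"
  have sum_le: "(\<Sum>m<N. expectation (b m)) \<le> C + real N * (c / 8)" for N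
  proof -
    have "(\<Sum>m<N. expectation (b m)) \<le> (\<Sum>m<N. (if m < m1 then K + c / 16 else 0) + c / 8)"
    proof (rule sum_mono)
      fix m
      show "expectation (b m) \<le> (if m < m1 then K + c / 16 else 0) + c / 8"
        using b_small[of m] b_any[of m] c by (cases "m < m1") auto
    qed
    also have "\<dots> = real (card ({..<N} \<inter> {..<m1})) * (K + c / 16) + real N * (c / 8)"
      by (simp add: sum.distrib sum.If_cases lessThan_def)
    also have "\<dots> \<le> real m1 * (K + c / 16) + real N * (c / 8)"
      using K c card_mono[of "{..<m1}" "{..<N} \<inter> {..<m1}"]
      by (intro add_right_mono mult_right_mono) auto
    finally show ?thesis by (simp add: C_def)
  qed
  \<comment> \<open>\<open>- ln (mass N x)\<close> is the sum of \<open>- ln\<close> of the ratios,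
    hence at most the sum of the \<open>b m x\<close>; on \<open>G\<close>, of mass above 1/2, it is
    at least \<open>c * N\<close>.\<close>
  have lower: "c * real N / 2 \<le> (\<Sum>m<N. expectation (b m))" if "N \<ge> N0" for N
  proof -
    have "AE x in \<mu>. \<forall>n. 0 < mass n x" using AE_mass_pos by (simp add: AE_all_countable)
    then have "AE x in \<mu>. indicator G x * (c * real N) \<le> (\<Sum>m<N. b m x)"
      using AE_unit
    proof eventually_elim
      case (elim x)
      show ?case
      proof (cases "x \<in> G")
        case True
        have r_pos: "0 < ratio m x" for m using elim by (simp add: ratio_def)
        then have r_nz: "ratio m x \<noteq> 0" for m by (simp add: less_imp_neq[symmetric])
        have m0: "mass 0 x = 1"
        proof -
          have d0: "digits 0 x = 0" using elim(2) by (simp add: digits_def floor_eq_iff)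
          have "AE y in \<mu>. y \<in> {y. digits 0 y = digits 0 x}"
            by (rule AE_mp[OF AE_digits[of 0]], rule AE_I2) (use d0 in auto)
          then have "measure \<mu> {y. digits 0 y = digits 0 x} = 1" by (subst prob_eq_1) auto
          then show ?thesis by (simp add: mass_def)
        qed
        have "c * real N \<le> - ln (mass N x)"
        proof -
          have "ln (mass N x) \<le> ln (exp (- c * real N))"
            using decay[OF that True] elim(1) by (subst ln_le_cancel_iff) auto
          then show ?thesis by simp
        qed
        also have "mass N x = (\<Prod>m<N. ratio m x)" using mass_eq_prod[of 0 N x] m0 by simp
        also have "- ln \<dots> = (\<Sum>m<N. - ln (ratio m x))"
          using r_nz by (subst ln_prod) (auto simp: sum_negf)
        also have "\<dots> \<le> (\<Sum>m<N. b m x)"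
          unfolding b_def using neg_ln_le[OF r_pos ratio_le_1 K] by (intro sum_mono) simp
        finally show ?thesis using True by simp
      qed (simp add: sum_nonneg b_nonneg)
    qed
    then have "(\<integral>x. indicator G x * (c * real N) \<partial>\<mu>) \<le> (\<integral>x. (\<Sum>m<N. b m x) \<partial>\<mu>)"
    proof (rule integral_mono_AE[rotated 2])
      show "integrable \<mu> (\<lambda>x. indicator G x * (c * real N))"
        using c by (intro integrable_bounded[of _ "c * real N"]) (auto simp: indicator_def)
      show "integrable \<mu> (\<lambda>x. \<Sum>m<N. b m x)"
        using int_b by (intro Bochner_Integration.integrable_sum)
    qed
    then have "measure \<mu> G * (c * real N) \<le> (\<Sum>m<N. expectation (b m))"
      using int_b by (simp add: Bochner_Integration.integral_sum)
    moreover have "1 / 2 * (c * real N) \<le> measure \<mu> G * (c * real N)"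
      using G_half c by (intro mult_right_mono) auto
    ultimately show ?thesis by simp
  qed
  \<comment> \<open>So large that \<open>3 * c * N / 8\<close>, the difference of the two linear
    terms, exceeds \<open>C\<close>.\<close>
  obtain N :: nat where N: "real N > 8 * C / (3 * c)" "N \<ge> N0"
  proof -
    obtain N' :: nat where "real N' > 8 * C / (3 * c)" using reals_Archimedean2 by blast
    then show ?thesis by (intro that[of "max N' N0"]) auto
  qed
  have "c * real N / 2 \<le> C + real N * (c / 8)" using lower[OF N(2)] sum_le[of N] by linarith
  moreover have "8 * C < real N * (3 * c)" using N(1) c by (simp add: divide_less_eq)
  ultimately show False by (simp add: algebra_simps)
qed

text \<open>Where the average of \<open>q\<close> ratios is near \<open>U < 1\<close>, their product
  is at most \<open>exp (- (q * c))\<close>, by \<open>t <= exp (t - 1)\<close>; elsewhere the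
  quotient is at most 1, and Markov's inequality applies. The integral is the mean over cells of the
  sum of squared conditional masses of subcells, so its smallness says that no atoms survive in the
  limit.\<close>

lemma conditional_mass_small:
  assumes "intermediate_dimension \<mu>" and \<epsilon>: "\<epsilon> > 0"
  shows "\<exists>q m0. \<forall>M\<ge>m0. (\<integral>x. mass (M + q) x / mass M x \<partial>\<mu>) \<le> \<epsilon>"
proof -
  obtain U where U: "(\<lambda>m. expectation (ratio m)) \<longlonglongrightarrow> U"
    and av: "averages_to ratio U"
    using ratio_limit by blast
  define c where "c = (1 - U) / 2"
  have c: "c > 0" using ratio_limit_less_1[OF assms(1) U] by (simp add: c_def)
  have "c * (\<epsilon> / 2) > 0" using c \<epsilon> by simp
  with av obtain q0 m0 where q0: "\<And>q M. q \<ge> q0 \<Longrightarrow> M \<ge> m0 \<Longrightarrow>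
      (\<integral>x. \<bar>(\<Sum>i<q. ratio (M + i) x) / q - U\<bar> \<partial>\<mu>) \<le> c * (\<epsilon> / 2)"
    unfolding averages_to_def by blast
  obtain q1 :: nat where q1: "real q1 > ln (2 / \<epsilon>) / c" using reals_Archimedean2 by blast
  define q where "q = max 1 (max q0 q1)"
  have q: "q \<ge> q0" "q > 0" "real q \<ge> real q1" by (auto simp: q_def)
  have exp_small: "exp (- (real q * c)) \<le> \<epsilon> / 2"
  proof -
    have "ln (2 / \<epsilon>) < real q * c" 
    proof -
      have "ln (2 / \<epsilon>) / c < real q" using q1 q(3) by linarith
      then show ?thesis using c by (simp add: divide_less_eq)
    qed
    then have "exp (ln (2 / \<epsilon>)) \<le> exp (real q * c)" by simp
    then have "2 / \<epsilon> \<le> exp (real q * c)" using \<epsilon> by simp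
    then show ?thesis using \<epsilon> by (simp add: exp_minus field_simps)
  qed
  have "(\<integral>x. mass (M + q) x / mass M x \<partial>\<mu>) \<le> \<epsilon>" if M: "M \<ge> m0" for M
  proof -
    let ?v = "\<lambda>x. (\<Sum>i<q. ratio (M + i) x) / q"
    have pt: "mass (M + q) x / mass M x \<le> exp (- (real q * c)) + 1 / c * \<bar>?v x - U\<bar>" for x
    proof (cases "\<bar>?v x - U\<bar> \<le> c")
      case True
      have "mass (M + q) x / mass M x \<le> (\<Prod>i<q. ratio (M + i) x)"
        unfolding mass_eq_prod by (cases "mass M x = 0") (auto intro: prod_nonneg)
      also have "\<dots> \<le> (\<Prod>i<q. exp (ratio (M + i) x - 1))"
      proof (intro prod_mono conjI ratio_nonneg)
        fix i
        show "ratio (M + i) x \<le> exp (ratio (M + i) x - 1)"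
          using exp_ge_add_one_self[of "ratio (M + i) x - 1"] by simp
      qed
      also have "\<dots> = exp (real q * (?v x - 1))"
        using q(2) by (simp add: exp_sum[symmetric] sum_subtractf right_diff_distrib)
      also have "\<dots> \<le> exp (- (real q * c))"
      proof -
        have "2 * c = 1 - U" by (simp add: c_def)
        then have "?v x - 1 \<le> - c" using True by linarith
        then have "real q * (?v x - 1) \<le> real q * - c" by (intro mult_left_mono) auto
        then show ?thesis by simp
      qed
      also have "\<dots> \<le> exp (- (real q * c)) + 1 / c * \<bar>?v x - U\<bar>" using c by simp
      finally show ?thesis .
    next
      case False
      have "mass (M + q) x / mass M x \<le> 1" by (rule mass_quotient_le_1)
      also have "1 \<le> 1 / c * \<bar>?v x - U\<bar>" using False c by (simp add: field_simps)
      also have "\<dots> \<le> exp (- (real q * c)) + 1 / c * \<bar>?v x - U\<bar>" by simp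
      finally show ?thesis .
    qed
    have int_r: "integrable \<mu> (ratio m)" for m by (intro integrable_bounded[of _ 1]) auto
    have int_v: "integrable \<mu> (\<lambda>x. \<bar>?v x - U\<bar>)" using int_r by simp
    have "(\<integral>x. mass (M + q) x / mass M x \<partial>\<mu>) \<le> (\<integral>x. exp (- (real q * c)) + 1 / c * \<bar>?v x - U\<bar> \<partial>\<mu>)"
    proof (rule integral_mono[OF _ _ pt])
      show "integrable \<mu> (\<lambda>x. mass (M + q) x / mass M x)"
        using mass_quotient_le_1 by (intro integrable_bounded[of _ 1]) auto
    qed (use int_v in simp)
    also have "\<dots> = exp (- (real q * c)) + 1 / c * (\<integral>x. \<bar>?v x - U\<bar> \<partial>\<mu>)"
      using int_v by (subst Bochner_Integration.integral_add) auto
    also have "\<dots> \<le> \<epsilon> / 2 + 1 / c * (c * (\<epsilon> / 2))"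
      using exp_small q0[OF q(1) M] c by (intro add_mono mult_left_mono) auto
    also have "\<dots> = \<epsilon>" using c by simp
    finally show ?thesis .
  qed
  then show ?thesis by blast
qed

end

section \<open>Wiener's lemma\<close>

lemma norm_one_minus_cis_ge:
  assumes "\<bar>t\<bar> \<le> 1" shows "\<bar>t\<bar> / 2 \<le> norm (1 - cis t)"
proof -
  let ?s = "t / 2"
  have "(\<Sum>m<3. sin_coeff m * ?s ^ m) = ?s"
    by (simp add: eval_nat_numeral sin_coeff_def)
  then have "\<bar>sin ?s - ?s\<bar> \<le> inverse (fact 3) * \<bar>?s\<bar> ^ 3"
    using Maclaurin_sin_bound[of ?s 3] by simp
  also have "\<dots> \<le> 1 / 6 * \<bar>?s\<bar>"
  proof -
    have "\<bar>?s\<bar> * (\<bar>?s\<bar> * \<bar>?s\<bar>) \<le> \<bar>?s\<bar> * (1 * 1)"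
      using assms by (intro mult_left_mono mult_mono) auto
    then show ?thesis by (simp add: eval_nat_numeral fact_numeral)
  qed
  finally have "2 * \<bar>sin ?s\<bar> \<ge> \<bar>t\<bar> / 2" by linarith
  moreover have "norm (1 - cis t) = 2 * \<bar>sin ?s\<bar>"
    using dist_exp_i_1[of t] by (simp add: cis_conv_exp norm_minus_commute)
  ultimately show ?thesis by simp
qed

lemma cis_sum_norm_le:
  assumes "0 < \<bar>t\<bar>" "\<bar>t\<bar> \<le> 1"
  shows "norm (\<Sum>r = 1..R. cis (real r * t)) \<le> 4 / \<bar>t\<bar>"
proof (cases "R \<ge> 1")
  case True
  let ?z = "cis t"
  have "(1 - ?z) * (\<Sum>r = 1..R. cis (real r * t)) = ?z ^ 1 - ?z ^ Suc R"
    using sum_gp_multiplied[OF True, of ?z] by (simp only: Complex.DeMoivre)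
  then have "norm (1 - ?z) * norm (\<Sum>r = 1..R. cis (real r * t)) = norm (?z ^ 1 - ?z ^ Suc R)"
    by (metis norm_mult)
  also have "\<dots> \<le> 2"
    using norm_triangle_ineq4[of "?z ^ 1" "?z ^ Suc R"] by (simp only: norm_power norm_cis power_one)
  finally have "norm (1 - ?z) * norm (\<Sum>r = 1..R. cis (real r * t)) \<le> 2" .
  moreover have "\<bar>t\<bar> / 2 * norm (\<Sum>r = 1..R. cis (real r * t)) \<le> norm (1 - ?z) * norm (\<Sum>r = 1..R. cis (real r * t))"
    using norm_one_minus_cis_ge[OF assms(2)] by (intro mult_right_mono) auto
  ultimately have "\<bar>t\<bar> / 2 * norm (\<Sum>r = 1..R. cis (real r * t)) \<le> 2" by linarith
  then show ?thesis using assms(1) by (simp add: field_simps)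
qed (use assms in simp)

context times_ergodic
begin

text \<open>Points of subcells that are neither equal nor adjacent are at least
  \<open>1 / a ^ q\<close> apart after rescaling, which bounds the kernel below; adjacent ones may
  be arbitrarily close and are counted with the diagonal.\<close>

definition near :: "nat \<Rightarrow> nat \<Rightarrow> real \<Rightarrow> real"
  where "near m q x = measure \<mu> {y. digits m y = digits m x \<and> \<bar>digits (m + q) y - digits (m + q) x\<bar> \<le> 1}"

text \<open>A neighbour of a subcell lying in the same cell is handled by \<open>2 w w' \<le> w\<^sup>2 + w'\<^sup>2\<close>.\<close>

lemma near_mass_integral_le:
  "integrable \<mu> (\<lambda>x. near m q x / mass m x)"
  "(\<integral>x. near m q x / mass m x \<partial>\<mu>) \<le> 3 * (\<integral>x. mass (m + q) x / mass m x \<partial>\<mu>)"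
proof -
  define F where "F = {0..<a ^ (m + q)}"
  define W where "W d = measure \<mu> {y. digits (m + q) y = d}" for d
  define V where "V e = measure \<mu> {y. digits m y = e}" for e
  define c where "c d = d div a ^ q" for d
  have c: "digits m x = c (digits (m + q) x)" for x
    unfolding c_def using digits_div[of m x q] by (simp add: add.commute)
  have fin: "finite F" "AE x in \<mu>. digits (m + q) x \<in> F"
    using AE_digits[of "m + q"] by (auto simp: F_def)
  have D: "digits (m + q) \<in> \<mu> \<rightarrow>\<^sub>M count_space UNIV" by simp
  have W_out: "W d = 0" if "d \<notin> F" for d
  proof -
    have "AE x in \<mu>. x \<notin> {y. digits (m + q) y = d}"
      using fin(2) by (rule AE_mp) (use that in auto)
    then show ?thesis
      unfolding W_def by (subst prob_eq_0) auto
  qed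
  have W_nonneg: "0 \<le> W d" and V_nonneg: "0 \<le> V d" for d by (simp_all add: W_def V_def)
  define N where "N d = measure \<mu> {y. digits m y = c d \<and> \<bar>digits (m + q) y - d\<bar> \<le> 1}" for d
  have near: "near m q x / mass m x = N (digits (m + q) x) / V (c (digits (m + q) x))" for x
    by (simp add: near_def mass_def N_def V_def c)
  have massq: "mass (m + q) x / mass m x = W (digits (m + q) x) / V (c (digits (m + q) x))" for x
    by (simp add: mass_def W_def V_def c)
  show "integrable \<mu> (\<lambda>x. near m q x / mass m x)"
    unfolding near by (rule partition_integrable_fun[OF D fin, of "\<lambda>d. N d / V (c d)"])
  \<comment> \<open>\<open>H d\<close> is the contribution of the subcell \<open>d\<close> to the
    integral of the mass quotient. It vanishes outside \<open>F\<close>, so shifting the index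
    cannot increase the sum.\<close>
  define H where "H d = (W d)\<^sup>2 / V (c d)" for d
  have H_nonneg: "0 \<le> H d" for d using V_nonneg by (simp add: H_def)
  have N_le: "N d \<le> (\<Sum>j\<in>{- 1, 0, 1}. if c (d + j) = c d then W (d + j) else 0)" for d
  proof -
    have "N d \<le> measure \<mu> (\<Union>j\<in>{- 1, 0, 1 :: int}. {y. digits m y = c d \<and> digits (m + q) y = d + j})"
      unfolding N_def
    proof (rule finite_measure_mono)
      show "{y. digits m y = c d \<and> \<bar>digits (m + q) y - d\<bar> \<le> 1}
        \<subseteq> (\<Union>j\<in>{- 1, 0, 1}. {y. digits m y = c d \<and> digits (m + q) y = d + j})"
      proof
        fix y assume y: "y \<in> {y. digits m y = c d \<and> \<bar>digits (m + q) y - d\<bar> \<le> 1}"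
        then have "digits (m + q) y - d \<in> {- 1, 0, 1}" by auto
        with y show "y \<in> (\<Union>j\<in>{- 1, 0, 1}. {y. digits m y = c d \<and> digits (m + q) y = d + j})"
          by (intro UN_I[of "digits (m + q) y - d"]) auto
      qed
      show "(\<Union>j\<in>{- 1, 0, 1}. {y. digits m y = c d \<and> digits (m + q) y = d + j}) \<in> sets \<mu>"
        by (intro sets.finite_UN) auto
    qed
    also have "\<dots> \<le> (\<Sum>j\<in>{- 1, 0, 1}. measure \<mu> {y. digits m y = c d \<and> digits (m + q) y = d + j})"
      by (intro finite_measure_subadditive_finite) auto
    also have "\<dots> \<le> (\<Sum>j\<in>{- 1, 0, 1}. if c (d + j) = c d then W (d + j) else 0)"
    proof (rule sum_mono)
      fix j
      show "measure \<mu> {y. digits m y = c d \<and> digits (m + q) y = d + j} \<le> (if c (d + j) = c d then W (d + j) else 0)"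
      proof (cases "c (d + j) = c d")
        case True
        then show ?thesis unfolding W_def by (auto intro!: finite_measure_mono)
      next
        case False
        then have empty: "{y. digits m y = c d \<and> digits (m + q) y = d + j} = {}" by (auto simp: c)
        show ?thesis unfolding empty using False by simp
      qed
    qed
    finally show ?thesis .
  qed
  have shift: "(\<Sum>d\<in>F. H (d + j)) \<le> (\<Sum>d\<in>F. H d)" for j
  proof -
    have "(\<Sum>d\<in>F. H (d + j)) = (\<Sum>e\<in>(\<lambda>d. d + j) ` F. H e)"
      by (subst sum.reindex) (auto simp: inj_on_def)
    also have "\<dots> = (\<Sum>e\<in>(\<lambda>d. d + j) ` F \<inter> F. H e)"
      using fin(1) W_out by (intro sum.mono_neutral_right) (auto simp: H_def)
    also have "\<dots> \<le> (\<Sum>d\<in>F. H d)"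
      using fin(1) H_nonneg by (intro sum_mono2) auto
    finally show ?thesis .
  qed
  have "(\<integral>x. near m q x / mass m x \<partial>\<mu>) = (\<Sum>d\<in>F. N d / V (c d) * W d)"
    unfolding near using partition_integral_fun[OF D fin, of "\<lambda>d. N d / V (c d)"] by (simp add: W_def)
  also have "\<dots> \<le> (\<Sum>d\<in>F. \<Sum>j\<in>{- 1, 0, 1}. (H d + H (d + j)) / 2)"
  proof (rule sum_mono)
    fix d
    have "N d / V (c d) * W d \<le> (\<Sum>j\<in>{- 1, 0, 1}. if c (d + j) = c d then W (d + j) else 0) / V (c d) * W d"
      using N_le W_nonneg V_nonneg by (intro mult_right_mono divide_right_mono) auto
    also have "\<dots> = (\<Sum>j\<in>{- 1, 0, 1}. (if c (d + j) = c d then W (d + j) else 0) / V (c d) * W d)"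
      by (simp only: sum_divide_distrib sum_distrib_right)
    also have "\<dots> \<le> (\<Sum>j\<in>{- 1, 0, 1}. (H d + H (d + j)) / 2)"
    proof (rule sum_mono)
      fix j
      show "(if c (d + j) = c d then W (d + j) else 0) / V (c d) * W d \<le> (H d + H (d + j)) / 2"
      proof (cases "c (d + j) = c d")
        case True
        have "W (d + j) * W d \<le> ((W d)\<^sup>2 + (W (d + j))\<^sup>2) / 2"
          using sum_squares_bound[of "W (d + j)" "W d"] by simp
        then have "W (d + j) * W d / V (c d) \<le> ((W d)\<^sup>2 + (W (d + j))\<^sup>2) / 2 / V (c d)"
          using V_nonneg by (rule divide_right_mono)
        then show ?thesis using True by (simp add: H_def add_divide_distrib)
      next
        case False
        then show ?thesis using H_nonneg by simp
      qed
    qed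
    finally show "N d / V (c d) * W d \<le> (\<Sum>j\<in>{- 1, 0, 1}. (H d + H (d + j)) / 2)" .
  qed
  also have "\<dots> = (\<Sum>j\<in>{- 1, 0, 1}. ((\<Sum>d\<in>F. H d) + (\<Sum>d\<in>F. H (d + j))) / 2)"
    by (subst sum.swap) (simp only: sum.distrib flip: sum_divide_distrib)
  also have "\<dots> \<le> (\<Sum>j\<in>{- 1, 0, 1 :: int}. (\<Sum>d\<in>F. H d))"
    using shift by (intro sum_mono) simp
  also have "\<dots> = 3 * (\<Sum>d\<in>F. W d / V (c d) * W d)"
    by (simp add: H_def power2_eq_square)
  also have "(\<Sum>d\<in>F. W d / V (c d) * W d) = (\<integral>x. mass (m + q) x / mass m x \<partial>\<mu>)"
    unfolding massq using partition_integral_fun[OF D fin, of "\<lambda>d. W d / V (c d)"] by (simp add: W_def)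
  finally show "(\<integral>x. near m q x / mass m x \<partial>\<mu>) \<le> 3 * (\<integral>x. mass (m + q) x / mass m x \<partial>\<mu>)" .
qed

abbreviation freq :: "real \<Rightarrow> real \<Rightarrow> complex"
  where "freq \<xi> \<equiv> (\<lambda>y. cis (\<xi> * y))"

lemma freq_measurable [measurable]: "freq \<xi> \<in> borel_measurable borel"
  by (intro borel_measurable_continuous_onI continuous_intros)

text \<open>The sum is a mean over the cell of a geometric kernel \<open>K\<close>, of size up to
  \<open>R\<close> near \<open>x\<close> and at most \<open>4 * a ^ q\<close> elsewhere. The
  frequencies are \<open>r\<close> and not \<open>2 * pi * r\<close>: rescaled points differ by less
  than 1, so the kernel is large only near difference 0, and the two ends of the unit interval are
  not identified.\<close>

lemma freq_average_le:
  assumes R: "R > (0 :: nat)"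
  shows "norm (\<Sum>r = 1..R. cnj (cond (freq (real r)) m x) * freq (real r) (Tn m x)) / R
    \<le> near m q x / mass m x + 4 * of_int a ^ q / R"
proof (cases "mass m x = 0")
  case True
  then have "cond (freq (real r)) m x = 0" for r by (simp add: cond_def cexp_def cell_mean_def mass_def)
  then show ?thesis using True by simp
next
  case False
  then have w: "mass m x > 0" by (simp add: less_le)
  define c where "c y = (of_bool (digits m y = digits m x) :: complex)" for y
  have [measurable]: "c \<in> borel_measurable borel" unfolding c_def by (rule digits_fun_measurable)
  define K where "K y = (\<Sum>r = 1..R. cis (real r * (Tn m x - Tn m y)))" for y
  have K_R: "norm (K y) \<le> R" for y
    unfolding K_def by (rule order_trans[OF norm_sum]) simp
  define S where "S = {y. digits m y = digits m x \<and> \<bar>digits (m + q) y - digits (m + q) x\<bar> \<le> 1}"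
  have [measurable]: "S \<in> sets borel"
  proof -
    have "S = {y. digits m y = digits m x} \<inter> (digits (m + q) -` {z. \<bar>z - digits (m + q) x\<bar> \<le> 1} \<inter> space borel)"
      by (auto simp: S_def)
    also have "\<dots> \<in> sets borel"
      by (intro sets.Int digits_set_measurable measurable_sets[OF digits_measurable]) simp
    finally show ?thesis .
  qed
  have K_le: "norm (c y * K y) \<le> real R * indicator S y + 4 * of_int a ^ q * of_bool (digits m y = digits m x)" for y
  proof (cases "digits m y = digits m x \<and> y \<notin> S")
    case True
    let ?t = "Tn m x - Tn m y"
    have "digits q (Tn m y) - digits q (Tn m x) = digits (m + q) y - digits (m + q) x"
      using True by (simp add: digits_Tn add.commute)
    then have "\<bar>digits q (Tn m y) - digits q (Tn m x)\<bar> \<ge> 2" using True by (auto simp: S_def)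
    then have "1 \<le> \<bar>of_int a ^ q * Tn m y - of_int a ^ q * Tn m x\<bar>"
      unfolding digits_def by linarith
    then have "1 \<le> of_int a ^ q * \<bar>?t\<bar>"
      by (simp add: abs_mult abs_minus_commute flip: right_diff_distrib)
    then have t: "1 / of_int a ^ q \<le> \<bar>?t\<bar>" by (simp add: divide_le_eq mult.commute)
    moreover have "0 < 1 / (of_int a :: real) ^ q" by simp
    ultimately have t0: "0 < \<bar>?t\<bar>" by linarith
    have "norm (K y) \<le> 4 / \<bar>?t\<bar>"
      unfolding K_def using t0 Tn_range[of m x] Tn_range[of m y] by (intro cis_sum_norm_le) auto
    also have "\<dots> \<le> 4 * of_int a ^ q"
      using t t0 by (simp add: field_simps)
    finally show ?thesis using True by (simp add: norm_mult c_def)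
  next
    case False
    then show ?thesis
      using K_R[of y] by (auto simp: norm_mult c_def indicator_def S_def intro: add_increasing2)
  qed
  have sum_eq: "(\<Sum>r = 1..R. cnj (cond (freq (real r)) m x) * freq (real r) (Tn m x)) = (\<integral>y. c y * K y \<partial>\<mu>) / of_real (mass m x)"
  proof -
    have int: "integrable \<mu> (\<lambda>y. c y * cis (real r * (Tn m x - Tn m y)))" for r
      by (intro integrable_bounded[of _ 1]) (measurable, simp add: norm_mult c_def)
    have "cnj (cond (freq (real r)) m x) * freq (real r) (Tn m x) = (\<integral>y. c y * cis (real r * (Tn m x - Tn m y)) \<partial>\<mu>) / of_real (mass m x)" for r
    proof -
      have "cnj (\<integral>y. c y * freq (real r) (Tn m y) \<partial>\<mu>) * freq (real r) (Tn m x)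
          = (\<integral>y. cnj (c y * freq (real r) (Tn m y)) * freq (real r) (Tn m x) \<partial>\<mu>)"
        by (simp only: integral_mult_left_zero Bochner_Integration.integral_cnj)
      also have "\<dots> = (\<integral>y. c y * cis (real r * (Tn m x - Tn m y)) \<partial>\<mu>)"
      proof (intro Bochner_Integration.integral_cong refl)
        fix y
        have "cis (- (real r * Tn m y)) * cis (real r * Tn m x) = cis (real r * (Tn m x - Tn m y))"
          by (simp add: cis_mult algebra_simps)
        then show "cnj (c y * freq (real r) (Tn m y)) * freq (real r) (Tn m x) = c y * cis (real r * (Tn m x - Tn m y))"
          by (simp add: c_def cis_cnj mult.assoc)
      qed
      finally show ?thesis by (simp add: cond_def cexp_def cell_mean_def mass_def c_def)
    qed
    then have "(\<Sum>r = 1..R. cnj (cond (freq (real r)) m x) * freq (real r) (Tn m x))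
        = (\<Sum>r = 1..R. \<integral>y. c y * cis (real r * (Tn m x - Tn m y)) \<partial>\<mu>) / of_real (mass m x)"
      by (simp add: sum_divide_distrib)
    also have "(\<Sum>r = 1..R. \<integral>y. c y * cis (real r * (Tn m x - Tn m y)) \<partial>\<mu>) = (\<integral>y. c y * K y \<partial>\<mu>)"
      unfolding K_def sum_distrib_left using int by (intro Bochner_Integration.integral_sum[symmetric])
    finally show ?thesis .
  qed
  have int_ind: "integrable \<mu> (\<lambda>y. indicator S y :: real)"
    by (intro integrable_bounded[of _ 1]) (auto simp: indicator_def)
  have int_b: "integrable \<mu> (\<lambda>y. of_bool (digits m y = digits m x) :: real)"
    by (intro integrable_bounded[of _ 1] digits_fun_measurable) auto
  have "norm (\<integral>y. c y * K y \<partial>\<mu>) \<le> (\<integral>y. real R * indicator S y + 4 * of_int a ^ q * of_bool (digits m y = digits m x) \<partial>\<mu>)"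
  proof (rule order_trans[OF integral_norm_bound], rule integral_mono')
    show "integrable \<mu> (\<lambda>y. real R * indicator S y + 4 * of_int a ^ q * of_bool (digits m y = digits m x))"
      using int_ind int_b by (intro Bochner_Integration.integrable_add integrable_mult_right)
  qed (use K_le in auto)
  also have "\<dots> = real R * near m q x + 4 * of_int a ^ q * mass m x"
    using int_ind int_b partition_cell_prob[OF digits_fin, of m "digits m x", where ?'b = real]
    by (subst Bochner_Integration.integral_add) (auto simp: near_def S_def mass_def)
  finally have "norm (\<integral>y. c y * K y \<partial>\<mu>) \<le> real R * near m q x + 4 * of_int a ^ q * mass m x" .
  then have "norm (\<integral>y. c y * K y \<partial>\<mu>) / mass m x / R \<le> (real R * near m q x + 4 * of_int a ^ q * mass m x) / mass m x / R"
    using w by (intro divide_right_mono) auto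
  also have "\<dots> = near m q x / mass m x + 4 * of_int a ^ q / R"
    using w R by (simp add: field_simps)
  finally show ?thesis
    unfolding sum_eq using w by (simp add: norm_divide)
qed

text \<open>By \<open>cexp_norm_sq\<close> one factor of the energy is the unconditioned function at
  \<open>x\<close>, so one kernel appears and not a double integral over the cell.\<close>

lemma energy_average_le:
  assumes R: "R > (0 :: nat)"
  shows "(\<Sum>r = 1..R. energy (freq (real r)) m) / R \<le> 3 * (\<integral>x. mass (m + q) x / mass m x \<partial>\<mu>) + 4 * of_int a ^ q / R"
proof -
  let ?h = "\<lambda>r x. cnj (cond (freq (real r)) m x) * freq (real r) (Tn m x)"
  have int: "integrable \<mu> (?h r)" for r
  proof (rule integrable_bounded[of _ 1])
    show "norm (?h r x) \<le> 1" for x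
      using cond_norm_le[of "freq (real r)" m x] by (simp add: norm_mult)
  qed measurable
  have e: "complex_of_real (energy (freq (real r)) m) = (\<integral>x. ?h r x \<partial>\<mu>)" for r
    unfolding energy_def cond_def
    by (rule cexp_norm_sq[OF digits_fin]) (intro integrable_bounded[of _ 1], auto)
  have eq: "complex_of_real (\<Sum>r = 1..R. energy (freq (real r)) m) = (\<integral>x. (\<Sum>r = 1..R. ?h r x) \<partial>\<mu>)"
    unfolding of_real_sum e using int by (intro Bochner_Integration.integral_sum[symmetric])
  have "norm (complex_of_real (\<Sum>r = 1..R. energy (freq (real r)) m)) \<le> (\<integral>x. norm (\<Sum>r = 1..R. ?h r x) \<partial>\<mu>)"
    unfolding eq by (rule integral_norm_bound)
  then have "(\<Sum>r = 1..R. energy (freq (real r)) m) \<le> (\<integral>x. norm (\<Sum>r = 1..R. ?h r x) \<partial>\<mu>)"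
    unfolding norm_of_real by linarith
  then have "(\<Sum>r = 1..R. energy (freq (real r)) m) / R \<le> (\<integral>x. norm (\<Sum>r = 1..R. ?h r x) \<partial>\<mu>) / R"
    by (rule divide_right_mono) simp
  also have "\<dots> = (\<integral>x. norm (\<Sum>r = 1..R. ?h r x) / R \<partial>\<mu>)" by simp
  also have "\<dots> \<le> (\<integral>x. near m q x / mass m x + 4 * of_int a ^ q / R \<partial>\<mu>)"
    using int near_mass_integral_le(1) freq_average_le[OF R]
    by (intro integral_mono integrable_divide integrable_norm Bochner_Integration.integrable_sum
        Bochner_Integration.integrable_add integrable_const)
  also have "\<dots> = (\<integral>x. near m q x / mass m x \<partial>\<mu>) + 4 * of_int a ^ q / R"
    using near_mass_integral_le(1)[of m q] by (subst Bochner_Integration.integral_add) auto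
  also have "\<dots> \<le> 3 * (\<integral>x. mass (m + q) x / mass m x \<partial>\<mu>) + 4 * of_int a ^ q / R"
    using near_mass_integral_le(2) by simp
  finally show ?thesis .
qed

text \<open>Wiener's lemma: since the conditional measures have no atoms, the mean square of their Fourier
  transforms over all frequencies is zero.\<close>

lemma fourier_coeff_eq_0:
  assumes dim: "intermediate_dimension \<mu>" and bound: "\<And>r::nat. r \<ge> 1 \<Longrightarrow> (norm (fourier_coeff k))\<^sup>2 \<le> freq_energy (real r)"
  shows "fourier_coeff k = 0"
proof -
  have "(norm (fourier_coeff k))\<^sup>2 \<le> 0"
  proof (rule field_le_epsilon)
    fix \<epsilon> :: real assume "\<epsilon> > 0"
    then have \<epsilon>: "\<epsilon> / 6 > 0" by simp
    obtain q m0 where q: "\<And>M. M \<ge> m0 \<Longrightarrow> (\<integral>x. mass (M + q) x / mass M x \<partial>\<mu>) \<le> \<epsilon> / 6"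
      using conditional_mass_small[OF dim \<epsilon>] by meson
    have "\<forall>\<^sub>F R in sequentially. 4 * of_int a ^ q / real R < \<epsilon> / 2"
      using \<epsilon> by (intro order_tendstoD(2)[OF lim_const_over_n]) auto
    then have "\<forall>\<^sub>F R in sequentially. 4 * of_int a ^ q / real R < \<epsilon> / 2 \<and> R > 0"
      using eventually_gt_at_top by (rule eventually_conj)
    then obtain R :: nat where R: "4 * of_int a ^ q / real R < \<epsilon> / 2" "R > 0"
      by (auto simp: eventually_sequentially)
    \<comment> \<open>\<open>R\<close> is already fixed, so the finite sum passes to the limit in
      \<open>m\<close>. Three times \<open>\<epsilon> / 6\<close> and the kernel term, below
      \<open>\<epsilon> / 2\<close>, make up \<open>\<epsilon>\<close>.\<close>
    have "(\<lambda>m. (\<Sum>r = 1..R. energy (freq (real r)) m) / R) \<longlonglongrightarrow> (\<Sum>r = 1..R. freq_energy (real r)) / R"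
      using R by (intro tendsto_intros energy_tendsto) auto
    moreover have "(\<Sum>r = 1..R. energy (freq (real r)) m) / R \<le> \<epsilon>" if "m \<ge> m0" for m
      using energy_average_le[OF R(2), of m q] q[OF that] R(1) by linarith
    ultimately have "(\<Sum>r = 1..R. freq_energy (real r)) / R \<le> \<epsilon>"
      by (intro LIMSEQ_le_const2) auto
    moreover have "(\<Sum>r = 1..R. (norm (fourier_coeff k))\<^sup>2) \<le> (\<Sum>r = 1..R. freq_energy (real r))"
      using bound by (intro sum_mono) auto
    then have "(norm (fourier_coeff k))\<^sup>2 \<le> (\<Sum>r = 1..R. freq_energy (real r)) / R"
      using R(2) by (simp add: field_simps)
    ultimately show "(norm (fourier_coeff k))\<^sup>2 \<le> 0 + \<epsilon>" by simp
  qed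
  then show ?thesis by simp
qed

end

section \<open>The semigroup of slopes\<close>

context times_ergodic
begin

section \<open>Measures without nontrivial Fourier coefficients\<close>

lemma integral_freq_diff:
  assumes zero: "\<And>k. k \<ge> 1 \<Longrightarrow> fourier_coeff k = 0"
  shows "(\<integral>y. cnj (cis (2 * pi * real j * (y - x))) * cis (2 * pi * real l * (y - x)) \<partial>\<mu>) = of_bool (j = l)"
proof -
  have aux: "(\<integral>y. cis (2 * pi * real k * (y - x)) \<partial>\<mu>) = 0" if "k \<ge> 1" for k
  proof -
    have "cis (2 * pi * real k * (y - x)) = cis (- (2 * pi * real k * x)) * cis (2 * pi * real k * y)" for y
      by (simp add: cis_mult algebra_simps)
    then show ?thesis using zero[OF that] by (simp add: fourier_coeff_def)
  qed
  consider "j = l" | "j < l" | "l < j" by linarith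
  then show ?thesis
  proof cases
    case 1
    then show ?thesis by (simp add: cis_cnj cis_mult)
  next
    case 2
    have "cnj (cis (2 * pi * real j * (y - x))) * cis (2 * pi * real l * (y - x)) = cis (2 * pi * real (l - j) * (y - x))" for y
      using 2 by (simp add: cis_cnj cis_mult of_nat_diff algebra_simps)
    then show ?thesis using aux[of "l - j"] 2 by simp
  next
    case 3
    have "cnj (cis (2 * pi * real j * (y - x))) * cis (2 * pi * real l * (y - x)) = cnj (cis (2 * pi * real (j - l) * (y - x)))" for y
      using 3 by (simp add: cis_cnj cis_mult of_nat_diff algebra_simps)
    then show ?thesis using aux[of "j - l"] 3 by (simp only: Bochner_Integration.integral_cnj) simp
  qed
qed

text \<open>The squared Dirichlet kernel of order \<open>N\<close> has mass \<open>N\<close> and is at least \<open>N\<^sup>2 / 4\<close> near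
  its centre.\<close>

lemma ball_measure_le:
  assumes zero: "\<And>k. k \<ge> 1 \<Longrightarrow> fourier_coeff k = 0" and N: "N > 0"
  shows "measure \<mu> (ball x (1 / (6 * real N))) \<le> 4 / real N"
proof -
  define E where "E y = (\<Sum>j<N. cis (2 * pi * real j * (y - x)))" for y
  let ?B = "ball x (1 / (6 * real N))"
  have [measurable]: "E \<in> borel_measurable borel" unfolding E_def by measurable
  have E_norm: "norm (E y) \<le> N" for y
    unfolding E_def by (rule order_trans[OF norm_sum]) simp
  have int: "integrable \<mu> (\<lambda>y. cnj (cis (2 * pi * real j * (y - x))) * cis (2 * pi * real l * (y - x)))" for j l
    by (intro integrable_bounded[of _ 1]) (measurable, simp add: norm_mult)
  have "complex_of_real (\<integral>y. (norm (E y))\<^sup>2 \<partial>\<mu>)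
      = (\<integral>y. (\<Sum>j<N. \<Sum>l<N. cnj (cis (2 * pi * real j * (y - x))) * cis (2 * pi * real l * (y - x))) \<partial>\<mu>)"
    unfolding integral_norm_sq E_def by (simp only: cnj_sum sum_product)
  also have "\<dots> = (\<Sum>j<N. \<Sum>l<N. \<integral>y. cnj (cis (2 * pi * real j * (y - x))) * cis (2 * pi * real l * (y - x)) \<partial>\<mu>)"
    using int by (simp only: Bochner_Integration.integral_sum Bochner_Integration.integrable_sum)
  also have "\<dots> = (\<Sum>j<N. \<Sum>l<N. of_bool (j = l))"
    by (simp only: integral_freq_diff[OF zero])
  also have "\<dots> = of_nat N"
    by (simp add: of_bool_def)
  finally have total: "(\<integral>y. (norm (E y))\<^sup>2 \<partial>\<mu>) = N"
    by (metis of_real_eq_iff of_real_of_nat_eq)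
  have lower: "(real N)\<^sup>2 / 4 * indicator ?B y \<le> (norm (E y))\<^sup>2" for y
  proof (cases "y \<in> ?B")
    case True
    then have xy: "\<bar>y - x\<bar> < 1 / (6 * real N)" by (simp add: dist_real_def abs_minus_commute)
    \<comment> \<open>The radius keeps all phases within \<open>pi / 3\<close>, where the cosine is
      at least 1/2.\<close>
    have "1 / 2 \<le> cos (2 * pi * real j * (y - x))" if j: "j < N" for j
    proof -
      have "\<bar>2 * pi * real j * (y - x)\<bar> = 2 * pi * (real j * \<bar>y - x\<bar>)" by (simp add: abs_mult)
      also have "\<dots> \<le> 2 * pi * (real N * (1 / (6 * real N)))"
        using xy j by (intro mult_left_mono mult_mono) auto
      also have "\<dots> = pi / 3" using N by simp
      finally have "cos (pi / 3) \<le> cos \<bar>2 * pi * real j * (y - x)\<bar>"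
        by (intro cos_monotone_0_pi_le) auto
      then show ?thesis by (simp add: cos_60 abs_real_def split: if_splits)
    qed
    then have "(\<Sum>j<N. 1 / 2) \<le> (\<Sum>j<N. cos (2 * pi * real j * (y - x)))"
      by (intro sum_mono) auto
    then have "real N / 2 \<le> Re (E y)" by (simp add: E_def)
    then have "real N / 2 \<le> norm (E y)" using complex_Re_le_cmod order_trans by blast
    then have "(real N / 2)\<^sup>2 \<le> (norm (E y))\<^sup>2" by (intro power_mono) auto
    then show ?thesis using True by (simp add: power_divide)
  qed simp
  have "(\<integral>y. (real N)\<^sup>2 / 4 * indicator ?B y \<partial>\<mu>) \<le> (\<integral>y. (norm (E y))\<^sup>2 \<partial>\<mu>)"
  proof (rule integral_mono[OF _ _ lower])
    show "integrable \<mu> (\<lambda>y. (real N)\<^sup>2 / 4 * indicator ?B y)"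
      by (intro integrable_bounded[of _ "(real N)\<^sup>2 / 4"]) (auto simp: indicator_def)
    show "integrable \<mu> (\<lambda>y. (norm (E y))\<^sup>2)"
      using E_norm by (intro integrable_bounded[of _ "(real N)\<^sup>2"]) (auto intro!: power_mono)
  qed
  then have "(real N)\<^sup>2 / 4 * measure \<mu> ?B \<le> real N" unfolding total by simp
  then show ?thesis using N by (simp add: field_simps power2_eq_square)
qed

text \<open>Otherwise balls have mass at most \<open>24 * r\<close> for radii \<open>r\<close>
  tending to 0, at every centre, which excludes local dimensions below 1.\<close>

lemma nonzero_fourier_coeff:
  assumes dim: "intermediate_dimension \<mu>"
  shows "\<exists>k\<ge>1. fourier_coeff k \<noteq> 0"
proof (rule ccontr)
  assume "\<not> ?thesis"
  then have zero: "\<And>k. k \<ge> 1 \<Longrightarrow> fourier_coeff k = 0" by blast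
  obtain x d where d: "has_local_dim \<mu> x d" "0 < d" "d < 1"
  proof -
    have "ae_filter \<mu> \<noteq> bot"
      using emeasure_space_1 by (auto simp: ae_filter_eq_bot_iff)
    from eventually_happens'[OF this dim[unfolded intermediate_dimension_def]] show ?thesis
      using that by blast
  qed
  define r where "r N = 1 / (6 * real (Suc N))" for N
  define e where "e = (d + 1) / 2"
  have r0: "r \<longlonglongrightarrow> 0"
  proof -
    have "(\<lambda>N. 1 / 6 * (1 / real (Suc N))) \<longlonglongrightarrow> 1 / 6 * 0"
      by (intro tendsto_intros LIMSEQ_Suc[OF lim_const_over_n])
    then show ?thesis by (simp add: r_def[abs_def])
  qed
  then have r: "filterlim r (at_right 0) sequentially"
    by (intro tendsto_imp_filterlim_at_right) (auto simp: r_def)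
  then have lim: "(\<lambda>N. ln (measure \<mu> (ball x (r N))) / ln (r N)) \<longlonglongrightarrow> d"
    using d(1) unfolding has_local_dim_def by (rule filterlim_compose[rotated])
  \<comment> \<open>Excludes balls of mass 0, for which the quotient is 0 because of
    \<open>ln 0 = 0\<close>.\<close>
  have ev1: "\<forall>\<^sub>F N in sequentially. ln (measure \<mu> (ball x (r N))) / ln (r N) > 0"
    using d by (intro order_tendstoD(1)[OF lim])
  have ev2: "\<forall>\<^sub>F N in sequentially. ln (measure \<mu> (ball x (r N))) / ln (r N) < e"
    using d by (intro order_tendstoD(2)[OF lim]) (simp add: e_def)
  have "filterlim (\<lambda>N. ln (r N)) at_bot sequentially"
    using ln_at_0 r by (rule filterlim_compose)
  then have ev3: "\<forall>\<^sub>F N in sequentially. ln (r N) < - (ln 24 / (1 - e))"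
    by (simp add: filterlim_at_bot_dense)
  have "\<forall>\<^sub>F N in sequentially. False"
    using ev1 ev2 ev3
  proof eventually_elim
    case (elim N)
    let ?m = "measure \<mu> (ball x (r N))"
    have e: "1 - e > 0" using d by (simp add: e_def)
    have "0 < ln 24 / (1 - e)" using e by simp
    then have neg: "ln (r N) < 0" using elim(3) by linarith
    have "?m \<noteq> 0" using elim(1) by auto
    then have pos: "?m > 0" by (simp add: less_le)
    have "?m \<le> 4 / real (Suc N)"
      using ball_measure_le[OF zero, of "Suc N" x] by (simp add: r_def)
    also have "\<dots> = 24 * r N" by (simp add: r_def del: of_nat_Suc)
    finally have "ln ?m \<le> ln (24 * r N)" using pos by (subst ln_le_cancel_iff) auto
    also have "\<dots> = ln 24 + ln (r N)" by (subst ln_mult) (auto simp: r_def)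
    finally have "ln ?m \<le> ln 24 + ln (r N)" .
    moreover have "e * ln (r N) < ln ?m" using elim(2) neg by (simp add: neg_divide_less_eq)
    ultimately have "- ln 24 < (1 - e) * ln (r N)" by (simp add: algebra_simps)
    moreover have "(1 - e) * ln (r N) < (1 - e) * - (ln 24 / (1 - e))"
      using elim(3) e by (intro mult_strict_left_mono)
    ultimately show False using e by simp
  qed
  then show False by simp
qed

end

text \<open>Let \<open>p\<close> be the infimum of the positive elements. If \<open>p = 0\<close>,
  multiples of small elements, shifted by multiples of \<open>L\<close>, are dense. Otherwise
  \<open>L = n * p\<close>, and \<open>- p = (n - 1) * p - L\<close> supplies the missing inverse,
  so that remainders modulo \<open>p\<close> stay in \<open>S\<close> and must vanish.\<close>

lemma closed_semigroup_real:
  fixes S :: "real set" and L :: real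
  assumes L: "L > 0" and zero: "0 \<in> S" and add: "\<And>s t. s \<in> S \<Longrightarrow> t \<in> S \<Longrightarrow> s + t \<in> S"
    and shift: "\<And>s i. s \<in> S \<Longrightarrow> s + of_int i * L \<in> S"
    and closed: "\<And>s. (\<And>\<epsilon>. \<epsilon> > 0 \<Longrightarrow> \<exists>t\<in>S. \<bar>t - s\<bar> < \<epsilon>) \<Longrightarrow> s \<in> S"
    and proper: "S \<noteq> UNIV"
  shows "\<exists>n::nat. n \<ge> 1 \<and> (\<forall>s\<in>S. \<exists>k::int. s = of_int k / of_nat n * L)"
proof -
  have mult: "of_nat m * s \<in> S" if "s \<in> S" for s and m :: nat
  proof (induction m)
    case (Suc m)
    then show ?case using add[OF that Suc] by (simp add: algebra_simps)
  qed (simp add: zero)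
  define P where "P = {s \<in> S. 0 < s}"
  have LP: "L \<in> P" using shift[OF zero, of 1] L by (simp add: P_def)
  define p where "p = Inf P"
  have bdd: "bdd_below P" by (rule bdd_belowI[of _ 0]) (auto simp: P_def)
  have p_le: "p \<le> s" if "s \<in> P" for s unfolding p_def using that bdd by (rule cInf_lower)
  have p_nonneg: "0 \<le> p" unfolding p_def using LP by (intro cInf_greatest) (auto simp: P_def)
  have p_approx: "\<exists>s\<in>P. s < p + \<epsilon>" if "\<epsilon> > 0" for \<epsilon>
    using cInf_lessD[of P "p + \<epsilon>"] LP that by (auto simp: p_def)
  have "p \<noteq> 0"
  proof
    assume p0: "p = 0"
    have "t \<in> S" for t
    proof (rule closed)
      fix \<epsilon> :: real assume "\<epsilon> > 0"
      then obtain s where s: "s \<in> S" "0 < s" "s < \<epsilon>" using p_approx[of \<epsilon>] p0 by (auto simp: P_def)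
      define j where "j = \<lfloor>t / L\<rfloor>"
      have "of_int j \<le> t / L" by (simp add: j_def)
      then have j: "of_int j * L \<le> t" using L by (simp add: le_divide_eq)
      define u where "u = t - of_int j * L"
      have u: "0 \<le> u" using j by (simp add: u_def)
      define m where "m = nat \<lfloor>u / s\<rfloor>"
      have m: "real m \<le> u / s" "u / s < real m + 1" using u s(2) by (auto simp: m_def)
      have "real m * s + of_int j * L \<in> S" using shift[OF mult[OF s(1)]] .
      moreover have "real m * s \<le> u" "u < real m * s + s"
        using m s(2) by (auto simp: le_divide_eq divide_less_eq algebra_simps)
      then have "\<bar>real m * s + of_int j * L - t\<bar> < \<epsilon>" using s(3) by (simp add: u_def)
      ultimately show "\<exists>v\<in>S. \<bar>v - t\<bar> < \<epsilon>" by blast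
    qed
    then show False using proper by blast
  qed
  then have p: "p > 0" using p_nonneg by simp
  have pS: "p \<in> S"
  proof (rule closed)
    fix \<epsilon> :: real assume "\<epsilon> > 0"
    then obtain s where "s \<in> P" "s < p + \<epsilon>" using p_approx by blast
    then show "\<exists>t\<in>S. \<bar>t - p\<bar> < \<epsilon>" using p_le[of s] by (intro bexI[of _ s]) (auto simp: P_def)
  qed
  define n where "n = nat \<lfloor>L / p\<rfloor>"
  have n: "real n \<le> L / p" "L / p < real n + 1" using L p by (auto simp: n_def)
  \<comment> \<open>A positive element, at least \<open>p\<close> by minimality; this forces
    \<open>L = n * p\<close>.\<close>
  have "real (Suc n) * p + of_int (- 1) * L \<in> S" using shift[OF mult[OF pS]] .
  moreover have "0 < real (Suc n) * p - L" using n(2) p by (simp add: divide_less_eq algebra_simps)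
  ultimately have "real (Suc n) * p - L \<in> P" by (simp add: P_def)
  then have "p \<le> real (Suc n) * p - L" by (rule p_le)
  moreover have "real n * p \<le> L" using n(1) p by (simp add: le_divide_eq)
  ultimately have L_eq: "L = real n * p" by (simp add: algebra_simps)
  have n1: "n \<ge> 1" using L_eq L by (cases n) auto
  have "\<exists>k::int. s = of_int k / of_nat n * L" if s: "s \<in> S" for s
  proof -
    define m where "m = \<lfloor>s / p\<rfloor>"
    have m: "of_int m \<le> s / p" "s / p < of_int m + 1" by (auto simp: m_def)
    define v where "v = s - of_int m * p"
    have v: "0 \<le> v" "v < p" using m p by (auto simp: v_def le_divide_eq divide_less_eq algebra_simps)
    have "v \<in> S"
    proof (cases "m \<ge> 0")
      case True
      \<comment> \<open>Subtracting \<open>m * p\<close> amounts to adding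
        \<open>m * (n - 1) * p\<close> and removing \<open>m * L\<close>.\<close>
      have "s + real (nat m * (n - 1)) * p + of_int (- m) * L \<in> S"
        using shift[OF add[OF s mult[OF pS]]] .
      moreover have "s + real (nat m * (n - 1)) * p + of_int (- m) * L = v"
        using True n1 by (simp add: v_def L_eq of_nat_diff algebra_simps)
      ultimately show ?thesis by simp
    next
      case False
      have "s + real (nat (- m)) * p \<in> S" using add[OF s mult[OF pS]] .
      moreover have "s + real (nat (- m)) * p = v" using False by (simp add: v_def)
      ultimately show ?thesis by simp
    qed
    then have "v = 0" using p_le[of v] v by (auto simp: P_def less_le)
    then have "s = of_int m / of_nat n * L" using n1 by (simp add: v_def L_eq)
    then show ?thesis by blast
  qed
  then show ?thesis using n1 by blast
qed

section \<open>Essential ranges and transported measures\<close>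

definition ess_range :: "real measure \<Rightarrow> real set \<Rightarrow> (real \<Rightarrow> real) \<Rightarrow> real set"
  where "ess_range M A g = {v. \<forall>\<epsilon>>0. measure M {y \<in> A. \<bar>g y - v\<bar> < \<epsilon>} > 0}"

text \<open>An exceptional value lies in an interval with rational endpoints whose preimage in
  \<open>A\<close> is null, and there are countably many such intervals.\<close>

lemma AE_ess_range:
  fixes g :: "real \<Rightarrow> real"
  assumes "finite_measure M" and sets: "sets M = sets borel"
    and [measurable]: "g \<in> borel_measurable borel" "A \<in> sets borel"
  shows "AE x in M. x \<in> A \<longrightarrow> g x \<in> ess_range M A g"
proof -
  interpret finite_measure M by fact
  have sp: "space M = UNIV" using sets_eq_imp_space_eq[OF sets] by simp
  note [measurable_cong] = sets
  let ?I = "\<lambda>p q. {y \<in> A. of_rat p < g y \<and> g y < of_rat q}"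
  have I [measurable]: "?I p q \<in> sets borel" for p q by measurable
  have "AE x in M. \<forall>p q. measure M (?I p q) = 0 \<longrightarrow> x \<notin> ?I p q"
  proof (subst AE_all_countable, rule allI, subst AE_all_countable, rule allI)
    fix p q
    show "AE x in M. measure M (?I p q) = 0 \<longrightarrow> x \<notin> ?I p q"
    proof (cases "measure M (?I p q) = 0")
      case True
      then have "AE x in M. x \<notin> ?I p q"
        using I sets by (intro AE_not_in null_setsI) (auto simp: emeasure_eq_measure)
      then show ?thesis by eventually_elim blast
    qed simp
  qed
  then show ?thesis
  proof eventually_elim
    case (elim x)
    show ?case
      unfolding ess_range_def
    proof (intro impI CollectI allI)
      fix \<epsilon> :: real assume x: "x \<in> A" and \<epsilon>: "\<epsilon> > 0"
      obtain p where p: "g x - \<epsilon> < of_rat p" "of_rat p < g x"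
        using of_rat_dense[of "g x - \<epsilon>" "g x"] \<epsilon> by auto
      obtain q where q: "g x < of_rat q" "of_rat q < g x + \<epsilon>"
        using of_rat_dense[of "g x" "g x + \<epsilon>"] \<epsilon> by auto
      have "measure M (?I p q) \<noteq> 0" using elim x p(2) q(1) by blast
      then have "0 < measure M (?I p q)" by (simp add: less_le)
      also have "\<dots> \<le> measure M {y \<in> A. \<bar>g y - g x\<bar> < \<epsilon>}"
      proof (rule finite_measure_mono)
        show "?I p q \<subseteq> {y \<in> A. \<bar>g y - g x\<bar> < \<epsilon>}" using p(1) q(2) by auto
        show "{y \<in> A. \<bar>g y - g x\<bar> < \<epsilon>} \<in> sets M" unfolding sets by measurable
      qed
      finally show "measure M {y \<in> A. \<bar>g y - g x\<bar> < \<epsilon>} > 0" .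
    qed
  qed
qed

text \<open>The image of \<open>\<mu>\<close> restricted to \<open>A\<close> is absolutely
  continuous with respect to \<open>\<nu>\<close>. This carries almost sure statements about
  \<open>\<nu>\<close> back along \<open>f\<close>, and it survives composition and the passage to
  subsets of positive mass.\<close>

definition transports :: "real measure \<Rightarrow> real measure \<Rightarrow> (real \<Rightarrow> real) \<Rightarrow> real set \<Rightarrow> bool"
  where "transports \<mu> \<nu> f A \<longleftrightarrow> A \<in> sets borel \<and> measure \<mu> A > 0 \<and>
    (\<forall>N\<in>sets borel. measure \<nu> N = 0 \<longrightarrow> measure \<mu> (A \<inter> f -` N) = 0)"

lemma smooth_cmult: "smooth f f' \<Longrightarrow> smooth (\<lambda>x. c * f x) (\<lambda>x. c * f' x)"
  unfolding smooth_def by (auto intro!: DERIV_cmult continuous_intros)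

text \<open>The affine map in between will be a branch of \<open>Tn p\<close>, extended to the whole
  line.\<close>

lemma smooth_compose:
  assumes f: "smooth f f'" and g: "smooth g g'"
  shows "smooth (\<lambda>x. g (c * f x - d)) (\<lambda>x. g' (c * f x - d) * (c * f' x))"
  unfolding smooth_def
proof (intro conjI allI)
  fix x
  have "((\<lambda>x. c * f x - d) has_real_derivative c * f' x) (at x)"
    using f unfolding smooth_def by (auto intro!: derivative_eq_intros)
  then show "((\<lambda>x. g (c * f x - d)) has_real_derivative g' (c * f x - d) * (c * f' x)) (at x)"
    using g unfolding smooth_def by (intro DERIV_chain2[of g]) auto
next
  have "continuous_on UNIV f"
    using f unfolding smooth_def by (meson DERIV_isCont continuous_at_imp_continuous_on)
  moreover have "continuous_on UNIV f'" "continuous_on UNIV g'"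
    using f g by (auto simp: smooth_def)
  ultimately show "continuous_on UNIV (\<lambda>x. g' (c * f x - d) * (c * f' x))"
    by (auto intro!: continuous_intros continuous_on_compose2[of UNIV g'])
qed

context times_ergodic
begin

text \<open>Along an orbit that misses \<open>B\<close>, the Birkhoff averages of its indicator
  would be 0.\<close>

lemma AE_visits:
  assumes B [measurable]: "B \<in> sets borel" and pos: "measure \<mu> B > 0"
  shows "AE x in \<mu>. \<exists>p. Tn p x \<in> B"
proof -
  have "AE x in \<mu>. (\<lambda>N. (\<Sum>i<N. indicator B (Tn i x)) / N) \<longlonglongrightarrow> (\<integral>x. indicator B x \<partial>\<mu>)"
    by (rule birkhoff[of _ 1]) (auto simp: indicator_def)
  then show ?thesis
  proof eventually_elim
    case (elim x)
    show ?case
    proof (rule ccontr)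
      assume "\<nexists>p. Tn p x \<in> B"
      then have "(\<lambda>N. (\<Sum>i<N. indicator B (Tn i x)) / N) = (\<lambda>N. 0 :: real)" by auto
      with elim have "(\<lambda>N. 0 :: real) \<longlonglongrightarrow> measure \<mu> B" by simp
      then have "measure \<mu> B = 0" using LIMSEQ_unique tendsto_const by blast
      then show False using pos by simp
    qed
  qed
qed

text \<open>Ergodicity of the intermediate measure brings the image of \<open>f\<close> into the domain of \<open>g\<close>.\<close>

lemma transports_compose:
  assumes "prob_space \<eta>" and sets_\<eta>: "sets \<eta> = sets borel"
    and f: "transports \<eta> \<mu> f A" and g: "transports \<mu> \<rho> g B"
    and [measurable]: "f \<in> borel_measurable borel" "g \<in> borel_measurable borel"
  shows "\<exists>p c A'. A' \<subseteq> A \<and> (\<forall>x\<in>A'. of_int a ^ p * f x - of_int c \<in> B) \<and>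
    transports \<eta> \<rho> (\<lambda>x. g (of_int a ^ p * f x - of_int c)) A'"
proof -
  interpret \<eta>: prob_space \<eta> by fact
  note [measurable_cong] = sets_\<eta>
  have [simp]: "space \<eta> = UNIV" using sets_eq_imp_space_eq[OF sets_\<eta>] by simp
  have A [measurable]: "A \<in> sets borel" and A_pos: "measure \<eta> A > 0"
    and f_null: "\<And>N. N \<in> sets borel \<Longrightarrow> measure \<mu> N = 0 \<Longrightarrow> measure \<eta> (A \<inter> f -` N) = 0"
    using f by (auto simp: transports_def)
  have B [measurable]: "B \<in> sets borel" and B_pos: "measure \<mu> B > 0"
    and g_null: "\<And>N. N \<in> sets borel \<Longrightarrow> measure \<rho> N = 0 \<Longrightarrow> measure \<mu> (B \<inter> g -` N) = 0"
    using g by (auto simp: transports_def)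
  \<comment> \<open>Countably many pieces. On each of them the integer part \<open>c\<close> is
    fixed, so that \<open>Tn p (f x)\<close> equals the smooth
    \<open>a ^ p * f x - c\<close>.\<close>
  define G where "G p c = {x \<in> A. Tn p (f x) \<in> B \<and> digits p (f x) = c}" for p c
  have G_meas [measurable]: "G p c \<in> sets borel" for p c
    unfolding G_def by measurable
  have "\<exists>p c. measure \<eta> (G p c) > 0"
  proof (rule ccontr)
    assume "\<not> ?thesis"
    then have zero: "measure \<eta> (G p c) = 0" for p c by (simp add: not_less antisym)
    define N where "N = {y. \<forall>p. Tn p y \<notin> B}"
    have [measurable]: "N \<in> sets borel" unfolding N_def by measurable
    have "AE y in \<mu>. y \<notin> N" using AE_visits[OF B B_pos] by (simp add: N_def)
    then have "measure \<mu> N = 0" by (subst prob_eq_0) auto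
    then have 1: "measure \<eta> (A \<inter> f -` N) = 0" by (intro f_null) auto
    have [measurable]: "A \<inter> f -` N \<in> sets borel"
      using measurable_sets[of f borel borel N] by simp
    have "AE x in \<eta>. x \<notin> A \<inter> f -` N" using 1 by (intro AE_not_in null_setsI) (auto simp: \<eta>.emeasure_eq_measure)
    moreover have "AE x in \<eta>. \<forall>p c. x \<notin> G p c"
      using zero by (intro AE_all_countable[THEN iffD2] allI AE_not_in null_setsI) (auto simp: \<eta>.emeasure_eq_measure)
    ultimately have "AE x in \<eta>. x \<notin> A"
      by eventually_elim (auto simp: G_def N_def)
    then have "measure \<eta> A = 0" by (subst \<eta>.prob_eq_0) auto
    then show False using A_pos by simp
  qed
  then obtain p c where pos: "measure \<eta> (G p c) > 0" by blast
  have in_B: "of_int a ^ p * f x - of_int c = Tn p (f x)" if "x \<in> G p c" for x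
    using that by (auto simp: G_def Tn_eq)
  have "measure \<eta> (G p c \<inter> (\<lambda>x. g (of_int a ^ p * f x - of_int c)) -` N) = 0"
    if N [measurable]: "N \<in> sets borel" and N0: "measure \<rho> N = 0" for N
  proof -
    let ?M = "B \<inter> g -` N"
    have [measurable]: "?M \<in> sets borel" using measurable_sets[of g borel borel N] by simp
    \<comment> \<open>Null by invariance of \<open>\<mu>\<close> under \<open>Tn p\<close>, so that
      \<open>f\<close> pulls it back to a null set.\<close>
    let ?M' = "{y. Tn p y \<in> ?M}"
    have "measure \<mu> ?M' = 0" using measure_Tn[of ?M p] g_null[OF N N0] by simp
    then have "measure \<eta> (A \<inter> f -` ?M') = 0" by (intro f_null) measurable
    then show ?thesis
    proof (rule \<eta>.measure_zero_mono)
      show "G p c \<inter> (\<lambda>x. g (of_int a ^ p * f x - of_int c)) -` N \<subseteq> A \<inter> f -` ?M'"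
        using in_B by (auto simp: G_def)
      have "?M' \<in> sets borel" by measurable
      then have "f -` ?M' \<inter> space borel \<in> sets borel" by (intro measurable_sets[of f borel borel]) auto
      then show "A \<inter> f -` ?M' \<in> sets \<eta>" using sets_\<eta> by (auto intro: sets.Int)
    qed
  qed
  then have "transports \<eta> \<rho> (\<lambda>x. g (of_int a ^ p * f x - of_int c)) (G p c)"
    using pos by (simp add: transports_def)
  moreover have "\<forall>x\<in>G p c. of_int a ^ p * f x - of_int c \<in> B"
    using in_B by (simp add: G_def)
  moreover have "G p c \<subseteq> A" by (auto simp: G_def)
  ultimately show ?thesis by blast
qed

text \<open>Logarithmic, up to multiples of \<open>ln a\<close>, and only on a set of positive mass.
  With a tolerance on the whole of \<open>A\<close>, the set of slopes is closed almost by
  construction.\<close>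

definition approx_slope :: "real \<Rightarrow> real \<Rightarrow> bool"
  where "approx_slope s \<epsilon> \<longleftrightarrow> (\<exists>f f' A. \<exists>i::int. smooth f f' \<and> transports \<mu> \<mu> f A \<and>
    (\<forall>x\<in>A. f' x \<noteq> 0 \<and> \<bar>ln \<bar>f' x\<bar> + of_int i * ln (of_int a) - s\<bar> < \<epsilon>))"

definition slopes :: "real set"
  where "slopes = {s. \<forall>\<epsilon>>0. approx_slope s \<epsilon>}"

lemma ln_a_pos: "0 < ln (of_int a :: real)"
  using a_ge_2 by simp

lemma slopes_zero: "0 \<in> slopes"
  unfolding slopes_def
proof (intro CollectI allI impI)
  fix \<epsilon> :: real assume \<epsilon>: "\<epsilon> > 0"
  have "smooth (\<lambda>x. x) (\<lambda>_. 1)" by (auto simp: smooth_def)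
  moreover have "transports \<mu> \<mu> (\<lambda>x. x) UNIV" by (simp add: transports_def)
  moreover have "\<forall>x\<in>UNIV. (1 :: real) \<noteq> 0 \<and> \<bar>ln \<bar>1 :: real\<bar> + of_int 0 * ln (of_int a) - 0\<bar> < \<epsilon>"
    using \<epsilon> by simp
  ultimately have "smooth (\<lambda>x. x) (\<lambda>_. 1) \<and> transports \<mu> \<mu> (\<lambda>x. x) UNIV \<and>
      (\<forall>x\<in>UNIV. (1 :: real) \<noteq> 0 \<and> \<bar>ln \<bar>1 :: real\<bar> + of_int 0 * ln (of_int a) - 0\<bar> < \<epsilon>)"
    by (intro conjI)
  note ex = this
  show "approx_slope 0 \<epsilon>"
    unfolding approx_slope_def
    by (rule exI[of _ "\<lambda>x. x"], rule exI[of _ "\<lambda>_. 1"], rule exI[of _ UNIV], rule exI[of _ 0], rule ex)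
qed

lemma slopes_shift:
  assumes "s \<in> slopes" shows "s + of_int j * ln (of_int a) \<in> slopes"
  unfolding slopes_def
proof (intro CollectI allI impI)
  fix \<epsilon> :: real assume "\<epsilon> > 0"
  then obtain f f' A and i :: int where *: "smooth f f'" "transports \<mu> \<mu> f A"
    "\<forall>x\<in>A. f' x \<noteq> 0 \<and> \<bar>ln \<bar>f' x\<bar> + of_int i * ln (of_int a) - s\<bar> < \<epsilon>"
    using assms unfolding slopes_def approx_slope_def by blast
  have "ln \<bar>f' x\<bar> + of_int (i + j) * ln (of_int a) - (s + of_int j * ln (of_int a))
    = ln \<bar>f' x\<bar> + of_int i * ln (of_int a) - s" for x
    by (simp add: algebra_simps)
  with *(3) have "\<forall>x\<in>A. f' x \<noteq> 0 \<and>
      \<bar>ln \<bar>f' x\<bar> + of_int (i + j) * ln (of_int a) - (s + of_int j * ln (of_int a))\<bar> < \<epsilon>"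
    by presburger
  with *(1,2) show "approx_slope (s + of_int j * ln (of_int a)) \<epsilon>"
    unfolding approx_slope_def
    by blast
qed

lemma slopes_closed:
  assumes "\<And>\<epsilon>. \<epsilon> > 0 \<Longrightarrow> \<exists>t\<in>slopes. \<bar>t - s\<bar> < \<epsilon>" shows "s \<in> slopes"
  unfolding slopes_def
proof (intro CollectI allI impI)
  fix \<epsilon> :: real assume "\<epsilon> > 0"
  then have \<epsilon>: "\<epsilon> / 2 > 0" by simp
  obtain t where t: "t \<in> slopes" "\<bar>t - s\<bar> < \<epsilon> / 2" using assms[OF \<epsilon>] by blast
  obtain f f' A and i :: int where *: "smooth f f'" "transports \<mu> \<mu> f A"
    "\<forall>x\<in>A. f' x \<noteq> 0 \<and> \<bar>ln \<bar>f' x\<bar> + of_int i * ln (of_int a) - t\<bar> < \<epsilon> / 2"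
    using t(1) \<epsilon> unfolding slopes_def approx_slope_def by blast
  have "\<bar>ln \<bar>f' x\<bar> + of_int i * ln (of_int a) - s\<bar> < \<epsilon>" if "x \<in> A" for x
  proof -
    have "\<bar>ln \<bar>f' x\<bar> + of_int i * ln (of_int a) - t\<bar> < \<epsilon> / 2" using *(3) that by blast
    then show ?thesis using t(2) by linarith
  qed
  with * show "approx_slope s \<epsilon>"
    unfolding approx_slope_def
    by blast
qed

end

text \<open>The factor \<open>a ^ p\<close>, the cost of waiting for a visit to \<open>B\<close>, is
  absorbed by the multiple of \<open>ln a\<close>. The intermediate measure is arbitrary:
  \<open>\<mu>\<close> itself gives the semigroup law, another one serves part (ii).\<close>

lemma (in times_ergodic) slope_compose:
  assumes \<nu>: "times_ergodic a \<nu>"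
    and f: "smooth f f'" "transports \<mu> \<nu> f A" "\<And>x. x \<in> A \<Longrightarrow> f' x \<noteq> 0 \<and> \<bar>ln \<bar>f' x\<bar> - s\<bar> < \<epsilon>"
    and g: "smooth g g'" "transports \<nu> \<mu> g B" "\<And>y. y \<in> B \<Longrightarrow> g' y \<noteq> 0 \<and> \<bar>ln \<bar>g' y\<bar> - t\<bar> < \<epsilon>"
  shows "approx_slope (s + t) (2 * \<epsilon>)"
proof -
  interpret \<nu>: times_ergodic a \<nu> by fact
  obtain p c A' where A': "A' \<subseteq> A" "\<And>x. x \<in> A' \<Longrightarrow> of_int a ^ p * f x - of_int c \<in> B"
    "transports \<mu> \<mu> (\<lambda>x. g (of_int a ^ p * f x - of_int c)) A'"
    using \<nu>.transports_compose[OF prob_space_axioms sets_eq f(2) g(2) smooth_measurable(1)[OF f(1)]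
        smooth_measurable(1)[OF g(1)]] by blast
  let ?h' = "\<lambda>x. g' (of_int a ^ p * f x - of_int c) * (of_int a ^ p * f' x)"
  have "?h' x \<noteq> 0 \<and> \<bar>ln \<bar>?h' x\<bar> + of_int (- int p) * ln (of_int a) - (s + t)\<bar> < 2 * \<epsilon>" if x: "x \<in> A'" for x
  proof -
    let ?y = "of_int a ^ p * f x - of_int c"
    have 1: "f' x \<noteq> 0" "\<bar>ln \<bar>f' x\<bar> - s\<bar> < \<epsilon>" using f(3) A'(1) x by auto
    have 2: "g' ?y \<noteq> 0" "\<bar>ln \<bar>g' ?y\<bar> - t\<bar> < \<epsilon>" using g(3)[OF A'(2)[OF x]] by auto
    have "ln \<bar>?h' x\<bar> = ln \<bar>g' ?y\<bar> + (real p * ln (of_int a) + ln \<bar>f' x\<bar>)"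
      using 1(1) 2(1) a_ge_2 by (simp add: abs_mult ln_mult ln_realpow power_abs)
    then have "\<bar>ln \<bar>?h' x\<bar> + of_int (- int p) * ln (of_int a) - (s + t)\<bar> = \<bar>(ln \<bar>f' x\<bar> - s) + (ln \<bar>g' ?y\<bar> - t)\<bar>"
      by (simp add: algebra_simps)
    also have "\<dots> < 2 * \<epsilon>" using 1(2) 2(2) by linarith
    finally show ?thesis using 1(1) 2(1) a_ge_2 by simp
  qed
  then have ex: "smooth (\<lambda>x. g (of_int a ^ p * f x - of_int c)) ?h' \<and>
    transports \<mu> \<mu> (\<lambda>x. g (of_int a ^ p * f x - of_int c)) A' \<and>
    (\<forall>x\<in>A'. ?h' x \<noteq> 0 \<and> \<bar>ln \<bar>?h' x\<bar> + of_int (- int p) * ln (of_int a) - (s + t)\<bar> < 2 * \<epsilon>)"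
    using A'(3) smooth_compose[OF f(1) g(1)] by blast
  show ?thesis
    unfolding approx_slope_def
    by (rule exI[of _ "\<lambda>x. g (of_int a ^ p * f x - of_int c)"], rule exI[of _ ?h'],
        rule exI[of _ A'], rule exI[of _ "- int p"], rule ex)
qed

context times_ergodic
begin

lemma times_ergodic_self: "times_ergodic a \<mu>" ..

lemma slopes_add:
  assumes s: "s \<in> slopes" and t: "t \<in> slopes" shows "s + t \<in> slopes"
  unfolding slopes_def
proof (intro CollectI allI impI)
  fix \<epsilon> :: real assume "\<epsilon> > 0"
  then have \<epsilon>: "\<epsilon> / 2 > 0" by simp
  let ?L = "ln (of_int a) :: real"
  obtain f f' A and i :: int where f: "smooth f f'" "transports \<mu> \<mu> f A"
    "\<And>x. x \<in> A \<Longrightarrow> f' x \<noteq> 0 \<and> \<bar>ln \<bar>f' x\<bar> + of_int i * ?L - s\<bar> < \<epsilon> / 2"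
    using s \<epsilon> unfolding slopes_def approx_slope_def by blast
  obtain g g' B and j :: int where g: "smooth g g'" "transports \<mu> \<mu> g B"
    "\<And>x. x \<in> B \<Longrightarrow> g' x \<noteq> 0 \<and> \<bar>ln \<bar>g' x\<bar> + of_int j * ?L - t\<bar> < \<epsilon> / 2"
    using t \<epsilon> unfolding slopes_def approx_slope_def by blast
  have f3: "f' x \<noteq> 0 \<and> \<bar>ln \<bar>f' x\<bar> - (s - of_int i * ?L)\<bar> < \<epsilon> / 2" if "x \<in> A" for x
    using f(3)[OF that] by (simp add: algebra_simps)
  have g3: "g' x \<noteq> 0 \<and> \<bar>ln \<bar>g' x\<bar> - (t - of_int j * ?L)\<bar> < \<epsilon> / 2" if "x \<in> B" for x
    using g(3)[OF that] by (simp add: algebra_simps)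
  obtain h h' A' and l :: int where h: "smooth h h'" "transports \<mu> \<mu> h A'"
    "\<And>x. x \<in> A' \<Longrightarrow> h' x \<noteq> 0 \<and>
      \<bar>ln \<bar>h' x\<bar> + of_int l * ?L - ((s - of_int i * ?L) + (t - of_int j * ?L))\<bar> < 2 * (\<epsilon> / 2)"
    using slope_compose[OF times_ergodic_self f(1,2) f3 g(1,2) g3] unfolding approx_slope_def by blast
  have "h' x \<noteq> 0 \<and> \<bar>ln \<bar>h' x\<bar> + of_int (l + i + j) * ?L - (s + t)\<bar> < \<epsilon>" if "x \<in> A'" for x
    using h(3)[OF that] by (simp add: algebra_simps)
  with h(1,2) show "approx_slope (s + t) \<epsilon>"
    unfolding approx_slope_def
    by blast
qed

text \<open>Multiplying \<open>f\<close> by \<open>a powi i\<close> brings the modulus of its slope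
  close to \<open>exp s\<close> and keeps its values normal; continuity of \<open>exp\<close> turns
  the logarithmic tolerance into an additive one.\<close>

lemma slopes_bound:
  assumes s: "s \<in> slopes"
  shows "norm (fourier_coeff k) \<le> sqrt (freq_energy (2 * pi * k * exp s))"
proof (rule field_le_epsilon)
  fix \<eta> :: real assume \<eta>: "\<eta> > 0"
  define K where "K = 2 * pi * real k + 1"
  have K: "K > 0" "2 * pi * real k \<le> K" by (simp_all add: K_def add_nonneg_pos)
  have "isCont exp s" by simp
  then obtain \<epsilon> where \<epsilon>: "\<epsilon> > 0" "\<And>t. \<bar>t - s\<bar> < \<epsilon> \<Longrightarrow> \<bar>exp t - exp s\<bar> < \<eta> / K"
    using \<eta> K unfolding continuous_at_eps_delta dist_real_def by (metis divide_pos_pos)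
  obtain f f' A and i :: int where f: "smooth f f'" "transports \<mu> \<mu> f A"
    "\<And>x. x \<in> A \<Longrightarrow> f' x \<noteq> 0 \<and> \<bar>ln \<bar>f' x\<bar> + of_int i * ln (of_int a) - s\<bar> < \<epsilon>"
    using s \<epsilon>(1) unfolding slopes_def approx_slope_def by blast
  define b where "b = (of_int a :: real) powi i"
  have b: "b > 0" "ln b = of_int i * ln (of_int a)"
    using a_ge_2 by (auto simp: b_def power_int_def ln_realpow ln_inverse)
  have A: "A \<in> sets borel" "measure \<mu> A > 0" using f(2) by (auto simp: transports_def)
  have normal: "AE x in \<mu>. x \<in> A \<longrightarrow> normal k (b * f x)"
  proof -
    obtain N where N: "{x \<in> space \<mu>. \<not> normal k x} \<subseteq> N" "emeasure \<mu> N = 0" "N \<in> sets \<mu>"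
      using AE_E[OF AE_normal] by blast
    then have "measure \<mu> (A \<inter> f -` N) = 0"
      using f(2) by (auto simp: transports_def measure_def)
    moreover have "A \<inter> f -` N \<in> sets borel"
      using A N(3) measurable_sets[OF smooth_measurable(1)[OF f(1)], of N] by (auto intro: sets.Int)
    ultimately have "AE x in \<mu>. x \<notin> A \<inter> f -` N"
      by (intro AE_not_in null_setsI) (auto simp: emeasure_eq_measure)
    then show ?thesis
      by eventually_elim (use N(1) in \<open>auto simp: b_def normal_mult_powi\<close>)
  qed
  have slope: "\<bar>\<bar>b * f' x\<bar> - exp s\<bar> \<le> \<eta> / K" if "x \<in> A" for x
  proof -
    have x: "f' x \<noteq> 0" "\<bar>ln \<bar>f' x\<bar> + of_int i * ln (of_int a) - s\<bar> < \<epsilon>" using f(3)[OF that] by auto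
    then have "\<bar>exp (ln \<bar>f' x\<bar> + ln b) - exp s\<bar> < \<eta> / K" unfolding b(2) by (intro \<epsilon>(2))
    moreover have "exp (ln \<bar>f' x\<bar> + ln b) = \<bar>b * f' x\<bar>" using x(1) b(1) by (simp add: exp_add abs_mult)
    ultimately show ?thesis by simp
  qed
  have "norm (fourier_coeff k) \<le> sqrt (freq_energy (2 * pi * k * exp s)) + 2 * pi * k * (\<eta> / K)"
    using \<eta> K by (intro fourier_coeff_le_freq_energy[OF smooth_cmult[OF f(1)] A normal slope]) auto
  also have "2 * pi * k * (\<eta> / K) \<le> K * (\<eta> / K)" using K \<eta> by (intro mult_right_mono) auto
  also have "K * (\<eta> / K) = \<eta>" using K by simp
  finally show "norm (fourier_coeff k) \<le> sqrt (freq_energy (2 * pi * k * exp s)) + \<eta>" by simp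
qed

text \<open>If all slopes were available, \<open>s\<close> could be chosen so that
  \<open>2 * pi * k * exp s\<close> is any given integer \<open>r >= 1\<close>, and these are the
  frequencies in Wiener's lemma.\<close>

lemma slopes_proper:
  assumes dim: "intermediate_dimension \<mu>" shows "slopes \<noteq> UNIV"
proof
  assume univ: "slopes = UNIV"
  obtain k where k: "k \<ge> 1" "fourier_coeff k \<noteq> 0" using nonzero_fourier_coeff[OF dim] by blast
  have "fourier_coeff k = 0"
  proof (rule fourier_coeff_eq_0[OF dim])
    fix r :: nat assume r: "r \<ge> 1"
    define s where "s = ln (real r / (2 * pi * real k))"
    have "2 * pi * real k * exp s = real r" using r k by (simp add: s_def)
    then have "norm (fourier_coeff k) \<le> sqrt (freq_energy (real r))"
      using slopes_bound[of s k] univ by simp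
    then have "(norm (fourier_coeff k))\<^sup>2 \<le> (sqrt (freq_energy (real r)))\<^sup>2" by (intro power_mono) auto
    moreover have "0 \<le> freq_energy (real r)"
      using energy_nonneg[of "freq (real r)" 0] cSUP_upper[OF _ energy_bdd[of "freq (real r)"], of 0]
      by (auto intro: order_trans)
    ultimately show "(norm (fourier_coeff k))\<^sup>2 \<le> freq_energy (real r)" by simp
  qed
  then show False using k(2) by simp
qed

lemma slopes_discrete:
  assumes dim: "intermediate_dimension \<mu>"
  shows "\<exists>n::nat. n \<ge> 1 \<and> (\<forall>s\<in>slopes. \<exists>k::int. s = of_int k / of_nat n * ln (of_int a))"
  by (rule closed_semigroup_real[OF ln_a_pos slopes_zero slopes_add slopes_shift slopes_closed slopes_proper[OF dim]])

end

section \<open>The theorem\<close>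

lemma diffeo_smooth:
  assumes "f \<in> diffeos"
  shows "\<exists>f' g'. smooth f f' \<and> smooth (inv f) g' \<and> bij f \<and> (\<forall>x. deriv f x = f' x) \<and>
    (\<forall>x. f' x \<noteq> 0) \<and> (\<forall>y. g' y = 1 / f' (inv f y))"
proof -
  have bij: "bij f" using assms by (simp add: diffeos_def)
  obtain f' where f': "\<And>x. (f has_real_derivative f' x) (at x)" "continuous_on UNIV f'"
    using assms unfolding diffeos_def C1_differentiable_on_def has_real_derivative_iff_has_vector_derivative by auto
  obtain g' where g': "\<And>x. (inv f has_real_derivative g' x) (at x)" "continuous_on UNIV g'"
    using assms unfolding diffeos_def C1_differentiable_on_def has_real_derivative_iff_has_vector_derivative by auto
  have prod: "g' (f x) * f' x = 1" for x
  proof -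
    have "((\<lambda>x. inv f (f x)) has_real_derivative g' (f x) * f' x) (at x)"
      using g'(1) f'(1) by (rule DERIV_chain2)
    moreover have "(\<lambda>x. inv f (f x)) = (\<lambda>x. x)" using bij by (simp add: bij_is_inj)
    ultimately have "((\<lambda>x. x) has_real_derivative g' (f x) * f' x) (at x)" by simp
    then show ?thesis using DERIV_ident DERIV_unique by blast
  qed
  have nz: "f' x \<noteq> 0" for x using prod[of x] by auto
  have "g' y = 1 / f' (inv f y)" for y
    using prod[of "inv f y"] nz[of "inv f y"] bij by (simp add: bij_is_surj surj_f_inv_f field_simps)
  then show ?thesis
    using f' g' bij nz DERIV_imp_deriv[OF f'(1)] unfolding smooth_def by blast
qed

section \<open>Transports obtained from equivalent restrictions\<close>

lemma equiv_measures_restr: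
  assumes "equiv_measures (restr (distr \<mu> borel f) E) (restr \<nu> E)"
    and "finite_measure \<mu>" "finite_measure \<nu>" "sets \<mu> = sets borel" "sets \<nu> = sets borel"
    and f: "f \<in> borel_measurable borel" and E: "E \<in> sets borel" and B: "B \<in> sets borel"
  shows "measure \<mu> (f -` (E \<inter> B)) = 0 \<longleftrightarrow> measure \<nu> (E \<inter> B) = 0"
proof -
  interpret \<mu>: finite_measure \<mu> by fact
  interpret \<nu>: finite_measure \<nu> by fact
  have f': "f \<in> measurable \<mu> borel" using f assms(4) by (simp cong: measurable_cong_sets)
  have sp: "space \<mu> = UNIV" using sets_eq_imp_space_eq[OF assms(4)] by simp
  have null_f: "B \<in> null_sets (restr (distr \<mu> borel f) E) \<longleftrightarrow> measure \<mu> (f -` (E \<inter> B)) = 0"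
  proof -
    have "emeasure (restr (distr \<mu> borel f) E) B = emeasure (distr \<mu> borel f) (E \<inter> B)"
      unfolding restr_def using E B by (intro emeasure_restricted) auto
    also have "\<dots> = emeasure \<mu> (f -` (E \<inter> B))"
      using E B f' by (subst emeasure_distr) (auto simp: sp)
    finally show ?thesis using B by (auto simp: null_sets_def restr_def \<mu>.emeasure_eq_measure)
  qed
  have null_\<nu>: "B \<in> null_sets (restr \<nu> E) \<longleftrightarrow> measure \<nu> (E \<inter> B) = 0"
  proof -
    have "emeasure (restr \<nu> E) B = emeasure \<nu> (E \<inter> B)"
      unfolding restr_def using E B assms(5) by (intro emeasure_restricted) auto
    then show ?thesis using B assms(5) by (auto simp: null_sets_def restr_def \<nu>.emeasure_eq_measure)
  qed
  show ?thesis
    using assms(1) null_f null_\<nu> unfolding equiv_measures_def absolutely_continuous_def by blast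
qed

context times_ergodic
begin

lemma transports_equiv:
  assumes \<nu>: "times_ergodic a \<nu>" and f: "smooth f f'" and E: "E \<in> sets borel"
    and equiv: "equiv_measures (restr (distr \<mu> borel f) E) (restr \<nu> E)"
    and A: "A \<in> sets borel" "A \<subseteq> f -` E" "measure \<mu> A > 0"
  shows "transports \<mu> \<nu> f A"
  unfolding transports_def
proof (intro conjI ballI impI A)
  interpret \<nu>: times_ergodic a \<nu> by fact
  fix N assume N: "N \<in> sets borel" "measure \<nu> N = 0"
  have f_meas: "f \<in> borel_measurable borel" using f by (rule smooth_measurable)
  have "measure \<nu> (E \<inter> N) = 0"
    by (rule \<nu>.measure_zero_mono[OF N(2)]) (use N in auto)
  then have "measure \<mu> (f -` (E \<inter> N)) = 0"
    using equiv_measures_restr[OF equiv finite_measure_axioms \<nu>.finite_measure_axioms sets_eq \<nu>.sets_eq f_meas E N(1)]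
    by simp
  then show "measure \<mu> (A \<inter> f -` N) = 0"
  proof (rule measure_zero_mono)
    show "f -` (E \<inter> N) \<in> sets \<mu>"
      using measurable_sets[OF f_meas, of "E \<inter> N"] E N by (simp add: sets.Int)
  qed (use A in auto)
qed

text \<open>Null sets are carried forward by the converse half of the equivalence; the half that
  made \<open>f\<close> a transport now gives the image of \<open>A\<close> positive mass.\<close>

lemma transports_equiv_inv:
  assumes \<nu>: "times_ergodic a \<nu>" and f: "smooth f f'" and g: "smooth (inv f) g'" and bij: "bij f"
    and E: "E \<in> sets borel"
    and equiv: "equiv_measures (restr (distr \<mu> borel f) E) (restr \<nu> E)"
    and A: "A \<in> sets borel" "A \<subseteq> f -` E" "measure \<mu> A > 0"
  shows "transports \<nu> \<mu> (inv f) (f ` A)"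
proof -
  interpret \<nu>: times_ergodic a \<nu> by fact
  have f_meas: "f \<in> borel_measurable borel" using f by (rule smooth_measurable)
  have img_meas: "f ` B \<in> sets borel" if "B \<in> sets borel" for B
    using measurable_sets[OF smooth_measurable(1)[OF g], of B] that by (simp add: bij_vimage_eq_inv_image[OF bij_imp_bij_inv[OF bij]] inv_inv_eq[OF bij])
  have iff: "measure \<mu> B = 0 \<longleftrightarrow> measure \<nu> (f ` B) = 0" if B: "B \<in> sets borel" "B \<subseteq> A" for B
  proof -
    have EB: "E \<inter> f ` B = f ` B" using A(2) B(2) by auto
    have "f -` (f ` B) = B" using bij by (simp add: bij_is_inj inj_vimage_image_eq)
    then show ?thesis
      using equiv_measures_restr[OF equiv finite_measure_axioms \<nu>.finite_measure_axioms sets_eq \<nu>.sets_eq f_meas E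
          img_meas[OF B(1)]] by (simp add: EB)
  qed
  show ?thesis
    unfolding transports_def
  proof (intro conjI ballI impI)
    show "f ` A \<in> sets borel" by (rule img_meas[OF A(1)])
    have "measure \<nu> (f ` A) \<noteq> 0" using iff[OF A(1)] A(3) by simp
    then show "0 < measure \<nu> (f ` A)" by (simp add: less_le)
    fix N :: "real set" assume N: "N \<in> sets borel" "measure \<mu> N = 0"
    have "measure \<mu> (A \<inter> N) = 0" by (rule measure_zero_mono[OF N(2)]) (use N in auto)
    then have "measure \<nu> (f ` (A \<inter> N)) = 0" using iff[of "A \<inter> N"] A(1) N(1) by (simp add: sets.Int)
    moreover have "f ` A \<inter> inv f -` N = f ` (A \<inter> N)"
      using bij by (auto simp: bij_is_inj)
    ultimately show "measure \<nu> (f ` A \<inter> inv f -` N) = 0" by simp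
  qed
qed

lemma essential_slope:
  assumes f: "smooth f f'" and nz: "\<And>x. f' x \<noteq> 0" and E: "E \<in> sets borel"
    and equiv: "equiv_measures (restr (distr \<mu> borel f) E) (restr \<mu> E)"
    and ess: "s \<in> ess_range \<mu> (f -` E) (\<lambda>x. ln \<bar>f' x\<bar>)"
  shows "s \<in> slopes"
  unfolding slopes_def
proof (intro CollectI allI impI)
  fix \<epsilon> :: real assume \<epsilon>: "\<epsilon> > 0"
  let ?A = "{y \<in> f -` E. \<bar>ln \<bar>f' y\<bar> - s\<bar> < \<epsilon>}"
  note [measurable] = smooth_measurable[OF f] E
  have "?A \<in> sets borel" by measurable
  then have tr: "transports \<mu> \<mu> f ?A"
    using ess \<epsilon> unfolding ess_range_def by (intro transports_equiv[OF times_ergodic_self f E equiv]) auto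
  have "\<forall>x\<in>?A. f' x \<noteq> 0 \<and> \<bar>ln \<bar>f' x\<bar> + of_int 0 * ln (of_int a) - s\<bar> < \<epsilon>"
    using nz by simp
  with f tr show "approx_slope s \<epsilon>"
    unfolding approx_slope_def by blast
qed

text \<open>Going from one point to another through \<open>\<nu>\<close>, i.e. by \<open>f\<close>, a power of \<open>T a\<close> and
  \<open>inv f\<close>.\<close>

lemma essential_slope_diff:
  assumes \<nu>: "times_ergodic a \<nu>" and f: "smooth f f'" and g: "smooth (inv f) g'" and bij: "bij f"
    and nz: "\<And>x. f' x \<noteq> 0" and g': "\<And>y. g' y = 1 / f' (inv f y)" and E: "E \<in> sets borel"
    and equiv: "equiv_measures (restr (distr \<mu> borel f) E) (restr \<nu> E)"
    and ess_s: "s \<in> ess_range \<mu> (f -` E) (\<lambda>x. ln \<bar>f' x\<bar>)"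
    and ess_t: "t \<in> ess_range \<mu> (f -` E) (\<lambda>x. ln \<bar>f' x\<bar>)"
  shows "s - t \<in> slopes"
  unfolding slopes_def
proof (intro CollectI allI impI)
  fix \<epsilon> :: real assume "\<epsilon> > 0"
  then have \<epsilon>: "\<epsilon> / 2 > 0" by simp
  let ?A = "\<lambda>s. {y \<in> f -` E. \<bar>ln \<bar>f' y\<bar> - s\<bar> < \<epsilon> / 2}"
  note [measurable] = smooth_measurable[OF f] E
  have A: "?A s \<in> sets borel" for s by measurable
  have f3: "f' x \<noteq> 0 \<and> \<bar>ln \<bar>f' x\<bar> - s\<bar> < \<epsilon> / 2" if "x \<in> ?A s" for x using that nz by simp
  have g3: "g' y \<noteq> 0 \<and> \<bar>ln \<bar>g' y\<bar> - (- t)\<bar> < \<epsilon> / 2" if "y \<in> f ` ?A t" for y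
  proof -
    obtain x where x: "x \<in> ?A t" "y = f x" using \<open>y \<in> f ` ?A t\<close> by blast
    then have "g' y = 1 / f' x" using g' bij by (simp add: bij_is_inj)
    then have "ln \<bar>g' y\<bar> = - ln \<bar>f' x\<bar>" using nz[of x] by (simp add: ln_div abs_divide)
    moreover have "\<bar>ln \<bar>f' x\<bar> - t\<bar> < \<epsilon> / 2" using x(1) by simp
    ultimately show ?thesis using \<open>g' y = 1 / f' x\<close> nz[of x] by (simp add: abs_minus_commute)
  qed
  have pos: "measure \<mu> (?A r) > 0" if "r \<in> ess_range \<mu> (f -` E) (\<lambda>x. ln \<bar>f' x\<bar>)" for r
    using that \<epsilon> unfolding ess_range_def by blast
  have tr1: "transports \<mu> \<nu> f (?A s)"
    using A pos[OF ess_s] by (intro transports_equiv[OF \<nu> f E equiv]) auto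
  have tr2: "transports \<nu> \<mu> (inv f) (f ` ?A t)"
    using A pos[OF ess_t] by (intro transports_equiv_inv[OF \<nu> f g bij E equiv]) auto
  show "approx_slope (s - t) \<epsilon>"
    using slope_compose[OF \<nu> f tr1 f3 g tr2 g3] by simp
qed

lemma eq_powr_of_ln:
  fixes u t :: real
  assumes "u \<noteq> 0" "t > 0" and "ln \<bar>u\<bar> - ln t = of_int k / of_nat n * ln (of_int a)"
  shows "u = t * of_int a powr (of_int k / of_nat n) \<or> u = - (t * of_int a powr (of_int k / of_nat n))"
proof -
  have "\<bar>u\<bar> = exp (ln t + (ln \<bar>u\<bar> - ln t))" using assms(1) by simp
  also have "\<dots> = t * exp (of_int k / of_nat n * ln (of_int a))"
    unfolding assms(3) using assms(2) by (simp add: exp_add)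
  also have "exp (of_int k / of_nat n * ln (of_int a)) = of_int a powr (of_int k / of_nat n)"
    using a_ge_2 by (simp add: powr_def)
  finally show ?thesis by (auto simp: abs_if split: if_splits)
qed

end

theorem theorem1p1:
  fixes a :: int and \<mu> :: "real measure"
  assumes "a \<ge> 2" and "T_ergodic a \<mu>" and "intermediate_dimension \<mu>"
  shows "\<exists>n::nat. n \<ge> 1 \<and>
    (\<forall>f \<in> diffeos. \<forall>E \<in> sets borel.
       equiv_measures (restr (distr \<mu> borel f) E) (restr \<mu> E) \<longrightarrow>
       (AE x in \<mu>. x \<in> f -` E \<longrightarrow>
          (\<exists>k::int. deriv f x = of_int a powr (of_int k / of_nat n) \<or>
                    deriv f x = - (of_int a powr (of_int k / of_nat n))))) \<and>
    (\<forall>\<nu> :: real measure. T_ergodic a \<nu> \<longrightarrow>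
      (\<forall>f \<in> diffeos. \<forall>E \<in> sets borel.
         equiv_measures (restr (distr \<mu> borel f) E) (restr \<nu> E) \<longrightarrow>
         (\<exists>t::real. AE x in \<mu>. x \<in> f -` E \<longrightarrow>
            (\<exists>k::int. deriv f x = t * of_int a powr (of_int k / of_nat n) \<or>
                      deriv f x = - (t * of_int a powr (of_int k / of_nat n))))))"
proof -
  interpret times_ergodic a \<mu> using assms by unfold_locales
  \<comment> \<open>Determined by the slopes of \<open>\<mu>\<close> alone, hence common to all
    \<open>\<nu>\<close>, \<open>f\<close> and \<open>E\<close>.\<close>
  obtain n :: nat where n: "n \<ge> 1" "\<And>s. s \<in> slopes \<Longrightarrow> \<exists>k::int. s = of_int k / of_nat n * ln (of_int a)"
    using slopes_discrete[OF assms(3)] by blast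
  have ess: "AE x in \<mu>. x \<in> f -` E \<longrightarrow> ln \<bar>f' x\<bar> \<in> ess_range \<mu> (f -` E) (\<lambda>x. ln \<bar>f' x\<bar>)"
    if f: "smooth f f'" and E: "E \<in> sets borel" for f f' E
  proof (rule AE_ess_range)
    note [measurable] = smooth_measurable[OF f] E
    show "(\<lambda>x. ln \<bar>f' x\<bar>) \<in> borel_measurable borel" by measurable
    show "f -` E \<in> sets borel" using measurable_sets[OF smooth_measurable(1)[OF f] E] by simp
  qed (simp_all add: finite_measure_axioms)
  show ?thesis
  proof (intro exI[of _ n] conjI n(1) ballI allI impI)
    fix f E assume f: "f \<in> diffeos" and E: "E \<in> sets borel"
      and equiv: "equiv_measures (restr (distr \<mu> borel f) E) (restr \<mu> E)"
    obtain f' where sm: "smooth f f'" and d: "\<And>x. deriv f x = f' x" and nz: "\<And>x. f' x \<noteq> 0"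
      using diffeo_smooth[OF f] by blast
    show "AE x in \<mu>. x \<in> f -` E \<longrightarrow>
          (\<exists>k::int. deriv f x = of_int a powr (of_int k / of_nat n) \<or>
                    deriv f x = - (of_int a powr (of_int k / of_nat n)))"
      using ess[OF sm E]
    proof eventually_elim
      case (elim x)
      show ?case
      proof
        assume "x \<in> f -` E"
        then have "ln \<bar>f' x\<bar> \<in> slopes"
          using elim by (intro essential_slope[OF sm nz E equiv]) blast
        then obtain k :: int where "ln \<bar>f' x\<bar> = of_int k / of_nat n * ln (of_int a)" using n(2) by blast
        then show "\<exists>k::int. deriv f x = of_int a powr (of_int k / of_nat n) \<or>
            deriv f x = - (of_int a powr (of_int k / of_nat n))"
          using eq_powr_of_ln[OF nz[of x] zero_less_one, of k n] by (auto simp: d)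
      qed
    qed
  next
    fix \<nu> f E assume "T_ergodic a \<nu>" and f: "f \<in> diffeos" and E: "E \<in> sets borel"
      and equiv: "equiv_measures (restr (distr \<mu> borel f) E) (restr \<nu> E)"
    then have \<nu>: "times_ergodic a \<nu>" using assms(1) by unfold_locales
    obtain f' g' where sm: "smooth f f'" "smooth (inv f) g'" "bij f"
      and d: "\<And>x. deriv f x = f' x" and nz: "\<And>x. f' x \<noteq> 0" and g': "\<And>y. g' y = 1 / f' (inv f y)"
      using diffeo_smooth[OF f] by blast
    show "\<exists>t::real. AE x in \<mu>. x \<in> f -` E \<longrightarrow>
            (\<exists>k::int. deriv f x = t * of_int a powr (of_int k / of_nat n) \<or>
                      deriv f x = - (t * of_int a powr (of_int k / of_nat n)))"
    proof (cases "\<exists>z. ln \<bar>f' z\<bar> \<in> ess_range \<mu> (f -` E) (\<lambda>x. ln \<bar>f' x\<bar>)")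
      case True
      then obtain z where z: "ln \<bar>f' z\<bar> \<in> ess_range \<mu> (f -` E) (\<lambda>x. ln \<bar>f' x\<bar>)"
        by blast
      show ?thesis
      \<comment> \<open>\<open>t\<close> is the modulus of one essential slope; the other essential
        slopes differ from it by factors whose logarithms lie in \<open>slopes\<close>.\<close>
      proof (rule exI[of _ "\<bar>f' z\<bar>"], use ess[OF sm(1) E] in eventually_elim)
        case (elim x)
        show ?case
        proof
          assume "x \<in> f -` E"
          then have "ln \<bar>f' x\<bar> - ln \<bar>f' z\<bar> \<in> slopes"
            using elim z by (intro essential_slope_diff[OF \<nu> sm nz g' E equiv]) blast+
          then obtain k :: int where "ln \<bar>f' x\<bar> - ln \<bar>f' z\<bar> = of_int k / of_nat n * ln (of_int a)" using n(2) by blast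
          then show "\<exists>k::int. deriv f x = \<bar>f' z\<bar> * of_int a powr (of_int k / of_nat n) \<or>
              deriv f x = - (\<bar>f' z\<bar> * of_int a powr (of_int k / of_nat n))"
            using eq_powr_of_ln[OF nz[of x], of "\<bar>f' z\<bar>" k n] nz[of z] unfolding d by auto
        qed
      qed
    next
      case False
      \<comment> \<open>No essential value is attained, so by \<open>ess\<close> the preimage of
        \<open>E\<close> is null, and any \<open>t\<close> will do.\<close>
      show ?thesis
        by (rule exI[of _ 0], rule eventually_mono[OF ess[OF sm(1) E]]) (use False in blast)
    qed
  qed
qed

end
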